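(* Let $G$ be a loopless multigraph with vertex set $V$ and, for each $v \in V$, let $M_v$ be a (possibly empty) multiset of positive integers. There is a packing of $G$ with stars such that $M_v$ is the multiset of sizes of stars centred at $v$ for each $v \in V$ if and only if $$\sum_{v \in V} \sigma_{f(v)}(M_v) \leq \sum_{\{u,v\} \in \binom{V}{2}}\min\bigl(f(u)+f(v),\mu_G(uv)\bigr)$$ for each function $f: V \rightarrow \mathbb{Z}$ such that $f(v) \in \{0,\ldots,|M_v|\}$ for each $v \in V$. Furthermore, there is a polynomial time (in the problem's input size) algorithm for deciding whether such a packing exists, and constructing one if so.
   Context: Multigraphs are finite. For a positive integer $m$, an $m$-star (star of size $m$) is a connected simple graph with $m$ edges, all incident with a single vertex; for $m\geq 2$ this vertex is unique and is called the centre, and each $1$-star is assumed to have exactly one of its two vertices designated as its centre. $\mu_G(uv)$ is the number of edges of $G$ between distinct vertices $u$ and $v$. A decomposition $\mathcal{D}$ of a multigraph $G$ is a collection of sub-multigraphs of $G$ with $\sum_{H\in\mathcal{D}}\mu_H(uv)=\mu_G(uv)$ for all distinct vertices $u,v$; a packing of $G$ is a decomposition of some sub-multigraph of $G$. $\binom{V}{2}$ is the set $\{\{u,v\}: u,v\in V, u\neq v\}$. For a multiset $M$ of positive integers and $i\in\{0,\ldots,|M|\}$, $\sigma_i(M)$ is the sum of the largest $i$ elements of $M$ (counted with multiplicity). Input: the multiplicity function $\mu_G$, represented by a sequence of $\binom{|V|}{2}$ nonnegative integers, together with, for each $v\in V$, the sequence $m_{v,1},\ldots,m_{v,|M_v|}$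 of elements of $M_v$. Thus the input size $|I|$ satisfies $|I|\geq \sum_{\{u,v\}\in\binom{V}{2}}\log(\mu_G(uv)+1)+\sum_{v\in V}\sum_{i=1}^{|M_v|}\log(m_{v,i}+1)$. *)

theory Defs
  imports "HOL-Library.Multiset" "HOL-Computational_Algebra.Polynomial"
begin

text \<open>Loopless multigraphs. An edge is its set of two ends; parallel edges are repeated
  elements of the multiset of edges.\<close>

record 'a multigraph =
  verts :: "'a set"
  edges :: "'a set multiset"

definition pairs :: "'a set \<Rightarrow> 'a set set" where
  "pairs V = {{u, v} | u v. u \<in> V \<and> v \<in> V \<and> u \<noteq> v}"

definition multigraph :: "'a multigraph \<Rightarrow> bool" where
  "multigraph G \<longleftrightarrow> finite (verts G) \<and> set_mset (edges G) \<subseteq> pairs (verts G)"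

definition mult :: "'a multigraph \<Rightarrow> 'a \<Rightarrow> 'a \<Rightarrow> nat" where
  "mult G u v = count (edges G) {u, v}"

definition submultigraph :: "'a multigraph \<Rightarrow> 'a multigraph \<Rightarrow> bool" where
  "submultigraph H G \<longleftrightarrow>
     multigraph H \<and> verts H \<subseteq> verts G \<and> edges H \<subseteq># edges G"

definition decomposition :: "'a multigraph \<Rightarrow> 'a multigraph multiset \<Rightarrow> bool" where
  "decomposition G D \<longleftrightarrow>
     (\<forall>H \<in># D. submultigraph H G) \<and>
     (\<forall>u \<in> verts G. \<forall>v \<in> verts G. u \<noteq> v \<longrightarrow> (\<Sum>H \<in># D. mult H u v) = mult G u v)"

definition packing :: "'a multigraph \<Rightarrow> 'a multigraph multiset \<Rightarrow> bool" where
  "packing G D \<longleftrightarrow> (\<exists>G'. submultigraph G' G \<and> decomposition G' D)"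

definition simple :: "'a multigraph \<Rightarrow> bool" where
  "simple H \<longleftrightarrow> multigraph H \<and> (\<forall>e. count (edges H) e \<le> 1)"

definition connected_graph :: "'a multigraph \<Rightarrow> bool" where
  "connected_graph H \<longleftrightarrow>
     verts H \<noteq> {} \<and> (\<forall>u \<in> verts H. \<forall>v \<in> verts H. (u, v) \<in> {(x, y). {x, y} \<in># edges H}\<^sup>*)"

text \<open>\<open>star m c H\<close>: \<open>H\<close> is an \<open>m\<close>-star with centre \<open>c\<close>. For \<open>m \<ge> 2\<close> the centre is
  determined by \<open>H\<close>; for \<open>m = 1\<close> either end may play this role, which is why packings with
  stars below consist of pairs of a designated centre and a star.\<close>

definition star :: "nat \<Rightarrow> 'a \<Rightarrow> 'a multigraph \<Rightarrow> bool" where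
  "star m c H \<longleftrightarrow>
     m > 0 \<and> simple H \<and> connected_graph H \<and> size (edges H) = m \<and> (\<forall>e \<in># edges H. c \<in> e)"

definition star_packing ::
    "'a multigraph \<Rightarrow> ('a \<Rightarrow> nat multiset) \<Rightarrow> ('a \<times> 'a multigraph) multiset \<Rightarrow> bool" where
  "star_packing G M P \<longleftrightarrow>
     packing G (image_mset snd P) \<and>
     (\<forall>(c, H) \<in># P. star (size (edges H)) c H) \<and>
     (\<forall>v \<in> verts G. {#size (edges H). (c, H) \<in># filter_mset (\<lambda>(c, H). c = v) P#} = M v)"

definition sum_largest :: "nat \<Rightarrow> nat multiset \<Rightarrow> nat" where
  "sum_largest i M = sum_list (take i (rev (sorted_list_of_multiset M)))"


text \<open>Deterministic multi-tape Turing machines with two-way infinite tapes. Symbols and states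
  are numbers; symbol 0 is the blank, state 0 is the initial state, and \<open>states T\<close> itself is the
  unique halting state. The transition function matters only on the finite domain that
  \<open>turing_machine\<close> constrains.\<close>

datatype move = Left | Stay | Right

record tm =
  tapes :: nat
  states :: nat
  symbols :: nat
  trans :: "nat \<Rightarrow> nat list \<Rightarrow> nat \<times> (nat \<times> move) list"

definition turing_machine :: "tm \<Rightarrow> bool" where
  "turing_machine T \<longleftrightarrow>
     tapes T > 0 \<and> symbols T > 0 \<and>
     (\<forall>q rs. q < states T \<and> length rs = tapes T \<and> set rs \<subseteq> {..<symbols T} \<longrightarrow>
        (case trans T q rs of (q', as) \<Rightarrow>
           q' \<le> states T \<and> length as = tapes T \<and> fst ` set as \<subseteq> {..<symbols T}))"

text \<open>A tape is a head position together with the cell contents.\<close>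

type_synonym tape = "int \<times> (int \<Rightarrow> nat)"
type_synonym config = "nat \<times> tape list"

fun shift :: "move \<Rightarrow> int" where
  "shift Left = -1"
| "shift Stay = 0"
| "shift Right = 1"

fun act :: "nat \<times> move \<Rightarrow> tape \<Rightarrow> tape" where
  "act (s, d) (h, c) = (h + shift d, c(h := s))"

fun step :: "tm \<Rightarrow> config \<Rightarrow> config" where
  "step T (q, ts) =
     (if q < states T
      then (case trans T q (map (\<lambda>(h, c). c h) ts) of (q', as) \<Rightarrow> (q', map2 act as ts))
      else (q, ts))"

definition word_cells :: "nat list \<Rightarrow> int \<Rightarrow> nat" where
  "word_cells w i = (if 0 \<le> i \<and> nat i < length w then w ! nat i else 0)"

definition init :: "tm \<Rightarrow> nat list \<Rightarrow> config" where
  "init T w = (0, (0, word_cells w) # replicate (tapes T - 1) (0, \<lambda>_. 0))"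

text \<open>The output is read off the first tape, from cell 0 up to the first blank. As halting
  configurations do not change, \<open>t\<close> is an upper bound on the number of steps.\<close>

definition outputs_within :: "tm \<Rightarrow> nat list \<Rightarrow> nat list \<Rightarrow> nat \<Rightarrow> bool" where
  "outputs_within T w y t \<longleftrightarrow>
     (\<exists>h c ts. (step T ^^ t) (init T w) = (states T, (h, c) # ts) \<and>
        0 \<notin> set y \<and> (\<forall>i < length y. c (int i) = y ! i) \<and> c (int (length y)) = 0)"

text \<open>A polynomial time algorithm for a search problem: instances \<open>x \<in> X\<close> are presented as words
  \<open>enc x\<close>, and \<open>ok x y\<close> says that \<open>y\<close> is a correct answer to \<open>x\<close>.\<close>

definition poly_time_solvable ::
    "'i set \<Rightarrow> ('i \<Rightarrow> nat list) \<Rightarrow> ('i \<Rightarrow> nat list \<Rightarrow> bool) \<Rightarrow> bool" where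
  "poly_time_solvable X enc ok \<longleftrightarrow>
     (\<exists>T (p :: nat poly). turing_machine T \<and>
        (\<forall>x \<in> X. set (enc x) \<subseteq> {0<..<symbols T} \<and>
           (\<exists>y. ok x y \<and> outputs_within T (enc x) y (poly p (length (enc x))))))"


text \<open>Words over the symbols 1 and 2 (the bits 0 and 1), 3 (ends a number) and 4 (ends a list).
  Binary notation is least significant bit first and has length \<open>\<lceil>log 2 (n + 1)\<rceil>\<close>; in
  particular 0 is the empty word.\<close>

fun binary :: "nat \<Rightarrow> nat list" where
  "binary n = (if n = 0 then [] else (1 + n mod 2) # binary (n div 2))"

declare binary.simps [simp del]

definition encode_lists :: "nat list list \<Rightarrow> nat list" where
  "encode_lists xss = concat (map (\<lambda>xs. concat (map (\<lambda>x. binary x @ [3]) xs) @ [4]) xss)"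

text \<open>An instance is a multigraph on \<open>{..<n}\<close> together with the sequences of elements of
  \<open>M\<^sub>0, \<dots>, M\<^sub>n\<^sub>-\<^sub>1\<close>; it is presented as the sequence of multiplicities of all pairs \<open>u < v\<close>,
  in lexicographic order, followed by these sequences.\<close>

definition instances :: "(nat multigraph \<times> nat list list) set" where
  "instances = {(G, Ms). multigraph G \<and> verts G = {..<length Ms} \<and>
     (\<forall>ms \<in> set Ms. \<forall>m \<in> set ms. m > 0)}"

fun encode_instance :: "nat multigraph \<times> nat list list \<Rightarrow> nat list" where
  "encode_instance (G, Ms) =
     encode_lists ([mult G u v. u \<leftarrow> [0..<length Ms], v \<leftarrow> [Suc u..<length Ms]] # Ms)"

text \<open>An answer is either the bit 0, meaning that there is no packing, or the bit 1 followed by a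
  packing, where each star is listed as its centre followed by its leaves.\<close>

fun star_of :: "'a \<times> 'a list \<Rightarrow> 'a \<times> 'a multigraph" where
  "star_of (c, ls) = (c, \<lparr>verts = insert c (set ls), edges = mset (map (\<lambda>l. {c, l}) ls)\<rparr>)"

fun encode_answer :: "(nat \<times> nat list) list option \<Rightarrow> nat list" where
  "encode_answer None = [1]"
| "encode_answer (Some S) = 2 # encode_lists (map (\<lambda>(c, ls). c # ls) S)"

fun correct_answer :: "nat multigraph \<times> nat list list \<Rightarrow> nat list \<Rightarrow> bool" where
  "correct_answer (G, Ms) y \<longleftrightarrow>
     (if \<exists>P. star_packing G (\<lambda>v. mset (Ms ! v)) P
      then \<exists>S. star_packing G (\<lambda>v. mset (Ms ! v)) (mset (map star_of S)) \<and>
             y = encode_answer (Some S)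
      else y = encode_answer None)"

end

theory Submission
  imports Defs
begin

text \<open>Call the prescribed stars and the pairs of vertices \<^emph>\<open>nodes\<close>, and join a
  star to a pair when its centre lies in the pair. A packing selects, for every star, as many of its pairs
  as its size says, so that a pair \<open>e\<close> is selected at most \<open>\<mu>(e)\<close> times. Read
  a selected edge of this bipartite graph as owned by its pair and an unselected one as owned by its star.
  Then packings become orientations in which a pair owns at most \<open>\<mu>(e)\<close> edges and a star of
  size \<open>m\<close> owns \<open>n - 1 - m\<close> edges, where \<open>n\<close> is the number of
  vertices. So everything rests on the problem of distributing the edges of a graph among their ends such
  that no node receives more than its capacity. A set of nodes that spans more edges than its total capacity
  is an obvious obstruction, and it is the only one. For the graph above, the absence of obstructions says
  that any set of stars asks for no more edges than \<open>\<Sum> min (number of stars centred in e)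
  \<mu>(e)\<close>. Among the sets that contain \<open>f(v)\<close> stars centred at \<open>v\<close>, those
  with the largest stars are critical, and this gives the condition of the theorem
  (\<open>feasible_iff_hall\<close>, \<open>packing_iff_hall\<close>, \<open>star_packing_iff\<close>).

  That obstructions are the only obstacle is shown by a push-relabel procedure. Every node has a height, and
  an edge owned by a node leads down by at most one level. An overloaded node hands an edge to a lower
  neighbour, or it is raised by one if there is none. A potential grows with each of these moves
  (\<open>push\<close>, \<open>relabel\<close>) and it is polynomially bounded
  (\<open>potential_le\<close>), so the procedure stops soon. If an overloaded node reaches a height that is
  not below the number of nodes, some lower level is empty, and the nodes above the empty level own only
  edges among themselves: they form an obstruction (\<open>stuck\<close>). If every star owns all its edges
  at the beginning, then no star ever owns too few, so at the end all stars have exactly the prescribed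
  sizes. Taken to its extreme, a state of maximal potential, the procedure proves the first half of the
  theorem; executed, it is the algorithm of the second half.

  The moves are local and need neither path searching nor arithmetic, which makes them suitable for a Turing
  machine. The machine is not written down directly. It is compiled from a language with bounded loops whose
  variables take values below the input length \<open>N\<close> and whose arrays are indexed by up to three
  variables. The language has no other loops, so that its programs are total functions on states
  (\<open>run\<close>) and take polynomial time whatever they compute (\<open>compile_correct\<close>,
  \<open>poly_time_solvable_run\<close>). What remains is to verify one program in this language
  (\<open>solve_correct\<close>): it reads the instance, runs the push-relabel procedure for \<open>3
  N\<^sup>3\<close> rounds, and writes the stars. All multiplicities and sizes may be cut off at \<open>N -
  1\<close>: there are fewer than \<open>N\<close> stars, and no star with \<open>n\<close> or more edges
  fits.\<close>

section \<open>Tape programs and their code\<close>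

text \<open>Structured programs that act on one tape at a time. The test of \<open>IFT j s c d\<close> is
  whether tape \<open>j\<close> shows the symbol \<open>s\<close>, and \<open>WHT j s c\<close> repeats
  \<open>c\<close> \<^emph>\<open>until\<close> tape \<open>j\<close> shows \<open>s\<close>.\<close>

datatype tcom = Mv nat move | Wr nat nat | SEQ tcom tcom | IFT nat nat tcom tcom | WHT nat nat tcom

text \<open>Tapes are kept in a function, so that acting on a tape is a function update and acts on
  different tapes commute by rewriting. A machine uses an initial segment of them.\<close>

type_synonym tapes = "nat \<Rightarrow> tape"

definition under_head :: "tape \<Rightarrow> nat" where "under_head T = snd T (fst T)"

text \<open>The number counts the steps of the code below, which spends a step on each test and on each
  jump.\<close>

inductive exec :: "tcom \<Rightarrow> nat \<Rightarrow> tapes \<Rightarrow> tapes \<Rightarrow> bool" where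
  Mv: "exec (Mv j d) 1 F (F(j := (fst (F j) + shift d, snd (F j))))"
| Wr: "exec (Wr j s) 1 F (F(j := (fst (F j), (snd (F j))(fst (F j) := s))))"
| SEQ: "exec c t F F' \<Longrightarrow> exec d t' F' F'' \<Longrightarrow> exec (SEQ c d) (t + t') F F''"
| IFT1: "under_head (F j) = s \<Longrightarrow> exec c t F F' \<Longrightarrow> exec (IFT j s c d) (t + 2) F F'"
| IFT2: "under_head (F j) \<noteq> s \<Longrightarrow> exec d t F F' \<Longrightarrow> exec (IFT j s c d) (t + 1) F F'"
| WHT1: "under_head (F j) = s \<Longrightarrow> exec (WHT j s c) 1 F F"
| WHT2: "under_head (F j) \<noteq> s \<Longrightarrow> exec c t F F' \<Longrightarrow> exec (WHT j s c) t' F' F'' \<Longrightarrow>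
           exec (WHT j s c) (t + t' + 2) F F''"

fun len :: "tcom \<Rightarrow> nat" where
  "len (Mv j d) = 1"
| "len (Wr j s) = 1"
| "len (SEQ c d) = len c + len d"
| "len (IFT j s c d) = len c + len d + 2"
| "len (WHT j s c) = len c + 2"

fun tape_ok :: "nat \<Rightarrow> nat \<Rightarrow> tcom \<Rightarrow> bool" where
  "tape_ok K S (Mv j d) \<longleftrightarrow> j < K"
| "tape_ok K S (Wr j s) \<longleftrightarrow> j < K \<and> s < S"
| "tape_ok K S (SEQ c d) \<longleftrightarrow> tape_ok K S c \<and> tape_ok K S d"
| "tape_ok K S (IFT j s c d) \<longleftrightarrow> j < K \<and> tape_ok K S c \<and> tape_ok K S d"
| "tape_ok K S (WHT j s c) \<longleftrightarrow> j < K \<and> tape_ok K S c"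

abbreviation idle :: "nat list \<Rightarrow> (nat \<times> move) list" where
  "idle rs \<equiv> map (\<lambda>r. (r, Stay)) rs"

definition shift_state :: "nat \<Rightarrow> nat \<times> 'b \<Rightarrow> nat \<times> 'b" where "shift_state n = apfst (\<lambda>q. n + q)"

lemma shift_state_simps [simp]: "shift_state n (q, a) = (n + q, a)" "fst (shift_state n x) = n + fst x" "snd (shift_state n x) = snd x"
  by (simp_all add: shift_state_def)

lemma shift_state_twice [simp]: "shift_state m (shift_state n x) = shift_state (m + n) x"
  by (cases x) simp

text \<open>States are relative to the start of the piece of code: execution begins in state
  \<open>0\<close> and ends in state \<open>len c\<close>, the first state that is not part of the code. So
  pieces can be placed at any offset, and the whole program halts in the right state. In a conditional,
  state \<open>0\<close> is the test and state \<open>len c + 1\<close> jumps over the second branch; in a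
  loop, state \<open>len c + 1\<close> jumps back.\<close>

fun code :: "tcom \<Rightarrow> nat \<Rightarrow> nat list \<Rightarrow> nat \<times> (nat \<times> move) list" where
  "code (Mv j d) q rs = (1, (idle rs)[j := (rs ! j, d)])"
| "code (Wr j s) q rs = (1, (idle rs)[j := (s, Stay)])"
| "code (SEQ c d) q rs =
     (if q < len c then code c q rs else shift_state (len c) (code d (q - len c) rs))"
| "code (IFT j s c d) q rs =
     (if q = 0 then (if rs ! j = s then 1 else len c + 2, idle rs)
      else if q \<le> len c then shift_state 1 (code c (q - 1) rs)
      else if q = len c + 1 then (len c + len d + 2, idle rs)
      else shift_state (len c + 2) (code d (q - (len c + 2)) rs))"
| "code (WHT j s c) q rs =
     (if q = 0 then (if rs ! j = s then len c + 2 else 1, idle rs)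
      else if q \<le> len c then shift_state 1 (code c (q - 1) rs)
      else (0, idle rs))"

definition machine :: "nat \<Rightarrow> nat \<Rightarrow> tcom \<Rightarrow> tm" where
  "machine K S c = \<lparr>tapes = K, states = len c, symbols = S, trans = code c\<rparr>"

lemma code_ok:
  assumes "tape_ok K S c" "q < len c" "length rs = K" "set rs \<subseteq> {..<S}"
  shows "fst (code c q rs) \<le> len c \<and> length (snd (code c q rs)) = K \<and>
         fst ` set (snd (code c q rs)) \<subseteq> {..<S}"
  using assms
proof (induction c arbitrary: q)
  case (Mv j d)
  have "set ((idle rs)[j := (rs ! j, d)]) \<subseteq> insert (rs ! j, d) (set (idle rs))"
    by (rule set_update_subset_insert)
  moreover have "rs ! j \<in> {..<S}" using Mv by (auto dest: nth_mem)
  ultimately show ?case using Mv by fastforce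
next
  case (Wr j s)
  have "set ((idle rs)[j := (s, Stay)]) \<subseteq> insert (s, Stay) (set (idle rs))"
    by (rule set_update_subset_insert)
  then show ?case using Wr by fastforce
next
  case (SEQ c d)
  then show ?case using SEQ.IH(1)[of q] SEQ.IH(2)[of "q - len c"] by (auto intro: trans_le_add1)
next
  case (IFT j s c d)
  show ?case
  proof (cases "q = 0 \<or> q = len c + 1")
    case True
    then show ?thesis using IFT by auto
  next
    case False
    then consider "0 < q" "q \<le> len c" | "len c + 1 < q" by linarith
    then show ?thesis
    proof cases
      case 1
      then have "fst (code c (q - 1) rs) \<le> len c \<and> length (snd (code c (q - 1) rs)) = K \<and>
         fst ` set (snd (code c (q - 1) rs)) \<subseteq> {..<S}"
        using IFT by (intro IFT.IH(1)) auto
      then show ?thesis using 1 by auto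
    next
      case 2
      then have "fst (code d (q - (len c + 2)) rs) \<le> len d \<and>
         length (snd (code d (q - (len c + 2)) rs)) = K \<and>
         fst ` set (snd (code d (q - (len c + 2)) rs)) \<subseteq> {..<S}"
        using IFT by (intro IFT.IH(2)) auto
      then show ?thesis using 2 by auto
    qed
  qed
next
  case (WHT j s c)
  show ?case
  proof (cases "q = 0 \<or> q = len c + 1")
    case True
    then show ?thesis using WHT by auto
  next
    case False
    then have "fst (code c (q - 1) rs) \<le> len c \<and> length (snd (code c (q - 1) rs)) = K \<and>
         fst ` set (snd (code c (q - 1) rs)) \<subseteq> {..<S}"
      using WHT.prems by (intro WHT.IH) auto
    then show ?thesis using False WHT.prems by auto
  qed
qed

lemma turing_machine_machine:
  assumes "tape_ok K S c" "K > 0" "S > 0"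
  shows "turing_machine (machine K S c)"
  using assms code_ok[OF assms(1)]
  by (auto simp: turing_machine_def machine_def split: prod.split) (metis fst_conv snd_conv image_subset_iff lessThan_iff)+

abbreviation conf :: "nat \<Rightarrow> tapes \<Rightarrow> tape list" where "conf K F \<equiv> map F [0..<K]"

text \<open>The transitions of the machine from state \<open>a\<close> on are those of the code of
  \<open>c\<close>, shifted.\<close>

definition embedded :: "tm \<Rightarrow> nat \<Rightarrow> tcom \<Rightarrow> bool" where
  "embedded T a c \<longleftrightarrow> a + len c \<le> states T \<and>
     (\<forall>q rs. q < len c \<longrightarrow> trans T (a + q) rs = shift_state a (code c q rs))"

lemma embedded_part:
  assumes "embedded T a C" "k + len c \<le> len C"
    and "\<And>q rs. q < len c \<Longrightarrow> code C (k + q) rs = shift_state k (code c q rs)"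
  shows "embedded T (a + k) c"
  using assms unfolding embedded_def by (auto simp: add.assoc)

lemma step_conf:
  assumes "q < states T" "trans T q (map (\<lambda>j. under_head (F j)) [0..<K]) = (q', as)"
  shows "step T (q, conf K F) = (q', map2 act as (conf K F))"
proof -
  have *: "(\<lambda>(h, c). c h) = under_head" by (auto simp: under_head_def)
  show ?thesis using assms by (simp add: * comp_def)
qed

lemma act_alt: "act a x = (fst x + shift (snd a), (snd x)(fst x := fst a))"
  by (cases a; cases x) simp

lemma map2_act_idle: "map2 act (idle (map (\<lambda>j. under_head (F j)) [0..<K])) (conf K F) = conf K F"
  by (rule nth_equalityI) (auto simp: under_head_def act_alt intro!: prod_eqI)

lemma map2_act_update:
  assumes "j < K"
  shows "map2 act ((idle (map (\<lambda>j. under_head (F j)) [0..<K]))[j := a]) (conf K F) = conf K (F(j := act a (F j)))"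
  using assms
  by (intro nth_equalityI) (auto simp: under_head_def act_alt nth_list_update)

lemma step_idle:
  assumes "q < states T"
    "trans T q (map (\<lambda>j. under_head (F j)) [0..<K]) = (q', idle (map (\<lambda>j. under_head (F j)) [0..<K]))"
  shows "step T (q, conf K F) = (q', conf K F)"
  using step_conf[OF assms] by (simp only: map2_act_idle)

lemma nth_rd: "j < K \<Longrightarrow> map (\<lambda>j. under_head (F j)) [0..<K] ! j = under_head (F j)"
  by simp

declare step.simps [simp del]

text \<open>By induction on the execution: the parts of a program are embedded at larger offsets, and the
  steps between them change only the state.\<close>

lemma exec_machine:
  assumes "exec c t F F'" "tape_ok K S c" "embedded T a c"
  shows "(step T ^^ t) (a, conf K F) = (a + len c, conf K F')"
  using assms
proof (induction arbitrary: a rule: exec.induct)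
  case (Mv j d F)
  then have 1: "trans T a rs = shift_state a (code (Mv j d) 0 rs)" "a < states T" for rs
    using Mv by (auto simp: embedded_def)
  show ?case using Mv
    by (simp add: step_conf[OF 1(2) 1(1)[unfolded code.simps shift_state_simps]] map2_act_update
      act_alt[of "(under_head (F j), d)"] nth_rd del: map_map upt_Suc) (simp add: under_head_def)
next
  case (Wr j s F)
  then have 1: "trans T a rs = shift_state a (code (Wr j s) 0 rs)" "a < states T" for rs
    using Wr by (auto simp: embedded_def)
  show ?case using Wr
    by (simp add: step_conf[OF 1(2) 1(1)[unfolded code.simps shift_state_simps]] map2_act_update
      act_alt[of "(s, Stay)"] nth_rd del: map_map upt_Suc)
next
  case (SEQ c t F F' d t' F'')
  have "embedded T a c"
    using embedded_part[OF SEQ.prems(2), of 0 c] by (simp add: shift_state_def prod_eq_iff)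
  moreover have "embedded T (a + len c) d"
    using embedded_part[OF SEQ.prems(2), of "len c" d] by simp
  moreover have "tape_ok K S c" "tape_ok K S d" using SEQ.prems by auto
  ultimately have "(step T ^^ t) (a, conf K F) = (a + len c, conf K F')"
    "(step T ^^ t') (a + len c, conf K F') = (a + len c + len d, conf K F'')"
    using SEQ.IH by blast+
  then have "(step T ^^ (t' + t)) (a, conf K F) = (a + len c + len d, conf K F'')"
    by (simp add: funpow_add)
  then show ?case by (simp add: add.commute[of t'] add.assoc)
next
  case (IFT1 F j s c t F' d)
  have e: "a + len c + 2 \<le> states T" "j < K" "tape_ok K S c"
    using IFT1.prems unfolding embedded_def by (auto simp: add.assoc)
  have e': "embedded T (a + 1) c"
    by (rule embedded_part[OF IFT1.prems(2)]) auto
  have tr: "trans T (a + q) rs = shift_state a (code (IFT j s c d) q rs)" if "q < len c + 2" for q rs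
    using IFT1.prems that unfolding embedded_def by auto
  have 1: "step T (a, conf K F) = (a + 1, conf K F)"
    by (rule step_idle) (use e tr[of 0] IFT1.hyps in \<open>auto\<close>)
  have 2: "(step T ^^ t) (a + 1, conf K F) = (a + 1 + len c, conf K F')"
    using IFT1.IH(1) e e' by blast
  have 3: "step T (a + 1 + len c, conf K F') = (a + len (IFT j s c d), conf K F')"
    by (rule step_idle) (use e tr[of "len c + 1"] in \<open>auto simp: ac_simps\<close>)
  have "(step T ^^ (1 + t + 1)) (a, conf K F) = (a + len (IFT j s c d), conf K F')"
    using 1 2 3 by (simp add: funpow_swap1)
  then show ?case by simp
next
  case (IFT2 F j s d t F' c)
  have e: "a + len c + 2 \<le> states T" "j < K" "tape_ok K S d"
    using IFT2.prems unfolding embedded_def by (auto simp: add.assoc)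
  have e': "embedded T (a + len c + 2) d"
    using embedded_part[OF IFT2.prems(2), of "len c + 2" d] by (simp add: add.assoc)
  have tr: "trans T (a + q) rs = shift_state a (code (IFT j s c d) q rs)" if "q < len c + 2" for q rs
    using IFT2.prems that unfolding embedded_def by auto
  have 1: "step T (a, conf K F) = (a + len c + 2, conf K F)"
    by (rule step_idle) (use e tr[of 0] IFT2.hyps in \<open>auto\<close>)
  have 2: "(step T ^^ t) (a + len c + 2, conf K F) = (a + len c + 2 + len d, conf K F')"
    using IFT2.IH(1) e e' by blast
  have "(step T ^^ (1 + t)) (a, conf K F) = (a + len (IFT j s c d), conf K F')"
    using 1 2 by (simp add: funpow_swap1 ac_simps)
  then show ?case by simp
next
  case (WHT1 F j s c)
  have e: "a + len c + 2 \<le> states T" "j < K"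
    using WHT1.prems unfolding embedded_def by (auto simp: add.assoc)
  have tr: "trans T (a + q) rs = shift_state a (code (WHT j s c) q rs)" if "q < len c + 2" for q rs
    using WHT1.prems that unfolding embedded_def by auto
  have 1: "step T (a, conf K F) = (a + len c + 2, conf K F)"
    by (rule step_idle) (use e tr[of 0] WHT1.hyps in \<open>auto\<close>)
  then show ?case by simp
next
  case (WHT2 F j s c t F' t' F'')
  have e: "a + len c + 2 \<le> states T" "j < K" "tape_ok K S c"
    using WHT2.prems unfolding embedded_def by (auto simp: add.assoc)
  have e': "embedded T (a + 1) c"
    by (rule embedded_part[OF WHT2.prems(2)]) auto
  have tr: "trans T (a + q) rs = shift_state a (code (WHT j s c) q rs)" if "q < len c + 2" for q rs
    using WHT2.prems that unfolding embedded_def by auto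
  have 1: "step T (a, conf K F) = (a + 1, conf K F)"
    by (rule step_idle) (use e tr[of 0] WHT2.hyps in \<open>auto\<close>)
  have 2: "(step T ^^ t) (a + 1, conf K F) = (a + 1 + len c, conf K F')"
    using WHT2.IH(1) e e' by blast
  have 3: "step T (a + 1 + len c, conf K F') = (a, conf K F')"
    by (rule step_idle) (use e tr[of "len c + 1"] in \<open>auto simp: ac_simps\<close>)
  have 4: "(step T ^^ t') (a, conf K F') = (a + len (WHT j s c), conf K F'')"
    using WHT2.IH(2) WHT2.prems by blast
  have "(step T ^^ (t' + (1 + t + 1))) (a, conf K F) = (a + len (WHT j s c), conf K F'')"
    unfolding funpow_add comp_def using 1 2 3 4 by (simp add: funpow_swap1)
  then show ?case by (simp add: ac_simps)
qed

text \<open>Halting configurations persist, so an upper bound on the number of steps may be used in place of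
  the exact number.\<close>

lemma funpow_step_halted: "(step T ^^ n) (states T, ts) = (states T, ts)"
  by (induction n) (auto simp: step.simps)

section \<open>Moving heads in polynomial time\<close>

definition runs_in :: "tcom \<Rightarrow> nat \<Rightarrow> tapes \<Rightarrow> tapes \<Rightarrow> bool" where
  "runs_in c b F F' \<longleftrightarrow> (\<exists>t\<le>b. exec c t F F')"

lemma runs_in_mono: "runs_in c b F F' \<Longrightarrow> b \<le> b' \<Longrightarrow> runs_in c b' F F'"
  by (auto simp: runs_in_def intro: order_trans)

lemma runs_in_Mv: "runs_in (Mv j d) 1 F (F(j := (fst (F j) + shift d, snd (F j))))"
  unfolding runs_in_def by (rule exI[of _ 1]) (use exec.Mv in blast)

lemma runs_in_Wr: "runs_in (Wr j s) 1 F (F(j := (fst (F j), (snd (F j))(fst (F j) := s))))"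
  unfolding runs_in_def by (rule exI[of _ 1]) (use exec.Wr in blast)

lemma runs_in_SEQ: "runs_in c b F F' \<Longrightarrow> runs_in d b' F' F'' \<Longrightarrow> runs_in (SEQ c d) (b + b') F F''"
  unfolding runs_in_def by (meson add_mono exec.SEQ)

lemma runs_in_IFT:
  assumes "under_head (F j) = s \<Longrightarrow> runs_in c b F F'" "under_head (F j) \<noteq> s \<Longrightarrow> runs_in d b F F'"
  shows "runs_in (IFT j s c d) (b + 2) F F'"
proof (cases "under_head (F j) = s")
  case True
  then obtain t where "t \<le> b" "exec c t F F'" using assms by (auto simp: runs_in_def)
  then show ?thesis unfolding runs_in_def using exec.IFT1[where F = F and j = j and s = s and c = c and d = d and F' = F' and t = t]  True
    by (intro exI[of _ "t + 2"]) auto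
next
  case False
  then obtain t where "t \<le> b" "exec d t F F'" using assms by (auto simp: runs_in_def)
  then show ?thesis unfolding runs_in_def using exec.IFT2[where F = F and j = j and s = s and c = c and d = d and F' = F' and t = t]  False
    by (intro exI[of _ "t + 1"]) auto
qed

text \<open>The invariant is indexed by the number of completed rounds. It determines when the loop ends, so
  the total time is known.\<close>

lemma runs_in_WHT:
  assumes "P 0 F"
    and "\<And>i G. i < n \<Longrightarrow> P i G \<Longrightarrow> under_head (G j) \<noteq> s \<and> (\<exists>G'. runs_in c b G G' \<and> P (Suc i) G')"
    and "\<And>G. P n G \<Longrightarrow> under_head (G j) = s"
  shows "\<exists>G. runs_in (WHT j s c) (n * (b + 2) + 1) F G \<and> P n G"
proof -
  have "\<exists>G. runs_in (WHT j s c) (k * (b + 2) + 1) F G \<and> P n G" if "k \<le> n" "P (n - k) F" for k F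
    using that
  proof (induction k arbitrary: F)
    case 0
    then show ?case using exec.WHT1[of F j s c] assms(3)[of F] by (auto simp: runs_in_def)
  next
    case (Suc k)
    then have *: "n - Suc k < n" "Suc (n - Suc k) = n - k" by auto
    from assms(2)[OF *(1) Suc.prems(2)] obtain G where
      G: "under_head (F j) \<noteq> s" "runs_in c b F G" "P (n - k) G" by (auto simp: *(2))
    with Suc obtain G' where G': "runs_in (WHT j s c) (k * (b + 2) + 1) G G'" "P n G'" by auto
    obtain t t' where t: "t \<le> b" "exec c t F G" "t' \<le> k * (b + 2) + 1" "exec (WHT j s c) t' G G'"
      using G G' by (auto simp: runs_in_def)
    have "exec (WHT j s c) (t + t' + 2) F G'" by (rule exec.WHT2) (use G(1) t in auto)
    moreover have "t + t' + 2 \<le> Suc k * (b + 2) + 1" using t(1,3) by simp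
    ultimately show ?case using G'(2) unfolding runs_in_def by blast
  qed
  from this[of n] assms(1) show ?thesis by simp
qed

lemma runs_in_WHT_seq:
  assumes "\<And>i. i < n \<Longrightarrow> under_head (f i j) \<noteq> s \<and> runs_in c b (f i) (f (Suc i))" "under_head (f n j) = s"
  shows "runs_in (WHT j s c) (n * (b + 2) + 1) (f 0) (f n)"
  using runs_in_WHT[of "\<lambda>i G. G = f i" "f 0" n j s c b] assms by auto

text \<open>On all tapes but tape \<open>0\<close>, cell \<open>-1\<close> holds the end marker
  \<open>5\<close>, which occurs nowhere else. Rewinding stops to the right of it.\<close>

definition rewind :: "nat \<Rightarrow> tcom" where
  "rewind j = SEQ (WHT j 5 (Mv j Left)) (Mv j Right)"

lemma runs_in_rewind:
  assumes "F j = (int h, c)" "c (-1) = 5" "\<And>i. 0 \<le> i \<Longrightarrow> i \<le> int h \<Longrightarrow> c i \<noteq> 5" "h \<le> n"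
  shows "runs_in (rewind j) (3 * n + 5) F (F(j := (0, c)))"
proof -
  let ?f = "\<lambda>i. F(j := (int h - int i, c))"
  have "runs_in (WHT j 5 (Mv j Left)) (Suc h * (1 + 2) + 1) (?f 0) (?f (Suc h))"
  proof (rule runs_in_WHT_seq, intro conjI)
    fix i assume "i < Suc h"
    then show "under_head (?f i j) \<noteq> 5" using assms(3)[of "int h - int i"] by (simp add: under_head_def)
    show "runs_in (Mv j Left) 1 (?f i) (?f (Suc i))"
      using runs_in_Mv[of j Left "?f i"] by (simp add: algebra_simps)
  qed (simp add: under_head_def assms(2))
  moreover have "runs_in (Mv j Right) 1 (?f (Suc h)) (F(j := (0, c)))"
    using runs_in_Mv[of j Right "?f (Suc h)"] by simp
  ultimately have "runs_in (rewind j) (Suc h * (1 + 2) + 1 + 1) (?f 0) (F(j := (0, c)))"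
    unfolding rewind_def by (rule runs_in_SEQ)
  moreover have "?f 0 = F" using assms(1) by auto
  ultimately show ?thesis using assms(4) by (auto elim: runs_in_mono)
qed

definition poly_bounded :: "(nat \<Rightarrow> nat) \<Rightarrow> bool" where
  "poly_bounded f \<longleftrightarrow> (\<exists>p :: nat poly. \<forall>N. f N \<le> poly p N)"

lemma poly_bounded_const [intro, simp]: "poly_bounded (\<lambda>_. k)"
  by (auto simp: poly_bounded_def intro: exI[of _ "[:k:]"])

lemma poly_bounded_id [intro, simp]: "poly_bounded (\<lambda>N. N)"
  by (auto simp: poly_bounded_def intro: exI[of _ "[:0, 1:]"])

lemma poly_bounded_add [intro]: "poly_bounded f \<Longrightarrow> poly_bounded g \<Longrightarrow> poly_bounded (\<lambda>N. f N + g N)"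
  unfolding poly_bounded_def by (metis add_mono poly_add)

lemma poly_bounded_mult [intro]: "poly_bounded f \<Longrightarrow> poly_bounded g \<Longrightarrow> poly_bounded (\<lambda>N. f N * g N)"
  unfolding poly_bounded_def by (metis mult_le_mono poly_mult)

lemma poly_bounded_Suc [intro]: "poly_bounded f \<Longrightarrow> poly_bounded (\<lambda>N. Suc (f N))"
  using poly_bounded_add[of f "\<lambda>_. 1"] by auto

text \<open>Tape \<open>0\<close> serves as input and output. Interleaving the tapes of variables and arrays
  leaves the numbers of both open.\<close>

definition var_tape :: "nat \<Rightarrow> nat" where "var_tape x = 2 * x + 1"
definition array_tape :: "nat \<Rightarrow> nat" where "array_tape a = 2 * a + 2"

lemma var_tape_array_tape [simp]: "var_tape x \<noteq> array_tape a" "array_tape a \<noteq> var_tape x" "var_tape x \<noteq> 0" "array_tape a \<noteq> 0" "0 \<noteq> var_tape x" "0 \<noteq> array_tape a"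
  "var_tape x = var_tape y \<longleftrightarrow> x = y" "array_tape a = array_tape b \<longleftrightarrow> a = b"
  unfolding var_tape_def array_tape_def by presburger+

text \<open>The contents of the tape of a variable with value \<open>x < N\<close>: the value is marked by
  \<open>1\<close>, and \<open>5\<close> and \<open>6\<close> mark the two ends of the range. The other use
  is \<open>var_cells N N\<close>, the tape without a mark.\<close>

definition var_cells :: "nat \<Rightarrow> nat \<Rightarrow> int \<Rightarrow> nat" where
  "var_cells N x = (\<lambda>i. if i = -1 then 5 else if i = int N then 6 else if i = int x then 1 else 0)"

lemma var_cells_simps [simp]: "var_cells N x (-1) = 5" "var_cells N x z = 5 \<longleftrightarrow> z = -1"
  "var_cells N x (int i) = 6 \<longleftrightarrow> i = N" "var_cells N x (int i) = Suc 0 \<longleftrightarrow> i = x \<and> i \<noteq> N"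
  by (auto simp: var_cells_def)

text \<open>Moves the head of an array by \<open>N ^ k\<close> cells. The tapes of the variables
  \<open>0\<close>, \<dots>, \<open>k - 1\<close> are the loop counters. Only their end markers are read, so
  the values of these variables do not matter and survive.\<close>

fun shift_by :: "nat \<Rightarrow> nat \<Rightarrow> tcom" where
  "shift_by a 0 = Mv (array_tape a) Right"
| "shift_by a (Suc k) = SEQ (WHT (var_tape k) 6 (SEQ (shift_by a k) (Mv (var_tape k) Right))) (rewind (var_tape k))"

fun tshift :: "nat \<Rightarrow> nat \<Rightarrow> nat" where
  "tshift N 0 = 1"
| "tshift N (Suc k) = (N * (tshift N k + 1 + 2) + 1) + (3 * N + 5)"

lemma poly_bounded_tshift: "poly_bounded (\<lambda>N. tshift N k)"
  by (induction k) (auto intro!: poly_bounded_add poly_bounded_mult poly_bounded_Suc)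

lemma runs_in_shift_by:
  assumes "\<And>j. j < k \<Longrightarrow> F (var_tape j) = (0, var_cells N (v j))" "F (array_tape a) = (p, c)"
  shows "runs_in (shift_by a k) (tshift N k) F (F(array_tape a := (p + int (N ^ k), c)))"
  using assms
proof (induction k arbitrary: F p)
  case 0
  then show ?case using runs_in_Mv[of "array_tape a" Right F] by (simp add: fun_upd_def)
next
  case (Suc k)
  let ?f = "\<lambda>i. F(array_tape a := (p + int (i * N ^ k), c), var_tape k := (int i, var_cells N (v k)))"
  have "runs_in (WHT (var_tape k) 6 (SEQ (shift_by a k) (Mv (var_tape k) Right))) (N * (tshift N k + 1 + 2) + 1) (?f 0) (?f N)"
  proof (rule runs_in_WHT_seq, intro conjI)
    fix i assume i: "i < N"
    then show "under_head (?f i (var_tape k)) \<noteq> 6" by (simp add: under_head_def)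
    have "runs_in (shift_by a k) (tshift N k) (?f i) ((?f i)(array_tape a := (p + int (i * N ^ k) + int (N ^ k), c)))"
      by (rule Suc.IH) (use Suc.prems in auto)
    from runs_in_SEQ[OF this runs_in_Mv[of "var_tape k" Right]]
    show "runs_in (SEQ (shift_by a k) (Mv (var_tape k) Right)) (tshift N k + 1) (?f i) (?f (Suc i))"
      by (simp add: fun_upd_twist algebra_simps)
  qed (simp add: under_head_def)
  moreover have "?f 0 = F" using Suc.prems by auto
  moreover have "runs_in (rewind (var_tape k)) (3 * N + 5) (?f N) ((?f N)(var_tape k := (0, var_cells N (v k))))"
    by (rule runs_in_rewind[where h = N]) auto
  moreover have "(?f N)(var_tape k := (0, var_cells N (v k))) = F(array_tape a := (p + int (N ^ Suc k), c))"
    using Suc.prems by (auto simp: fun_eq_iff)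
  ultimately show ?case unfolding shift_by.simps tshift.simps by (metis (no_types) runs_in_SEQ)
qed

text \<open>Indices are the digits of the address in base \<open>N\<close>.\<close>

fun addr :: "nat \<Rightarrow> nat list \<Rightarrow> nat" where
  "addr N [] = 0"
| "addr N (y # ys) = y * N ^ length ys + addr N ys"

lemma addr_less: "set ys \<subseteq> {..<N} \<Longrightarrow> addr N ys < N ^ length ys"
proof (induction ys)
  case (Cons y ys)
  then have "addr N ys < N ^ length ys" "y + 1 \<le> N" by auto
  then have "addr N (y # ys) < (y + 1) * N ^ length ys" by simp
  also have "\<dots> \<le> N * N ^ length ys" using \<open>y + 1 \<le> N\<close> by (rule mult_le_mono1)
  finally show ?case by simp
qed simp

lemma addr_inject:
  assumes "length ys = length zs" "set ys \<subseteq> {..<N}" "set zs \<subseteq> {..<N}" "addr N ys = addr N zs"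
  shows "ys = zs"
  using assms
proof (induction ys zs rule: list_induct2)
  case (Cons y ys z zs)
  let ?K = "N ^ length ys"
  have l: "addr N ys < ?K" "addr N zs < ?K" using Cons addr_less[of ys N] addr_less[of zs N] by auto
  have e: "y * ?K + addr N ys = z * ?K + addr N zs" using Cons by simp
  have "(y * ?K + addr N ys) div ?K = y"
    using l by (metis add.right_neutral div_less div_mult_self3 less_nat_zero_code not_gr_zero)
  moreover have "(z * ?K + addr N zs) div ?K = z"
    using l by (metis add.right_neutral div_less div_mult_self3 less_nat_zero_code not_gr_zero)
  ultimately have "y = z" using e by simp
  then show ?case using e Cons by auto
qed simp

text \<open>Adds the contribution of each index to the position of the head. The mark on the tape of the
  variable ends the loop, and the value is intact after rewinding.\<close>

fun goto :: "nat \<Rightarrow> nat list \<Rightarrow> tcom" where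
  "goto a [] = Mv (array_tape a) Stay"
| "goto a (x # xs) = SEQ (SEQ
     (WHT (var_tape x) 1 (SEQ (shift_by a (length xs)) (Mv (var_tape x) Right))) (rewind (var_tape x))) (goto a xs)"

fun tgoto :: "nat \<Rightarrow> nat \<Rightarrow> nat" where
  "tgoto N 0 = 1"
| "tgoto N (Suc k) = (N * (tshift N k + 1 + 2) + 1) + (3 * N + 5) + tgoto N k"

lemma poly_bounded_tgoto: "poly_bounded (\<lambda>N. tgoto N k)"
  by (induction k) (auto intro!: poly_bounded_add poly_bounded_mult poly_bounded_Suc poly_bounded_tshift)

lemma runs_in_goto:
  assumes "\<And>x. x \<in> set xs \<Longrightarrow> F (var_tape x) = (0, var_cells N (v x)) \<and> v x < N \<and> length xs \<le> x"
    "\<And>j. j < length xs \<Longrightarrow> F (var_tape j) = (0, var_cells N (v j))" "F (array_tape a) = (p, c)"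
  shows "runs_in (goto a xs) (tgoto N (length xs)) F (F(array_tape a := (p + int (addr N (map v xs)), c)))"
  using assms
proof (induction xs arbitrary: F p)
  case Nil
  then show ?case using runs_in_Mv[of "array_tape a" Stay F] by (simp add: fun_upd_def)
next
  case (Cons x xs)
  let ?k = "length xs"
  let ?f = "\<lambda>i. F(array_tape a := (p + int (i * N ^ ?k), c), var_tape x := (int i, var_cells N (v x)))"
  have x: "v x < N" "Suc ?k \<le> x" "F (var_tape x) = (0, var_cells N (v x))" using Cons.prems(1)[of x] by auto
  have "runs_in (WHT (var_tape x) 1 (SEQ (shift_by a ?k) (Mv (var_tape x) Right))) (v x * (tshift N ?k + 1 + 2) + 1) (?f 0) (?f (v x))"
  proof (rule runs_in_WHT_seq, intro conjI)
    fix i assume i: "i < v x"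
    then show "under_head (?f i (var_tape x)) \<noteq> 1" by (simp add: under_head_def)
    have "runs_in (shift_by a ?k) (tshift N ?k) (?f i) ((?f i)(array_tape a := (p + int (i * N ^ ?k) + int (N ^ ?k), c)))"
      by (rule runs_in_shift_by[where v = v]) (use Cons.prems(2,3) x(2) in auto)
    from runs_in_SEQ[OF this runs_in_Mv[of "var_tape x" Right]]
    show "runs_in (SEQ (shift_by a ?k) (Mv (var_tape x) Right)) (tshift N ?k + 1) (?f i) (?f (Suc i))"
      by (simp add: fun_upd_twist algebra_simps)
  qed (use x in \<open>simp add: under_head_def\<close>)
  then have "runs_in (WHT (var_tape x) 1 (SEQ (shift_by a ?k) (Mv (var_tape x) Right))) (N * (tshift N ?k + 1 + 2) + 1) (?f 0) (?f (v x))"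
    by (rule runs_in_mono) (use x in \<open>simp del: add_2_eq_Suc add_2_eq_Suc'\<close>)
  moreover have "?f 0 = F" using Cons.prems x by auto
  moreover have "runs_in (rewind (var_tape x)) (3 * N + 5) (?f (v x)) ((?f (v x))(var_tape x := (0, var_cells N (v x))))"
    by (rule runs_in_rewind) (use x in auto)
  moreover have 1: "(?f (v x))(var_tape x := (0, var_cells N (v x))) = F(array_tape a := (p + int (v x * N ^ ?k), c))"
    using x by (auto simp: fun_eq_iff)
  ultimately have 2: "runs_in (SEQ (WHT (var_tape x) 1 (SEQ (shift_by a ?k) (Mv (var_tape x) Right))) (rewind (var_tape x)))
    ((N * (tshift N ?k + 1 + 2) + 1) + (3 * N + 5)) F (F(array_tape a := (p + int (v x * N ^ ?k), c)))"
    by (metis (no_types) runs_in_SEQ)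
  have 3: "runs_in (goto a xs) (tgoto N ?k) (F(array_tape a := (p + int (v x * N ^ ?k), c)))
    ((F(array_tape a := (p + int (v x * N ^ ?k), c)))(array_tape a := (p + int (v x * N ^ ?k) + int (addr N (map v xs)), c)))"
    by (rule Cons.IH) (use Cons.prems in \<open>auto simp: Suc_le_eq less_imp_le\<close>)
  have 4: "(F(array_tape a := (p + int (v x * N ^ ?k), c)))(array_tape a := (p + int (v x * N ^ ?k) + int (addr N (map v xs)), c))
     = F(array_tape a := (p + int (addr N (map v (x # xs))), c))"
    by (simp add: add.assoc)
  show ?case using runs_in_SEQ[OF 2 3] unfolding 4 by (simp add: fun_upd_def)
qed

section \<open>A language with bounded loops\<close>

text \<open>\<open>Inc\<close> increments a variable, \<open>Emit\<close> appends a symbol to the output,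
  \<open>Write a xs s\<close> stores the symbol \<open>s\<close> in the entry of the array \<open>a\<close>
  whose index tuple is given by the variables \<open>xs\<close>, and \<open>IfA a xs s\<close> tests whether
  this entry is \<open>s\<close>. \<open>For x c\<close> executes \<open>c\<close> for \<open>x = 0,
  \<dots>, N - 1\<close>.\<close>

datatype com = Skip | Inc nat | Emit nat | Write nat "nat list" nat | Seq com com
  | IfA nat "nat list" nat com com | IfEq nat nat com com | For nat com

text \<open>Values of the variables, entries of the arrays, and output.\<close>

record st =
  vr :: "nat \<Rightarrow> nat"
  ar :: "nat \<Rightarrow> nat list \<Rightarrow> nat"
  ot :: "nat list"

definition setv :: "nat \<Rightarrow> nat \<Rightarrow> st \<Rightarrow> st" where
  "setv x n \<sigma> = \<sigma>\<lparr>vr := (vr \<sigma>)(x := n)\<rparr>"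

definition seta :: "nat \<Rightarrow> nat list \<Rightarrow> nat \<Rightarrow> st \<Rightarrow> st" where
  "seta a ys s \<sigma> = \<sigma>\<lparr>ar := (ar \<sigma>)(a := (ar \<sigma> a)(ys := s))\<rparr>"

definition emit :: "nat \<Rightarrow> st \<Rightarrow> st" where
  "emit s \<sigma> = \<sigma>\<lparr>ot := ot \<sigma> @ [s]\<rparr>"

lemma st_simps [simp]:
  "vr (setv x n \<sigma>) = (vr \<sigma>)(x := n)" "ar (setv x n \<sigma>) = ar \<sigma>" "ot (setv x n \<sigma>) = ot \<sigma>"
  "vr (seta a ys s \<sigma>) = vr \<sigma>" "ar (seta a ys s \<sigma>) = (ar \<sigma>)(a := (ar \<sigma> a)(ys := s))"
  "ot (seta a ys s \<sigma>) = ot \<sigma>"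
  "vr (emit s \<sigma>) = vr \<sigma>" "ar (emit s \<sigma>) = ar \<sigma>" "ot (emit s \<sigma>) = ot \<sigma> @ [s]"
  by (simp_all add: setv_def seta_def emit_def)

text \<open>Unlike \<open>f ^^ n\<close>, this passes the number of the round to the function.\<close>

primrec iter :: "nat \<Rightarrow> (nat \<Rightarrow> 'b \<Rightarrow> 'b) \<Rightarrow> 'b \<Rightarrow> 'b" where
  "iter 0 f s = s"
| "iter (Suc n) f s = f n (iter n f s)"

text \<open>Variables saturate at \<open>N - 1\<close>. So all values stay in the range that the tapes
  provide, and loops have \<open>N\<close> rounds no matter what the program does.\<close>

fun run :: "nat \<Rightarrow> com \<Rightarrow> st \<Rightarrow> st" where
  "run N Skip \<sigma> = \<sigma>"
| "run N (Inc x) \<sigma> = (if Suc (vr \<sigma> x) < N then setv x (Suc (vr \<sigma> x)) \<sigma> else \<sigma>)"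
| "run N (Emit s) \<sigma> = emit s \<sigma>"
| "run N (Write a xs s) \<sigma> = seta a (map (vr \<sigma>) xs) s \<sigma>"
| "run N (Seq c d) \<sigma> = run N d (run N c \<sigma>)"
| "run N (IfA a xs s c d) \<sigma> =
     (if ar \<sigma> a (map (vr \<sigma>) xs) = s then run N c \<sigma> else run N d \<sigma>)"
| "run N (IfEq x y c d) \<sigma> = (if vr \<sigma> x = vr \<sigma> y then run N c \<sigma> else run N d \<sigma>)"
| "run N (For x c) \<sigma> = setv x 0 (iter N (\<lambda>i \<tau>. run N c (setv x i \<tau>)) \<sigma>)"

fun assigned :: "com \<Rightarrow> nat set" where
  "assigned (Inc x) = {x}"
| "assigned (Seq c d) = assigned c \<union> assigned d"
| "assigned (IfA a xs s c d) = assigned c \<union> assigned d"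
| "assigned (IfEq x y c d) = assigned c \<union> assigned d"
| "assigned (For x c) = insert x (assigned c)"
| "assigned _ = {}"

lemma run_assigned: "x \<notin> assigned c \<Longrightarrow> vr (run N c \<sigma>) x = vr \<sigma> x"
proof (induction c arbitrary: \<sigma>)
  case (For y c)
  have "vr (iter n (\<lambda>i \<tau>. run N c (setv y i \<tau>)) \<sigma>) x = vr \<sigma> x" for n
    by (induction n) (use For in auto)
  then show ?case using For by simp
qed auto

text \<open>The variables \<open>0\<close>, \<open>1\<close>, \<open>2\<close> are the loop counters of
  \<open>shift_by\<close>; hence the lower bound on variables and the upper bound on the number of indices.
  A loop variable keeps its place on its tape during the loop, so the body must not assign it. Symbols from
  \<open>5\<close> on would be mistaken for end markers, and an emitted blank would end the output.\<close>

fun well_formed :: "nat \<Rightarrow> (nat \<Rightarrow> nat) \<Rightarrow> com \<Rightarrow> bool" where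
  "well_formed M r Skip \<longleftrightarrow> True"
| "well_formed M r (Inc x) \<longleftrightarrow> x < M \<and> 3 \<le> x"
| "well_formed M r (Emit s) \<longleftrightarrow> 0 < s \<and> s < 5"
| "well_formed M r (Write a xs s) \<longleftrightarrow> a < M \<and> length xs = r a \<and> length xs \<le> 3 \<and>
     set xs \<subseteq> {3..<M} \<and> s < 5"
| "well_formed M r (Seq c d) \<longleftrightarrow> well_formed M r c \<and> well_formed M r d"
| "well_formed M r (IfA a xs s c d) \<longleftrightarrow> a < M \<and> length xs = r a \<and> length xs \<le> 3 \<and>
     set xs \<subseteq> {3..<M} \<and> well_formed M r c \<and> well_formed M r d"
| "well_formed M r (IfEq x y c d) \<longleftrightarrow> x < M \<and> 3 \<le> x \<and> y < M \<and> 3 \<le> y \<and> x \<noteq> y \<and> well_formed M r c \<and> well_formed M r d"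
| "well_formed M r (For x c) \<longleftrightarrow> x < M \<and> 3 \<le> x \<and> x \<notin> assigned c \<and> well_formed M r c"

definition zero :: "nat \<Rightarrow> tcom" where
  "zero j = SEQ (WHT j 1 (Mv j Right)) (SEQ (Wr j 0) (SEQ (rewind j) (Wr j 1)))"

text \<open>Moves the mark by one cell. If it would enter cell \<open>N\<close>, no mark is written and the
  head stays on the end marker \<open>6\<close>, which ends the loop around it.\<close>

definition advance :: "nat \<Rightarrow> tcom" where
  "advance j = SEQ (WHT j 1 (Mv j Right)) (SEQ (Wr j 0) (SEQ (Mv j Right)
     (IFT j 6 (Mv j Stay) (SEQ (Wr j 1) (rewind j)))))"

fun compile :: "com \<Rightarrow> tcom" where
  "compile Skip = Mv 0 Stay"
| "compile (Inc x) = SEQ (WHT (var_tape x) 1 (Mv (var_tape x) Right)) (SEQ (Mv (var_tape x) Right)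
     (SEQ (IFT (var_tape x) 6 (Mv (var_tape x) Left)
        (SEQ (Mv (var_tape x) Left) (SEQ (Wr (var_tape x) 0) (SEQ (Mv (var_tape x) Right) (Wr (var_tape x) 1)))))
      (rewind (var_tape x))))"
| "compile (Emit s) = SEQ (Wr 0 s) (Mv 0 Right)"
| "compile (Write a xs s) = SEQ (goto a xs) (SEQ (Wr (array_tape a) s) (rewind (array_tape a)))"
| "compile (Seq c d) = SEQ (compile c) (compile d)"
| "compile (IfA a xs s c d) = SEQ (goto a xs)
     (IFT (array_tape a) s (SEQ (rewind (array_tape a)) (compile c)) (SEQ (rewind (array_tape a)) (compile d)))"
| "compile (IfEq x y c d) = SEQ (WHT (var_tape x) 1 (SEQ (Mv (var_tape x) Right) (Mv (var_tape y) Right)))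
     (SEQ (rewind (var_tape x))
       (IFT (var_tape y) 1 (SEQ (rewind (var_tape y)) (compile c)) (SEQ (rewind (var_tape y)) (compile d))))"
| "compile (For x c) = SEQ (zero (var_tape x)) (SEQ (WHT (var_tape x) 6 (SEQ (compile c) (advance (var_tape x))))
     (SEQ (rewind (var_tape x)) (Wr (var_tape x) 1)))"

lemma tape_ok_rewind: "tape_ok K S (rewind j) \<longleftrightarrow> j < K"
  by (auto simp: rewind_def)

text \<open>There are tape \<open>0\<close> and the tapes of \<open>M\<close> variables and \<open>M\<close>
  arrays. The symbols are those of the words, the blank, and the end markers \<open>5\<close> and
  \<open>6\<close>.\<close>

lemma tape_ok_cmp:
  assumes "well_formed M r c"
  shows "tape_ok (Suc (2 * M)) 7 (compile c)"
proof -
  have [simp]: "var_tape x < Suc (2 * M) \<longleftrightarrow> x < M" "array_tape x < Suc (2 * M) \<longleftrightarrow> x < M" for x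
    unfolding var_tape_def array_tape_def by linarith+
  have [simp]: "tape_ok (Suc (2 * M)) 7 (shift_by a k)" if "a < M" "k \<le> M" for a k
    using that by (induction k) (auto simp: tape_ok_rewind simp del: mult_Suc_right)
  have [simp]: "tape_ok (Suc (2 * M)) 7 (goto a xs)" if "a < M" "set xs \<subseteq> {3..<M}" "length xs \<le> 3" for a xs
  proof (cases "xs = []")
    case False
    then have "3 \<le> M" using that by (cases xs) auto
    then show ?thesis using that
      by (induction xs) (auto simp: tape_ok_rewind simp del: mult_Suc_right)
  qed (use that in simp)
  show ?thesis using assms
    by (induction c) (auto simp: tape_ok_rewind zero_def advance_def simp del: mult_Suc_right)
qed

text \<open>Entries outside the range of the indices are not represented, but their cells, too, are free of
  end markers. The head of tape \<open>0\<close> is at the end of the output.\<close>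

definition represents :: "nat \<Rightarrow> (nat \<Rightarrow> nat) \<Rightarrow> nat \<Rightarrow> st \<Rightarrow> tapes \<Rightarrow> bool" where
  "represents M r N \<sigma> F \<longleftrightarrow>
     (\<forall>x<M. vr \<sigma> x < N \<and> F (var_tape x) = (0, var_cells N (vr \<sigma> x))) \<and>
     (\<forall>a<M. \<exists>c. F (array_tape a) = (0, c) \<and> c (-1) = 5 \<and> (\<forall>i\<ge>0. c i < 5) \<and>
        (\<forall>ys. length ys = r a \<and> set ys \<subseteq> {..<N} \<longrightarrow> c (int (addr N ys)) = ar \<sigma> a ys)) \<and>
     F 0 = (int (length (ot \<sigma>)), word_cells (ot \<sigma>)) \<and> 0 \<notin> set (ot \<sigma>)"

lemma represents_setv:
  assumes "represents M r N \<sigma> F" "n < N"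
  shows "represents M r N (setv x n \<sigma>) (F(var_tape x := (0, var_cells N n)))"
  using assms by (auto simp: represents_def)

lemma represents_seta:
  assumes "represents M r N \<sigma> F" "a < M" "length ys = r a" "set ys \<subseteq> {..<N}" "s < 5" "F (array_tape a) = (0, c)"
  shows "represents M r N (seta a ys s \<sigma>) (F(array_tape a := (0, c(int (addr N ys) := s))))"
  using assms by (auto simp: represents_def dest!: addr_inject[rotated 3])

lemma represents_emit:
  assumes "represents M r N \<sigma> F" "0 < s" "F 0 = (h, c)"
  shows "represents M r N (emit s \<sigma>) (F(0 := (h + 1, c(h := s))))"
proof -
  have "(word_cells (ot \<sigma>))(int (length (ot \<sigma>)) := s) = word_cells (ot \<sigma> @ [s])"
    by (auto simp: fun_eq_iff word_cells_def nth_append)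
  then show ?thesis using assms by (auto simp: represents_def)
qed

text \<open>The time bound depends on the program but not on the state.\<close>

definition implemented :: "nat \<Rightarrow> (nat \<Rightarrow> nat) \<Rightarrow> com \<Rightarrow> (nat \<Rightarrow> nat) \<Rightarrow> bool" where
  "implemented M r c f \<longleftrightarrow> poly_bounded f \<and> (\<forall>N \<sigma> F. N \<ge> 1 \<longrightarrow> represents M r N \<sigma> F \<longrightarrow>
     (\<exists>F'. runs_in (compile c) (f N) F F' \<and> represents M r N (run N c \<sigma>) F'))"

lemma implementedI:
  assumes "poly_bounded f" "\<And>N \<sigma> F. N \<ge> 1 \<Longrightarrow> represents M r N \<sigma> F \<Longrightarrow>
     \<exists>F'. runs_in (compile c) (f N) F F' \<and> represents M r N (run N c \<sigma>) F'"
  shows "implemented M r c f"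
  using assms by (auto simp: implemented_def)

lemma implementedD:
  "implemented M r c f \<Longrightarrow> N \<ge> 1 \<Longrightarrow> represents M r N \<sigma> F \<Longrightarrow>
     \<exists>F'. runs_in (compile c) (f N) F F' \<and> represents M r N (run N c \<sigma>) F'"
  by (simp add: implemented_def)

text \<open>Moving the head of a variable's tape to its mark.\<close>

lemma runs_in_find:
  assumes "F j = (0, var_cells N n)" "n < N"
  shows "runs_in (WHT j 1 (Mv j Right)) (3 * N + 1) F (F(j := (int n, var_cells N n)))"
proof -
  let ?f = "\<lambda>i. F(j := (int i, var_cells N n))"
  have "runs_in (WHT j 1 (Mv j Right)) (n * (1 + 2) + 1) (?f 0) (?f n)"
  proof (rule runs_in_WHT_seq, intro conjI)
    fix i assume "i < n"
    then show "under_head (?f i j) \<noteq> 1" by (simp add: under_head_def)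
    show "runs_in (Mv j Right) 1 (?f i) (?f (Suc i))"
      using runs_in_Mv[of j Right "?f i"] by (simp add: algebra_simps)
  qed (use assms in \<open>simp add: under_head_def\<close>)
  moreover have "?f 0 = F" using assms(1) by auto
  ultimately show ?thesis using assms(2) by (auto elim: runs_in_mono)
qed

lemma var_cells_update: "n < N \<Longrightarrow> (var_cells N n)(int n := 0) = var_cells N N"
  "n < N \<Longrightarrow> (var_cells N N)(int n := Suc 0) = var_cells N n"
  by (auto simp: var_cells_def fun_eq_iff)

lemma var_cells_update0: "0 < N \<Longrightarrow> (var_cells N N)(0 := Suc 0) = var_cells N 0"
  using var_cells_update(2)[of 0 N] by simp

lemma runs_in_zero:
  assumes "F j = (0, var_cells N n)" "n < N"
  shows "runs_in (zero j) ((3 * N + 1) + (1 + ((3 * N + 5) + 1))) F (F(j := (0, var_cells N 0)))"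
proof -
  have 1: "runs_in (Wr j 0) 1 (F(j := (int n, var_cells N n))) (F(j := (int n, var_cells N N)))"
    using runs_in_Wr[of j 0 "F(j := (int n, var_cells N n))"] var_cells_update[OF assms(2)] by simp
  have 2: "runs_in (rewind j) (3 * N + 5) (F(j := (int n, var_cells N N))) (F(j := (0, var_cells N N)))"
    using runs_in_rewind[of "F(j := (int n, var_cells N N))" j n "var_cells N N" N] assms(2) by simp
  have 3: "runs_in (Wr j 1) 1 (F(j := (0, var_cells N N))) (F(j := (0, var_cells N 0)))"
    using runs_in_Wr[of j 1 "F(j := (0, var_cells N N))"] var_cells_update0[of N] assms(2) by simp
  show ?thesis unfolding zero_def
    by (rule runs_in_SEQ[OF runs_in_find[of F j N n, OF assms] runs_in_SEQ[OF 1 runs_in_SEQ[OF 2 3]]])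
qed

lemma runs_in_advance:
  assumes "F j = (0, var_cells N n)" "n < N"
  shows "runs_in (advance j) ((3 * N + 1) + (1 + (1 + ((1 + (3 * N + 5)) + 2)))) F
    (F(j := (if Suc n < N then (0, var_cells N (Suc n)) else (int N, var_cells N N))))"
    (is "runs_in _ _ _ ?G")
proof -
  have 1: "runs_in (Wr j 0) 1 (F(j := (int n, var_cells N n))) (F(j := (int n, var_cells N N)))"
    using runs_in_Wr[of j 0 "F(j := (int n, var_cells N n))"] var_cells_update[OF assms(2)] by simp
  let ?H = "F(j := (int (Suc n), var_cells N N))"
  have 2: "runs_in (Mv j Right) 1 (F(j := (int n, var_cells N N))) ?H"
    using runs_in_Mv[of j Right "F(j := (int n, var_cells N N))"] by (simp add: algebra_simps)
  have at_end: "Suc n < N \<longleftrightarrow> under_head (?H j) \<noteq> 6"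
    using assms(2) var_cells_simps(3)[of N N "Suc n"] by (auto simp: under_head_def)
  have 3: "runs_in (IFT j 6 (Mv j Stay) (SEQ (Wr j 1) (rewind j))) ((1 + (3 * N + 5)) + 2) ?H ?G"
  proof (rule runs_in_IFT)
    assume "under_head (?H j) = 6"
    then have "\<not> Suc n < N" using at_end by simp
    then have "Suc n = N" using assms(2) by simp
    then show "runs_in (Mv j Stay) (1 + (3 * N + 5)) ?H ?G"
      using runs_in_mono[OF runs_in_Mv[of j Stay ?H], of "1 + (3 * N + 5)"] by simp
  next
    assume "under_head (?H j) \<noteq> 6"
    then have n: "Suc n < N" using at_end by simp
    then have a: "runs_in (Wr j 1) 1 ?H (F(j := (int (Suc n), var_cells N (Suc n))))"
      using runs_in_Wr[of j 1 ?H] var_cells_update(2)[OF n] by simp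
    have b: "runs_in (rewind j) (3 * N + 5) (F(j := (int (Suc n), var_cells N (Suc n)))) (F(j := (0, var_cells N (Suc n))))"
      using runs_in_rewind[of "F(j := (int (Suc n), var_cells N (Suc n)))" j "Suc n" _ N] n by simp
    show "runs_in (SEQ (Wr j 1) (rewind j)) (1 + (3 * N + 5)) ?H ?G"
      using runs_in_SEQ[OF a b] n by simp
  qed
  show ?thesis unfolding advance_def
    by (rule runs_in_SEQ[OF runs_in_find[of F j N n, OF assms] runs_in_SEQ[OF 1 runs_in_SEQ[OF 2 3]]])
qed

lemma implemented_Skip: "implemented M r Skip (\<lambda>_. 1)"
proof (rule implementedI)
  fix N \<sigma> F assume "represents M r N \<sigma> F"
  then show "\<exists>F'. runs_in (compile Skip) 1 F F' \<and> represents M r N (run N Skip \<sigma>) F'"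
    using runs_in_Mv[of 0 Stay F] by auto
qed auto

lemma implemented_Emit:
  assumes "0 < s"
  shows "implemented M r (Emit s) (\<lambda>_. 1 + 1)"
proof (rule implementedI)
  fix N \<sigma> F assume "represents M r N \<sigma> F"
  moreover obtain h c where F: "F 0 = (h, c)" by fastforce
  ultimately have "represents M r N (emit s \<sigma>) (F(0 := (h + 1, c(h := s))))"
    by (intro represents_emit assms)
  moreover have "runs_in (SEQ (Wr 0 s) (Mv 0 Right)) (1 + 1) F (F(0 := (h + 1, c(h := s))))"
    using runs_in_SEQ[OF runs_in_Wr[of 0 s F] runs_in_Mv[of 0 Right]] F by simp
  ultimately show "\<exists>F'. runs_in (compile (Emit s)) (1 + 1) F F' \<and> represents M r N (run N (Emit s) \<sigma>) F'"
    by auto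
qed auto

lemma implemented_Seq:
  assumes "implemented M r c f" "implemented M r d g"
  shows "implemented M r (Seq c d) (\<lambda>N. f N + g N)"
  using assms unfolding implemented_def by (auto intro!: poly_bounded_add) (meson runs_in_SEQ)

lemma implemented_Inc:
  assumes "x < M"
  shows "implemented M r (Inc x) (\<lambda>N. (3 * N + 1) + (1 + (((1 + (1 + (1 + 1))) + 2) + (3 * N + 5))))" (is "implemented _ _ _ ?cost")
proof (rule implementedI)
  fix N \<sigma> F assume N: "N \<ge> 1" and represents: "represents M r N \<sigma> F"
  let ?j = "var_tape x" and ?n = "vr \<sigma> x"
  have F: "F ?j = (0, var_cells N ?n)" "?n < N" using represents assms by (auto simp: represents_def)
  let ?m = "if Suc ?n < N then Suc ?n else ?n" 
  let ?H = "F(?j := (int (Suc ?n), var_cells N ?n))" 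
  let ?I = "F(?j := (int ?m, var_cells N ?m))"
  let ?G = "F(?j := (0, var_cells N ?m))"
  have 2: "runs_in (Mv ?j Right) 1 (F(?j := (int ?n, var_cells N ?n))) ?H"
    using runs_in_Mv[of ?j Right "F(?j := (int ?n, var_cells N ?n))"] by (simp add: algebra_simps)
  have at_end: "Suc ?n < N \<longleftrightarrow> under_head (?H ?j) \<noteq> 6"
    using F(2) var_cells_simps(3)[of N ?n "Suc ?n"] by (auto simp: under_head_def)
  have 3: "runs_in (IFT ?j 6 (Mv ?j Left)
        (SEQ (Mv ?j Left) (SEQ (Wr ?j 0) (SEQ (Mv ?j Right) (Wr ?j 1))))) ((1 + (1 + (1 + 1))) + 2) ?H ?I"
  proof (rule runs_in_IFT)
    assume "under_head (?H ?j) = 6"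
    then have "\<not> Suc ?n < N" using at_end by simp
    then show "runs_in (Mv ?j Left) (1 + (1 + (1 + 1))) ?H ?I"
      using runs_in_mono[OF runs_in_Mv[of ?j Left ?H], of "1 + (1 + (1 + 1))"] by simp
  next
    assume "under_head (?H ?j) \<noteq> 6"
    then have n: "Suc ?n < N" using at_end by simp
    have a: "runs_in (Mv ?j Left) 1 ?H (F(?j := (int ?n, var_cells N ?n)))"
      using runs_in_Mv[of ?j Left ?H] by simp
    have b: "runs_in (Wr ?j 0) 1 (F(?j := (int ?n, var_cells N ?n))) (F(?j := (int ?n, var_cells N N)))"
      using runs_in_Wr[of ?j 0 "F(?j := (int ?n, var_cells N ?n))"] var_cells_update[OF F(2)] by simp
    have c: "runs_in (Mv ?j Right) 1 (F(?j := (int ?n, var_cells N N))) (F(?j := (int (Suc ?n), var_cells N N)))"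
      using runs_in_Mv[of ?j Right "F(?j := (int ?n, var_cells N N))"] by (simp add: algebra_simps)
    have d: "runs_in (Wr ?j 1) 1 (F(?j := (int (Suc ?n), var_cells N N))) (F(?j := (int (Suc ?n), var_cells N (Suc ?n))))"
      using runs_in_Wr[of ?j 1 "F(?j := (int (Suc ?n), var_cells N N))"] var_cells_update(2)[OF n] by simp
    show "runs_in (SEQ (Mv ?j Left) (SEQ (Wr ?j 0) (SEQ (Mv ?j Right) (Wr ?j 1)))) (1 + (1 + (1 + 1))) ?H ?I"
      using runs_in_SEQ[OF a runs_in_SEQ[OF b runs_in_SEQ[OF c d]]] n by simp
  qed
  have 4: "runs_in (rewind ?j) (3 * N + 5) ?I ?G"
    using runs_in_rewind[of ?I ?j ?m "var_cells N ?m" N] F(2) by simp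
  have "runs_in (compile (Inc x)) (?cost N) F ?G"
    unfolding compile.simps by (rule runs_in_SEQ[OF runs_in_find[of F ?j N ?n, OF F] runs_in_SEQ[OF 2 runs_in_SEQ[OF 3 4]]])
  moreover have "represents M r N (run N (Inc x) \<sigma>) ?G"
    using represents_setv[OF represents, of ?m x] F by (auto simp: fun_upd_idem represents)
  ultimately show "\<exists>F'. runs_in (compile (Inc x)) (?cost N) F F'
    \<and> represents M r N (run N (Inc x) \<sigma>) F'"
    by blast
qed (intro poly_bounded_add poly_bounded_mult poly_bounded_const poly_bounded_id)

lemma poly_bounded_power: "poly_bounded (\<lambda>N. N ^ k)"
  by (induction k) (auto intro: poly_bounded_mult)

text \<open>Bringing the head of an array's tape to the cell of an entry, and back after an optional change.\<close>

lemma runs_in_access: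
  assumes "represents M r N \<sigma> F" "a < M" "length xs = r a" "length xs \<le> 3" "set xs \<subseteq> {3..<M}"
    "F (array_tape a) = (0, c)"
  defines "ys \<equiv> map (vr \<sigma>) xs"
  shows "runs_in (goto a xs) (tgoto N (length xs)) F (F(array_tape a := (int (addr N ys), c)))"
    "s < 5 \<Longrightarrow> runs_in (rewind (array_tape a)) (3 * N ^ length xs + 5) (F(array_tape a := (int (addr N ys), c(int (addr N ys) := s))))
       (F(array_tape a := (0, c(int (addr N ys) := s))))"
    "runs_in (rewind (array_tape a)) (3 * N ^ length xs + 5) (F(array_tape a := (int (addr N ys), c))) F"
    "c (int (addr N ys)) = ar \<sigma> a ys" "set ys \<subseteq> {..<N}"
proof -
  show ys: "set ys \<subseteq> {..<N}" using assms by (auto simp: represents_def)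
  have "length xs \<le> M" using assms(4,5) by (cases xs) auto
  then have "F (var_tape j) = (0, var_cells N (vr \<sigma> j))" if "j < length xs" for j
    using assms(1) that by (simp add: represents_def)
  moreover have "F (var_tape x) = (0, var_cells N (vr \<sigma> x)) \<and> vr \<sigma> x < N \<and> length xs \<le> x" if "x \<in> set xs" for x
  proof -
    have "x < M" "3 \<le> x" using assms(5) that by auto
    then show ?thesis using assms(1,4) by (simp add: represents_def)
  qed
  ultimately show "runs_in (goto a xs) (tgoto N (length xs)) F (F(array_tape a := (int (addr N ys), c)))"
    using runs_in_goto[of xs F N "vr \<sigma>" a 0 c] assms(6) by (simp add: ys_def)
  have "c (-1) = 5 \<and> (\<forall>i\<ge>0. c i < 5) \<and> c (int (addr N ys)) = ar \<sigma> a ys"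
    using assms(1-3,6) ys unfolding represents_def by (force simp: ys_def)
  then have c: "c (-1) = 5" "\<And>i. i \<ge> 0 \<Longrightarrow> c i < 5" "c (int (addr N ys)) = ar \<sigma> a ys"
    by auto
  then show "c (int (addr N ys)) = ar \<sigma> a ys" by simp
  have "addr N ys \<le> N ^ length xs" using addr_less[OF ys] by (simp add: ys_def)
  then have *: "runs_in (rewind (array_tape a)) (3 * N ^ length xs + 5) (F(array_tape a := (int (addr N ys), d))) (F(array_tape a := (0, d)))"
    if "d (-1) = 5" "\<And>i. i \<ge> 0 \<Longrightarrow> d i < 5" for d
    using runs_in_rewind[of "F(array_tape a := (int (addr N ys), d))" "array_tape a" "addr N ys" d "N ^ length xs"]
      that(1) that(2)[THEN less_imp_neq] by simp
  show "runs_in (rewind (array_tape a)) (3 * N ^ length xs + 5) (F(array_tape a := (int (addr N ys), c(int (addr N ys) := s))))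
       (F(array_tape a := (0, c(int (addr N ys) := s))))" if "s < 5"
    by (rule *) (use c that in auto)
  show "runs_in (rewind (array_tape a)) (3 * N ^ length xs + 5) (F(array_tape a := (int (addr N ys), c))) F"
    using *[of c, OF c(1,2)] assms(6) by (simp add: fun_upd_idem)
qed

lemma implemented_Write:
  assumes "well_formed M r (Write a xs s)"
  shows "implemented M r (Write a xs s) (\<lambda>N. tgoto N (length xs) + (1 + (3 * N ^ length xs + 5)))" (is "implemented _ _ _ ?cost")
proof (rule implementedI)
  fix N \<sigma> F assume represents: "represents M r N \<sigma> F"
  then obtain c where F: "F (array_tape a) = (0, c)" using assms by (auto simp: represents_def)
  have well_formed: "a < M" "length xs = r a" "length xs \<le> 3" "set xs \<subseteq> {3..<M}" "s < 5" using assms by auto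
  let ?p = "int (addr N (map (vr \<sigma>) xs))"
  note acc = runs_in_access[OF represents well_formed(1-4) F]
  have 1: "runs_in (Wr (array_tape a) s) 1 (F(array_tape a := (?p, c))) (F(array_tape a := (?p, c(?p := s))))"
    using runs_in_Wr[of "array_tape a" s "F(array_tape a := (?p, c))"] by simp
  have "runs_in (compile (Write a xs s)) (?cost N) F (F(array_tape a := (0, c(?p := s))))"
    unfolding compile.simps by (rule runs_in_SEQ[OF acc(1) runs_in_SEQ[OF 1 acc(2)[OF well_formed(5)]]])
  moreover have "represents M r N (run N (Write a xs s) \<sigma>) (F(array_tape a := (0, c(?p := s))))"
    using represents_seta[OF represents well_formed(1) _ acc(5) well_formed(5) F] well_formed by simp
  ultimately show "\<exists>F'. runs_in (compile (Write a xs s)) (?cost N) F F' \<and>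
    represents M r N (run N (Write a xs s) \<sigma>) F'" by blast
qed (intro poly_bounded_add poly_bounded_mult poly_bounded_const poly_bounded_id poly_bounded_tgoto poly_bounded_power)

lemma implemented_IfA:
  assumes "well_formed M r (IfA a xs s c1 c2)" "implemented M r c1 f" "implemented M r c2 g"
  shows "implemented M r (IfA a xs s c1 c2)
    (\<lambda>N. tgoto N (length xs) + (((3 * N ^ length xs + 5) + (f N + g N)) + 2))" (is "implemented _ _ _ ?cost")
proof (rule implementedI)
  fix N \<sigma> F assume represents: "represents M r N \<sigma> F" and N: "N \<ge> 1"
  then obtain c where F: "F (array_tape a) = (0, c)" using assms(1) by (auto simp: represents_def)
  have well_formed: "a < M" "length xs = r a" "length xs \<le> 3" "set xs \<subseteq> {3..<M}" using assms(1) by auto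
  let ?p = "int (addr N (map (vr \<sigma>) xs))"
  note acc = runs_in_access[OF represents well_formed F]
  obtain F1 where F1: "runs_in (compile c1) (f N) F F1" "represents M r N (run N c1 \<sigma>) F1"
    using implementedD[OF assms(2) N represents] by blast
  obtain F2 where F2: "runs_in (compile c2) (g N) F F2" "represents M r N (run N c2 \<sigma>) F2"
    using implementedD[OF assms(3) N represents] by blast
  let ?s = "ar \<sigma> a (map (vr \<sigma>) xs) = s"
  let ?G = "if ?s then F1 else F2"
  have under_head: "under_head ((F(array_tape a := (?p, c))) (array_tape a)) = s \<longleftrightarrow> ?s" using acc(4) by (simp add: under_head_def)
  have "runs_in (compile c1) (f N + g N) F F1" "runs_in (compile c2) (f N + g N) F F2"
    using F1(1) F2(1) by (auto elim: runs_in_mono)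
  note 1 = this[THEN runs_in_SEQ[OF acc(3)]]
  have "runs_in (IFT (array_tape a) s (SEQ (rewind (array_tape a)) (compile c1)) (SEQ (rewind (array_tape a)) (compile c2)))
    (((3 * N ^ length xs + 5) + (f N + g N)) + 2) (F(array_tape a := (?p, c))) ?G"
    by (rule runs_in_IFT) (use under_head 1 in auto)
  from runs_in_SEQ[OF acc(1) this]
  show "\<exists>F'. runs_in (compile (IfA a xs s c1 c2)) (?cost N) F F' \<and>
    represents M r N (run N (IfA a xs s c1 c2) \<sigma>) F'"
    using F1(2) F2(2) unfolding compile.simps by (intro exI[of _ ?G]) auto
qed (use assms(2,3) in \<open>auto simp: implemented_def intro!: poly_bounded_add poly_bounded_Suc poly_bounded_mult poly_bounded_tgoto poly_bounded_power\<close>)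

lemma implemented_IfEq:
  assumes "well_formed M r (IfEq x y c1 c2)" "implemented M r c1 f" "implemented M r c2 g"
  shows "implemented M r (IfEq x y c1 c2)
    (\<lambda>N. (N * ((1 + 1) + 2) + 1) + ((3 * N + 5) + (((3 * N + 5) + (f N + g N)) + 2)))" (is "implemented _ _ _ ?cost")
proof (rule implementedI)
  fix N \<sigma> F assume represents: "represents M r N \<sigma> F" and N: "N \<ge> 1"
  let ?n = "vr \<sigma> x" and ?m = "vr \<sigma> y"
  have F: "F (var_tape x) = (0, var_cells N ?n)" "F (var_tape y) = (0, var_cells N ?m)" "?n < N" "?m < N" and xy: "x \<noteq> y"
    using represents assms(1) by (auto simp: represents_def)
  obtain F1 where F1: "runs_in (compile c1) (f N) F F1" "represents M r N (run N c1 \<sigma>) F1"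
    using implementedD[OF assms(2) N represents] by blast
  obtain F2 where F2: "runs_in (compile c2) (g N) F F2" "represents M r N (run N c2 \<sigma>) F2"
    using implementedD[OF assms(3) N represents] by blast
  let ?G = "if ?n = ?m then F1 else F2"
  let ?f = "\<lambda>i. F(var_tape x := (int i, var_cells N ?n), var_tape y := (int i, var_cells N ?m))"
  have "runs_in (WHT (var_tape x) 1 (SEQ (Mv (var_tape x) Right) (Mv (var_tape y) Right))) (?n * ((1 + 1) + 2) + 1) (?f 0) (?f ?n)"
  proof (rule runs_in_WHT_seq, intro conjI)
    fix i assume "i < ?n"
    then show "under_head (?f i (var_tape x)) \<noteq> 1" using xy by (simp add: under_head_def)
    show "runs_in (SEQ (Mv (var_tape x) Right) (Mv (var_tape y) Right)) (1 + 1) (?f i) (?f (Suc i))"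
      using runs_in_SEQ[OF runs_in_Mv[of "var_tape x" Right "?f i"] runs_in_Mv[of "var_tape y" Right]] xy
      by (simp add: algebra_simps fun_upd_twist)
  qed (use xy F in \<open>simp add: under_head_def\<close>)
  then have 1: "runs_in (WHT (var_tape x) 1 (SEQ (Mv (var_tape x) Right) (Mv (var_tape y) Right))) (N * ((1 + 1) + 2) + 1) (?f 0) (?f ?n)"
    by (rule runs_in_mono) (use F in simp)
  have "runs_in (rewind (var_tape x)) (3 * N + 5) (?f ?n) ((?f ?n)(var_tape x := (0, var_cells N ?n)))"
    by (rule runs_in_rewind[where h = ?n]) (use xy F in auto)
  then have 2: "runs_in (rewind (var_tape x)) (3 * N + 5) (?f ?n) (F(var_tape y := (int ?n, var_cells N ?m)))"
    using xy F by (simp add: fun_upd_twist fun_upd_idem)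
  have "runs_in (rewind (var_tape y)) (3 * N + 5) (F(var_tape y := (int ?n, var_cells N ?m)))
    ((F(var_tape y := (int ?n, var_cells N ?m)))(var_tape y := (0, var_cells N ?m)))"
    by (rule runs_in_rewind[where h = ?n]) (use F in auto)
  then have 3: "runs_in (rewind (var_tape y)) (3 * N + 5) (F(var_tape y := (int ?n, var_cells N ?m))) F"
    using F by (simp add: fun_upd_idem)
  have under_head: "under_head ((F(var_tape y := (int ?n, var_cells N ?m))) (var_tape y)) = 1 \<longleftrightarrow> ?n = ?m"
    using F by (auto simp: under_head_def)
  have "runs_in (compile c1) (f N + g N) F F1" "runs_in (compile c2) (f N + g N) F F2"
    using F1(1) F2(1) by (auto elim: runs_in_mono)
  note 4 = this[THEN runs_in_SEQ[OF 3]]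
  have 5: "runs_in (IFT (var_tape y) 1 (SEQ (rewind (var_tape y)) (compile c1)) (SEQ (rewind (var_tape y)) (compile c2)))
    (((3 * N + 5) + (f N + g N)) + 2) (F(var_tape y := (int ?n, var_cells N ?m))) ?G"
    by (rule runs_in_IFT) (use under_head 4 in auto)
  have "?f 0 = F" using F by auto
  then have "runs_in (compile (IfEq x y c1 c2)) (?cost N) F ?G"
    using runs_in_SEQ[OF 1 runs_in_SEQ[OF 2 5]] by simp
  then show "\<exists>F'. runs_in (compile (IfEq x y c1 c2)) (?cost N) F F' \<and>
    represents M r N (run N (IfEq x y c1 c2) \<sigma>) F'"
    using F1(2) F2(2) by (intro exI[of _ ?G]) auto
qed (use assms(2,3) in \<open>auto simp: implemented_def intro!: poly_bounded_add poly_bounded_Suc poly_bounded_mult\<close>)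

text \<open>During round \<open>i\<close>, the tape of \<open>x\<close> represents the value
  \<open>i\<close>, as the body leaves it alone. After the last round it carries no mark and its head is on
  the right end marker, until the last two commands restore the value \<open>0\<close>.\<close>

lemma implemented_For:
  assumes "well_formed M r (For x c)" "implemented M r c f"
  shows "implemented M r (For x c) (\<lambda>N. ((3 * N + 1) + (1 + ((3 * N + 5) + 1))) +
    ((N * ((f N + ((3 * N + 1) + (1 + (1 + ((1 + (3 * N + 5)) + 2))))) + 2) + 1) + ((3 * N + 5) + 1)))"
proof (rule implementedI)
  fix N \<sigma> F assume represents: "represents M r N \<sigma> F" and N: "N \<ge> 1"
  have x: "x < M" "x \<notin> assigned c" using assms(1) by auto
  have F: "F (var_tape x) = (0, var_cells N (vr \<sigma> x))" "vr \<sigma> x < N" using represents x(1) by (simp_all add: represents_def)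
  let ?\<sigma> = "\<lambda>i. iter i (\<lambda>i \<tau>. run N c (setv x i \<tau>)) \<sigma>"
  let ?P = "\<lambda>i G. if i < N then represents M r N (setv x i (?\<sigma> i)) G
    else \<exists>H. represents M r N (?\<sigma> i) H \<and> G = H(var_tape x := (int N, var_cells N N))"
  let ?b = "f N + ((3 * N + 1) + (1 + (1 + ((1 + (3 * N + 5)) + 2))))"
  have 1: "runs_in (zero (var_tape x)) ((3 * N + 1) + (1 + ((3 * N + 5) + 1))) F (F(var_tape x := (0, var_cells N 0)))"
    by (rule runs_in_zero[of F "var_tape x" N "vr \<sigma> x", OF F])
  have "\<exists>G. runs_in (WHT (var_tape x) 6 (SEQ (compile c) (advance (var_tape x)))) (N * (?b + 2) + 1) (F(var_tape x := (0, var_cells N 0))) G \<and> ?P N G"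
  proof (rule runs_in_WHT[where P = ?P])
    show "?P 0 (F(var_tape x := (0, var_cells N 0)))" using N represents_setv[OF represents, of 0 x] by simp
  next
    fix i G assume i: "i < N" "?P i G"
    then have G: "represents M r N (setv x i (?\<sigma> i)) G" by simp
    have "G (var_tape x) = (0, var_cells N i)" using G x by (simp add: represents_def)
    then have "under_head (G (var_tape x)) \<noteq> 6" using i(1) var_cells_simps(3)[of N i 0] by (simp add: under_head_def)
    moreover obtain H where H: "runs_in (compile c) (f N) G H" "represents M r N (?\<sigma> (Suc i)) H"
      using implementedD[OF assms(2) N G] by auto
    have "vr (?\<sigma> (Suc i)) x = i" using x(2) by (simp add: run_assigned)
    then have Hx: "H (var_tape x) = (0, var_cells N i)" using H(2) x by (simp add: represents_def)
    let ?G' = "H(var_tape x := (if Suc i < N then (0, var_cells N (Suc i)) else (int N, var_cells N N)))"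
    have "runs_in (SEQ (compile c) (advance (var_tape x))) ?b G ?G'"
      by (rule runs_in_SEQ[OF H(1) runs_in_advance[of H "var_tape x" N i, OF Hx i(1)]])
    moreover have "?P (Suc i) ?G'"
    proof (cases "Suc i < N")
      case True
      then show ?thesis using represents_setv[OF H(2) True, of x] by simp
    next
      case False
      then show ?thesis using H(2) by auto
    qed
    ultimately show "under_head (G (var_tape x)) \<noteq> 6 \<and> (\<exists>G'. runs_in (SEQ (compile c) (advance (var_tape x))) ?b G G' \<and> ?P (Suc i) G')"
      by blast
  next
    fix G assume "?P N G"
    then show "under_head (G (var_tape x)) = 6" by (auto simp: under_head_def)
  qed
  then obtain H where 2: "runs_in (WHT (var_tape x) 6 (SEQ (compile c) (advance (var_tape x)))) (N * (?b + 2) + 1) (F(var_tape x := (0, var_cells N 0)))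
    (H(var_tape x := (int N, var_cells N N)))" and H: "represents M r N (?\<sigma> N) H"
    by auto
  have 3: "runs_in (rewind (var_tape x)) (3 * N + 5) (H(var_tape x := (int N, var_cells N N))) (H(var_tape x := (0, var_cells N N)))"
    using runs_in_rewind[of "H(var_tape x := (int N, var_cells N N))" "var_tape x" N "var_cells N N" N] by simp
  have 4: "runs_in (Wr (var_tape x) 1) 1 (H(var_tape x := (0, var_cells N N))) (H(var_tape x := (0, var_cells N 0)))"
    using runs_in_Wr[of "var_tape x" 1 "H(var_tape x := (0, var_cells N N))"] var_cells_update0[of N] N by simp
  have "represents M r N (run N (For x c) \<sigma>) (H(var_tape x := (0, var_cells N 0)))"
    using represents_setv[OF H, of 0 x] N by simp
  with runs_in_SEQ[OF 1 runs_in_SEQ[OF 2 runs_in_SEQ[OF 3 4]]]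
  show "\<exists>F'. runs_in (compile (For x c)) (((3 * N + 1) + (1 + ((3 * N + 5) + 1))) +
    ((N * (?b + 2) + 1) + ((3 * N + 5) + 1))) F F' \<and> represents M r N (run N (For x c) \<sigma>) F'"
    unfolding compile.simps by blast
qed (use assms(2) in \<open>auto simp: implemented_def intro!: poly_bounded_add poly_bounded_Suc poly_bounded_mult\<close>)

text \<open>Each construct runs its parts a number of times that is polynomial in \<open>N\<close>;
  therefore programs have polynomial time bounds by induction on their structure.\<close>

theorem compile_correct: "well_formed M r c \<Longrightarrow> \<exists>f. implemented M r c f"
proof (induction c)
  case Skip
  show ?case using implemented_Skip by blast
next
  case (Inc x)
  show ?case by (rule exI, rule implemented_Inc) (use Inc in simp)
next
  case (Emit s)
  show ?case by (rule exI, rule implemented_Emit) (use Emit in simp)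
next
  case (Write a xs s)
  show ?case by (rule exI, rule implemented_Write) (use Write in simp)
next
  case (Seq c d)
  then obtain f g where "implemented M r c f" "implemented M r d g" by auto
  then show ?case using implemented_Seq by blast
next
  case (IfA a xs s c d)
  then obtain f g where "implemented M r c f" "implemented M r d g" by auto
  then show ?case using implemented_IfA[OF IfA.prems] by blast
next
  case (IfEq x y c d)
  then obtain f g where "implemented M r c f" "implemented M r d g" by auto
  then show ?case using implemented_IfEq[OF IfEq.prems] by blast
next
  case (For x c)
  then obtain f where "implemented M r c f" by auto
  then show ?case using implemented_For[OF For.prems] by blast
qed

section \<open>From loop programs to polynomial time algorithms\<close>

fun seqs :: "(nat \<Rightarrow> tcom) \<Rightarrow> nat list \<Rightarrow> tcom" where
  "seqs p [] = Mv 0 Stay"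
| "seqs p (j # js) = SEQ (p j) (seqs p js)"

lemma runs_in_seqs:
  assumes "distinct js" "\<And>j G. j \<in> set js \<Longrightarrow> G j = F j \<Longrightarrow> runs_in (p j) b G (G(j := g j))"
  shows "runs_in (seqs p js) (length js * b + 1) F (\<lambda>j. if j \<in> set js then g j else F j)"
  using assms
proof (induction js arbitrary: F)
  case Nil
  then show ?case using runs_in_Mv[of 0 Stay F] by (simp add: fun_upd_def)
next
  case (Cons i js)
  have 1: "runs_in (p i) b F (F(i := g i))" using Cons.prems(2)[of i F] by (simp add: fun_upd_def)
  have 2: "runs_in (seqs p js) (length js * b + 1) (F(i := g i))
    (\<lambda>j. if j \<in> set js then g j else (F(i := g i)) j)"
  proof (rule Cons.IH)
    show "distinct js" using Cons.prems by simp
    fix j G assume j: "j \<in> set js" "G j = (F(i := g i)) j"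
    then have "j \<noteq> i" using Cons.prems by auto
    then show "runs_in (p j) b G (G(j := g j))" using Cons.prems(2)[of j G] j by (simp add: fun_upd_def)
  qed
  have 3: "(\<lambda>j. if j \<in> set js then g j else (F(i := g i)) j) = (\<lambda>j. if j \<in> set (i # js) then g j else F j)"
    using Cons.prems(1) by (auto simp: fun_eq_iff)
  show ?case using runs_in_SEQ[OF 1 2] unfolding 3 by (simp add: add.assoc)
qed

definition copy :: tcom where
  "copy = IFT 0 1 (Wr (array_tape 0) 1) (IFT 0 2 (Wr (array_tape 0) 2) (IFT 0 3 (Wr (array_tape 0) 3) (Wr (array_tape 0) 4)))"

text \<open>Sets up the end markers on the left, copies the input to array \<open>0\<close> while moving the
  heads of all variables along, so that these stop at cell \<open>N\<close>, where the right end markers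
  belong, and finally blanks tape \<open>0\<close> for the output.\<close>

definition prepare :: "nat \<Rightarrow> tcom" where
  "prepare M = SEQ (seqs (\<lambda>j. SEQ (Mv j Left) (SEQ (Wr j 5) (Mv j Right))) [1..<Suc (2 * M)])
    (SEQ (WHT 0 0 (SEQ copy (SEQ (Mv 0 Right) (SEQ (Mv (array_tape 0) Right)
        (seqs (\<lambda>j. Mv j Right) (map var_tape [0..<M]))))))
    (SEQ (seqs (\<lambda>j. SEQ (Wr j 6) (SEQ (rewind j) (Wr j 1))) (map var_tape [0..<M]))
    (SEQ (rewind (array_tape 0))
    (SEQ (Mv 0 Left) (SEQ (WHT 0 0 (SEQ (Wr 0 0) (Mv 0 Left))) (Mv 0 Right))))))"

lemma tape_ok_seqs: "tape_ok K S (seqs p js) \<longleftrightarrow> (\<forall>j\<in>set js. tape_ok K S (p j)) \<and> K > 0" if "K > 0"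
  using that by (induction js) auto

lemma tape_ok_prepare:
  assumes "M \<ge> 1"
  shows "tape_ok (Suc (2 * M)) 7 (prepare M)"
proof -
  have [simp]: "var_tape x < Suc (2 * M) \<longleftrightarrow> x < M" "array_tape x < Suc (2 * M) \<longleftrightarrow> x < M" for x
    unfolding var_tape_def array_tape_def by linarith+
  show ?thesis using assms
    by (auto simp: prepare_def tape_ok_seqs tape_ok_rewind copy_def)
qed

text \<open>The initial configuration on the input \<open>w\<close>.\<close>

definition tapes0 :: "nat list \<Rightarrow> tapes" where
  "tapes0 w = (\<lambda>j. (0, if j = 0 then word_cells w else (\<lambda>_. 0)))"

definition init_st :: "nat list \<Rightarrow> st" where
  "init_st w = \<lparr>vr = \<lambda>_. 0, ar = \<lambda>a ys. if a = 0 \<and> length ys = 1 then word_cells w (int (hd ys)) else 0,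
     ot = []\<rparr>"

text \<open>The contents of an array tape that holds the word \<open>w\<close>.\<close>

definition marked :: "nat list \<Rightarrow> int \<Rightarrow> nat" where
  "marked w z = (if z = -1 then 5 else word_cells w z)"

lemma word_cells_erase:
  assumes "k < length w"
  shows "(word_cells (take (Suc k) w))(int k := 0) = word_cells (take k w)"
proof
  fix z
  show "((word_cells (take (Suc k) w))(int k := 0)) z = word_cells (take k w) z"
    using assms by (cases z) (auto simp: word_cells_def)
qed

lemma marked_extend:
  assumes "k < length w"
  shows "(marked (take k w))(int k := w ! k) = marked (take (Suc k) w)"
proof
  fix z
  show "((marked (take k w))(int k := w ! k)) z = marked (take (Suc k) w) z"
    using assms by (cases z) (auto simp: marked_def word_cells_def)
qed

lemma runs_in_copy:
  assumes "under_head (F 0) \<in> {1, 2, 3, 4}"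
  shows "runs_in copy (1 + 2 + 2 + 2) F (F(array_tape 0 := (fst (F (array_tape 0)), (snd (F (array_tape 0)))(fst (F (array_tape 0)) := under_head (F 0)))))"
proof -
  have w: "runs_in (Wr (array_tape 0) (under_head (F 0))) b F (F(array_tape 0 := (fst (F (array_tape 0)), (snd (F (array_tape 0)))(fst (F (array_tape 0)) := under_head (F 0)))))" if "b \<ge> 1" for b
    using runs_in_mono[OF runs_in_Wr that] .
  show ?thesis unfolding copy_def
  proof (intro runs_in_IFT)
  qed (use w[of "1 + 2 + 2"] w[of "1 + 2"] w[of 1] assms in \<open>auto simp del: One_nat_def\<close>)
qed

definition prepare_time :: "nat \<Rightarrow> nat \<Rightarrow> nat" where
  "prepare_time M N = (length [1..<Suc (2 * M)] * (1 + (1 + 1)) + 1) +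
     ((N * (((1 + 2 + 2 + 2) + (1 + (1 + (length (map var_tape [0..<M]) * 1 + 1)))) + 2) + 1) +
     ((length (map var_tape [0..<M]) * (1 + ((3 * N + 5) + 1)) + 1) +
     ((3 * N + 5) + (1 + ((N * ((1 + 1) + 2) + 1) + 1)))))"

lemma runs_in_prepare:
  assumes w: "set w \<subseteq> {0<..<5}" "w \<noteq> []" and r: "r 0 = 1" and M: "M \<ge> 1"
  defines "N \<equiv> length w"
  shows "\<exists>F. runs_in (prepare M) (prepare_time M N) (tapes0 w) F \<and> represents M r N (init_st w) F"
proof -
  have N: "N > 0" using w by (simp add: N_def)
  let ?J = "set (map var_tape [0..<M])"
  let ?F1 = "\<lambda>j. if j \<in> set [1..<Suc (2 * M)] then (0, marked []) else tapes0 w j"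
  \<comment> \<open>The tapes after \<open>i\<close> symbols have been copied.\<close>
  let ?G = "\<lambda>i j. if j = 0 then (int i, word_cells w) else if j = array_tape 0 then (int i, marked (take i w))
     else if j \<in> ?J then (int i, marked []) else ?F1 j"
  have J: "0 \<notin> ?J" "array_tape 0 \<notin> ?J" "distinct (map var_tape [0..<M])" by (auto simp: distinct_map inj_on_def)
  have sub: "?J \<subseteq> set [1..<Suc (2 * M)]" "array_tape 0 \<in> set [1..<Suc (2 * M)]" "0 \<notin> set [1..<Suc (2 * M)]"
    using M by (auto simp: var_tape_def array_tape_def)
  have 1: "runs_in (seqs (\<lambda>j. SEQ (Mv j Left) (SEQ (Wr j 5) (Mv j Right))) [1..<Suc (2 * M)])
    (length [1..<Suc (2 * M)] * (1 + (1 + 1)) + 1) (tapes0 w) ?F1"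
  proof (rule runs_in_seqs)
    fix j G assume "j \<in> set [1..<Suc (2 * M)]" "G j = tapes0 w j"
    then have G: "G j = (0, \<lambda>_. 0)" by (auto simp: tapes0_def)
    have m: "(\<lambda>_. 0)(-1 := 5) = marked []" by (auto simp: marked_def word_cells_def fun_eq_iff)
    have a: "runs_in (Mv j Left) 1 G (G(j := (-1, \<lambda>_. 0)))" using runs_in_Mv[of j Left G] G by simp
    have b: "runs_in (Wr j 5) 1 (G(j := (-1, \<lambda>_. 0))) (G(j := (-1, marked [])))"
      using runs_in_Wr[of j 5 "G(j := (-1, \<lambda>_. 0))"] m by simp
    have c: "runs_in (Mv j Right) 1 (G(j := (-1, marked []))) (G(j := (0, marked [])))"
      using runs_in_Mv[of j Right "G(j := (-1, marked []))"] by simp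
    show "runs_in (SEQ (Mv j Left) (SEQ (Wr j 5) (Mv j Right))) (1 + (1 + 1)) G (G(j := (0, marked [])))"
      by (rule runs_in_SEQ[OF a runs_in_SEQ[OF b c]])
  qed simp
  have "?F1 = ?G 0" using sub by (auto simp: fun_eq_iff tapes0_def)
  note 1 = 1[unfolded this]
  have 2: "runs_in (WHT 0 0 (SEQ copy (SEQ (Mv 0 Right) (SEQ (Mv (array_tape 0) Right)
        (seqs (\<lambda>j. Mv j Right) (map var_tape [0..<M]))))))
     (N * (((1 + 2 + 2 + 2) + (1 + (1 + (length (map var_tape [0..<M]) * 1 + 1)))) + 2) + 1) (?G 0) (?G N)"
  proof (rule runs_in_WHT_seq, intro conjI)
    fix i assume i: "i < N"
    have under_head: "under_head (?G i 0) = w ! i" using i by (simp add: under_head_def word_cells_def N_def)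
    have wi: "w ! i \<in> {0<..<5}" using w(1) i by (auto simp: N_def dest: nth_mem)
    then show "under_head (?G i 0) \<noteq> 0" using under_head by simp
    have four: "under_head (?G i 0) \<in> {1, 2, 3, 4}" using wi under_head by auto
    have mk: "(marked (take i w))(int i := w ! i) = marked (take (Suc i) w)"
      using i by (intro marked_extend) (simp add: N_def)
    have a: "runs_in copy (1 + 2 + 2 + 2) (?G i) ((?G i)(array_tape 0 := (int i, marked (take (Suc i) w))))"
      using runs_in_copy[of "?G i", OF four] under_head mk by (simp del: upt_Suc)
    have b: "runs_in (Mv 0 Right) 1 ((?G i)(array_tape 0 := (int i, marked (take (Suc i) w))))
       ((?G i)(array_tape 0 := (int i, marked (take (Suc i) w)), 0 := (int (Suc i), word_cells w)))"
      using runs_in_Mv[of 0 Right "(?G i)(array_tape 0 := (int i, marked (take (Suc i) w)))"] by (simp add: algebra_simps del: upt_Suc)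
    have c: "runs_in (Mv (array_tape 0) Right) 1 ((?G i)(array_tape 0 := (int i, marked (take (Suc i) w)), 0 := (int (Suc i), word_cells w)))
       ((?G i)(0 := (int (Suc i), word_cells w), array_tape 0 := (int (Suc i), marked (take (Suc i) w))))"
      (is "runs_in _ _ _ ?H")
      using runs_in_Mv[of "array_tape 0" Right "(?G i)(array_tape 0 := (int i, marked (take (Suc i) w)), 0 := (int (Suc i), word_cells w))"]
      by (simp add: algebra_simps fun_upd_twist del: upt_Suc)
    have d: "runs_in (seqs (\<lambda>j. Mv j Right) (map var_tape [0..<M])) (length (map var_tape [0..<M]) * 1 + 1) ?H
       (\<lambda>j. if j \<in> ?J then (int (Suc i), marked []) else ?H j)"
    proof (rule runs_in_seqs)
      fix j G assume "j \<in> ?J" "G j = ?H j"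
      then have "G j = (int i, marked [])" using J by auto
      then show "runs_in (Mv j Right) 1 G (G(j := (int (Suc i), marked [])))"
        using runs_in_Mv[of j Right G] by (simp add: algebra_simps)
    qed (rule J)
    have "(\<lambda>j. if j \<in> ?J then (int (Suc i), marked []) else ?H j) = ?G (Suc i)"
      using J by (auto simp: fun_eq_iff)
    note d = d[unfolded this]
    show "runs_in (SEQ copy (SEQ (Mv 0 Right) (SEQ (Mv (array_tape 0) Right) (seqs (\<lambda>j. Mv j Right) (map var_tape [0..<M])))))
       ((1 + 2 + 2 + 2) + (1 + (1 + (length (map var_tape [0..<M]) * 1 + 1)))) (?G i) (?G (Suc i))"
      by (rule runs_in_SEQ[OF a runs_in_SEQ[OF b runs_in_SEQ[OF c d]]])
  qed (simp add: under_head_def word_cells_def N_def)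
  let ?H = "\<lambda>j. if j \<in> ?J then (0, var_cells N 0) else ?G N j"
  have 3: "runs_in (seqs (\<lambda>j. SEQ (Wr j 6) (SEQ (rewind j) (Wr j 1))) (map var_tape [0..<M]))
    (length (map var_tape [0..<M]) * (1 + ((3 * N + 5) + 1)) + 1) (?G N) ?H"
  proof (rule runs_in_seqs)
    fix j G assume "j \<in> ?J" "G j = ?G N j"
    then have G: "G j = (int N, marked [])" using J by auto
    have m: "(marked [])(int N := 6) = var_cells N N"
      by (auto simp: marked_def word_cells_def var_cells_def fun_eq_iff)
    have a: "runs_in (Wr j 6) 1 G (G(j := (int N, var_cells N N)))" using runs_in_Wr[of j 6 G] G m by simp
    have b: "runs_in (rewind j) (3 * N + 5) (G(j := (int N, var_cells N N))) (G(j := (0, var_cells N N)))"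
      using runs_in_rewind[of "G(j := (int N, var_cells N N))" j N "var_cells N N" N] by simp
    have c: "runs_in (Wr j 1) 1 (G(j := (0, var_cells N N))) (G(j := (0, var_cells N 0)))"
      using runs_in_Wr[of j 1 "G(j := (0, var_cells N N))"] var_cells_update0[OF N] by simp
    show "runs_in (SEQ (Wr j 6) (SEQ (rewind j) (Wr j 1))) (1 + ((3 * N + 5) + 1)) G (G(j := (0, var_cells N 0)))"
      by (rule runs_in_SEQ[OF a runs_in_SEQ[OF b c]])
  qed (rule J)
  have tk: "marked (take N w) = marked w" by (simp add: N_def)
  have w5: "marked w z < 5" if "z \<ge> 0" for z
    using w(1) that by (auto simp: marked_def word_cells_def subset_iff)
  have H: "?H (array_tape 0) = (int N, marked w)" using J(2) by (simp add: tk)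
  have 4: "runs_in (rewind (array_tape 0)) (3 * N + 5) ?H (?H(array_tape 0 := (0, marked w)))"
    
  proof (rule runs_in_rewind[where h = N])
    show "marked w i \<noteq> 5" if "0 \<le> i" for i using w5[OF that] by simp
  qed (use H in \<open>simp_all add: marked_def\<close>)
  define I where "I = ?H(array_tape 0 := (0, marked w))"
  note 4 = 4[folded I_def]
  have I0: "I 0 = (int N, word_cells w)" using J by (simp add: I_def)
  have 5: "runs_in (Mv 0 Left) 1 I (I(0 := (int N - 1, word_cells w)))"
    using runs_in_Mv[of 0 Left I] I0 by simp
  \<comment> \<open>Tape \<open>0\<close> after the last \<open>i\<close> symbols have been erased.\<close>
  let ?K = "\<lambda>i. I(0 := (int N - 1 - int i, word_cells (take (N - i) w)))"
  have 6: "runs_in (WHT 0 0 (SEQ (Wr 0 0) (Mv 0 Left))) (N * ((1 + 1) + 2) + 1) (?K 0) (?K N)"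
  proof (rule runs_in_WHT_seq, intro conjI)
    fix i assume i: "i < N"
    have idx: "nat (int N - 1 - int i) = N - Suc i" "0 \<le> int N - 1 - int i" using i by auto
    have "w ! (N - Suc i) \<in> set w" using i by (simp add: N_def)
    then have "w ! (N - Suc i) > 0" using w(1) by auto
    then show "under_head (?K i 0) \<noteq> 0" using i idx by (simp add: under_head_def word_cells_def N_def)
    have e: "(word_cells (take (N - i) w))(int N - 1 - int i := 0) = word_cells (take (N - Suc i) w)"
      using word_cells_erase[of "N - Suc i" w] i
      by (simp add: N_def of_nat_diff Suc_diff_Suc diff_diff_add)
    have a: "runs_in (Wr 0 0) 1 (?K i) (I(0 := (int N - 1 - int i, word_cells (take (N - Suc i) w))))"
      using runs_in_Wr[of 0 0 "?K i"] e by simp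
    have b: "runs_in (Mv 0 Left) 1 (I(0 := (int N - 1 - int i, word_cells (take (N - Suc i) w)))) (?K (Suc i))"
      using runs_in_Mv[of 0 Left "I(0 := (int N - 1 - int i, word_cells (take (N - Suc i) w)))"]
      by (simp add: algebra_simps)
    show "runs_in (SEQ (Wr 0 0) (Mv 0 Left)) (1 + 1) (?K i) (?K (Suc i))" by (rule runs_in_SEQ[OF a b])
  qed (simp add: under_head_def word_cells_def)
  have K0: "?K 0 = I(0 := (int N - 1, word_cells w))" by (simp add: N_def)
  note 6 = 6[unfolded K0]
  let ?L = "I(0 := (0, word_cells []))"
  have 7: "runs_in (Mv 0 Right) 1 (?K N) ?L"
    using runs_in_Mv[of 0 Right "?K N"] by simp
  have "runs_in (prepare M) (prepare_time M N) (tapes0 w) ?L"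
    unfolding prepare_def prepare_time_def
    by (rule runs_in_SEQ[OF 1 runs_in_SEQ[OF 2 runs_in_SEQ[OF 3 runs_in_SEQ[OF 4 runs_in_SEQ[OF 5 runs_in_SEQ[OF 6 7]]]]]])
  moreover have "represents M r N (init_st w) ?L"
    unfolding represents_def
  proof (intro conjI allI impI)
    fix x assume "x < M"
    then show "?L (var_tape x) = (0, var_cells N (vr (init_st w) x))" by (simp add: init_st_def I_def)
    show "vr (init_st w) x < N" using N by (simp add: init_st_def)
  next
    fix a assume a: "a < M"
    show "\<exists>c. ?L (array_tape a) = (0, c) \<and> c (-1) = 5 \<and> (\<forall>i\<ge>0. c i < 5) \<and>
        (\<forall>ys. length ys = r a \<and> set ys \<subseteq> {..<N} \<longrightarrow> c (int (addr N ys)) = ar (init_st w) a ys)"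
    proof (cases "a = 0")
      case True
      have "marked w (int (addr N ys)) = ar (init_st w) 0 ys" if "length ys = 1" for ys
        using that by (cases ys) (auto simp: init_st_def marked_def)
      then show ?thesis using True r w5 by (intro exI[of _ "marked w"]) (auto simp: I_def marked_def[of w "-1"])
    next
      case False
      have "array_tape a \<in> set [1..<Suc (2 * M)]" using a by (auto simp: array_tape_def)
      then have "?L (array_tape a) = (0, marked [])" using False by (auto simp: I_def)
      then show ?thesis using False by (auto simp: marked_def word_cells_def init_st_def)
    qed
  qed (auto simp: init_st_def)
  ultimately show ?thesis by blast
qed

text \<open>Preparing the tapes and running the compiled program both take polynomial time, and the output
  tape represents the output of the program.\<close>

theorem poly_time_solvable_run:
  assumes well_formed: "well_formed M r c" and r: "r 0 = 1" and M: "M \<ge> 1"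
    and ok: "\<And>x. x \<in> X \<Longrightarrow> enc x \<noteq> [] \<and> set (enc x) \<subseteq> {0<..<5} \<and>
      ok x (ot (run (length (enc x)) c (init_st (enc x))))"
  shows "poly_time_solvable X enc ok"
proof -
  obtain f where f: "implemented M r c f" using compile_correct[OF well_formed] by blast
    have "poly_bounded (\<lambda>N. prepare_time M N + f N)"
    using f unfolding prepare_time_def by (intro poly_bounded_add poly_bounded_mult poly_bounded_const poly_bounded_id) (simp add: implemented_def)
  then obtain p :: "nat poly" where p: "\<And>N. prepare_time M N + f N \<le> poly p N" unfolding poly_bounded_def by blast
  let ?K = "Suc (2 * M)"
  let ?c = "SEQ (prepare M) (compile c)"
  let ?T = "machine ?K 7 ?c"
  have tape_ok: "tape_ok ?K 7 ?c" using tape_ok_prepare[OF M] tape_ok_cmp[OF well_formed] by simp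
  have "outputs_within ?T w (ot (run (length w) c (init_st w))) (poly p (length w))"
    if w: "w \<noteq> []" "set w \<subseteq> {0<..<5}" for w
  proof -
    let ?N = "length w"
    let ?\<sigma> = "run ?N c (init_st w)"
    obtain F where F: "runs_in (prepare M) (prepare_time M ?N) (tapes0 w) F" "represents M r ?N (init_st w) F"
      using runs_in_prepare[of w r M, OF w(2,1) r M] by blast
    have "?N \<ge> 1" using w by (cases w) auto
    from implementedD[OF f this F(2)] obtain F' where F': "runs_in (compile c) (f ?N) F F'" "represents M r ?N ?\<sigma> F'" by blast
    from runs_in_SEQ[OF F(1) F'(1)] obtain t where t: "t \<le> prepare_time M ?N + f ?N" "exec ?c t (tapes0 w) F'"
      unfolding runs_in_def by blast
    have "embedded ?T 0 ?c" by (simp add: embedded_def machine_def shift_state_def prod_eq_iff)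
    from exec_machine[OF t(2) tape_ok this]
    have run: "(step ?T ^^ t) (0, conf ?K (tapes0 w)) = (states ?T, conf ?K F')" by (simp add: machine_def)
    have init: "Defs.init ?T w = (0, conf ?K (tapes0 w))"
    proof -
      have "conf ?K (tapes0 w) = tapes0 w 0 # map (tapes0 w) [1..<?K]"
        by (simp add: upt_conv_Cons del: upt_Suc)
      also have "map (tapes0 w) [1..<?K] = replicate (?K - 1) (0, \<lambda>_. 0)"
        by (intro nth_equalityI) (auto simp: tapes0_def simp del: upt_Suc)
      finally show ?thesis by (simp add: Defs.init_def machine_def tapes0_def del: upt_Suc)
    qed
    have "t \<le> poly p ?N" using t(1) p[of ?N] by linarith
    then have "(step ?T ^^ poly p ?N) (Defs.init ?T w) = (step ?T ^^ (poly p ?N - t)) ((step ?T ^^ t) (Defs.init ?T w))"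
      using funpow_add[of "poly p ?N - t" t "step ?T"] by (simp only: le_add_diff_inverse2 comp_apply)
    also have "\<dots> = (states ?T, conf ?K F')" unfolding init run by (rule funpow_step_halted)
    also have "conf ?K F' = F' 0 # map F' [1..<?K]" by (simp add: upt_conv_Cons del: upt_Suc)
    also have "F' 0 = (int (length (ot ?\<sigma>)), word_cells (ot ?\<sigma>))" using F'(2) by (simp add: represents_def)
    finally show ?thesis using F'(2) unfolding outputs_within_def
      by (auto simp: represents_def word_cells_def)
  qed
  moreover have "turing_machine ?T" using tape_ok by (rule turing_machine_machine) auto
  moreover have "set (enc x) \<subseteq> {0<..<symbols ?T}" if "x \<in> X" for x
    using ok[OF that] by (auto simp: machine_def)
  ultimately show ?thesis unfolding poly_time_solvable_def using ok by blast
qed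

section \<open>Orientations under capacities\<close>

text \<open>In an orientation, a pair \<open>(i, j)\<close> says that \<open>i\<close> owns the edge between
  \<open>i\<close> and \<open>j\<close>.\<close>

definition load :: "('u \<times> 'u) set \<Rightarrow> 'u \<Rightarrow> nat" where
  "load R i = card {j. (i, j) \<in> R}"

definition orients :: "('u \<times> 'u) set \<Rightarrow> ('u \<times> 'u) set \<Rightarrow> bool" where
  "orients E R \<longleftrightarrow> R \<subseteq> E \<union> E\<inverse> \<and> (\<forall>(i, j) \<in> E. (i, j) \<in> R \<longleftrightarrow> (j, i) \<notin> R)"

text \<open>The relation \<open>E\<close> contains every edge in one direction, the one in which the
  procedure starts. Capacities are integers, as a star with more edges than there are other vertices has a
  negative one. The bound \<open>N\<close> is the greatest height.\<close>

locale capacitated_graph =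
  fixes U :: "'u set" and E :: "('u \<times> 'u) set" and cap :: "'u \<Rightarrow> int" and N :: nat
  assumes fin: "finite U" and card_U: "card U \<le> N" and E_sub: "E \<subseteq> U \<times> U"
    and antisym_E: "(i, j) \<in> E \<Longrightarrow> (j, i) \<notin> E"
begin

text \<open>The last condition holds since only overloaded nodes give edges away or are raised: a node whose
  capacity is once exhausted remains so.\<close>

definition valid :: "('u \<times> 'u) set \<Rightarrow> ('u \<Rightarrow> nat) \<Rightarrow> bool" where
  "valid R h \<longleftrightarrow> orients E R \<and> (\<forall>i. h i \<le> N) \<and> (\<forall>(i, j) \<in> R. h i \<le> Suc (h j)) \<and>
     (\<forall>i\<in>U. cap i \<le> load E i \<or> h i > 0 \<longrightarrow> cap i \<le> load R i)"

definition excess :: "('u \<times> 'u) set \<Rightarrow> 'u \<Rightarrow> bool" where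
  "excess R i \<longleftrightarrow> cap i < load R i"

text \<open>Raising a node increases the first sum by \<open>N\<close> and the second one by at most its
  load, which is less than \<open>N\<close>. A push turns a difference of \<open>1\<close> into
  \<open>-1\<close>. So both moves increase the potential.\<close>

definition potential :: "('u \<times> 'u) set \<Rightarrow> ('u \<Rightarrow> nat) \<Rightarrow> int" where
  "potential R h = int N * (\<Sum>i\<in>U. int (h i)) - (\<Sum>(i, j)\<in>R. int (h i) - int (h j))"

text \<open>The edges inside \<open>W\<close> are owned by nodes of \<open>W\<close>, whichever way they are
  oriented.\<close>

definition obstruction :: "'u set \<Rightarrow> bool" where
  "obstruction W \<longleftrightarrow> W \<subseteq> U \<and> (\<Sum>i\<in>W. cap i) < card (E \<inter> W \<times> W)"

lemma orients_sub: "orients E R \<Longrightarrow> R \<subseteq> U \<times> U"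
  using E_sub by (auto simp: orients_def)

lemma orients_antisym: "orients E R \<Longrightarrow> (i, j) \<in> R \<Longrightarrow> (j, i) \<notin> R"
  by (auto simp: orients_def)

lemma orients_finite: "orients E R \<Longrightarrow> finite R"
  using orients_sub fin by (meson finite_SigmaI finite_subset)

lemma valid_start: "valid E (\<lambda>_. 0)"
  using antisym_E by (auto simp: valid_def orients_def)

lemma load_exchange:
  assumes "finite R" "(i, j) \<in> R" "(j, i) \<notin> R" "i \<noteq> j"
  shows "load (insert (j, i) (R - {(i, j)})) k =
    (if k = i then load R i - 1 else if k = j then Suc (load R j) else load R k)"
proof -
  have f: "finite {b. (a, b) \<in> R}" for a
    using finite_imageI[OF assms(1), of snd] by (rule finite_subset[rotated]) force
  have "{b. (i, b) \<in> insert (j, i) (R - {(i, j)})} = {b. (i, b) \<in> R} - {j}"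
    "{b. (j, b) \<in> insert (j, i) (R - {(i, j)})} = insert i {b. (j, b) \<in> R}"
    "k \<noteq> i \<Longrightarrow> k \<noteq> j \<Longrightarrow> {b. (k, b) \<in> insert (j, i) (R - {(i, j)})} = {b. (k, b) \<in> R}"
    using assms(4) by auto
  then show ?thesis using assms f by (auto simp: load_def)
qed

lemma push:
  assumes "valid R h" "excess R i" "(i, j) \<in> R" "h j < h i"
  defines "R' \<equiv> insert (j, i) (R - {(i, j)})"
  shows "valid R' h" "potential R' h > potential R h"
proof -
  have o: "orients E R" using assms by (simp add: valid_def)
  have ij: "(j, i) \<notin> R" "i \<noteq> j" "finite R"
    using orients_antisym[OF o] orients_finite[OF o] assms by auto
  \<comment> \<open>Edges lead down by at most one level.\<close>
  have h: "h i = Suc (h j)" using assms by (fastforce simp: valid_def)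
  have "orients E R'" using o assms(3) ij(1) unfolding orients_def R'_def by auto
  moreover have "\<forall>(a, b) \<in> R'. h a \<le> Suc (h b)" using assms h by (auto simp: valid_def)
  moreover have "cap k \<le> load R' k" if "k \<in> U" "cap k \<le> load E k \<or> h k > 0" for k
  proof -
    have "cap k \<le> load R k" using assms(1) that by (auto simp: valid_def)
    moreover have "cap i < load R i" using assms(2) by (simp add: excess_def)
    ultimately show ?thesis using load_exchange[OF ij(3) assms(3) ij(1,2), of k]
      unfolding R'_def by (auto split: if_splits)
  qed
  ultimately show "valid R' h" using assms(1) by (auto simp: valid_def)
  have "(\<Sum>(a, b)\<in>R. int (h a) - int (h b)) = 1 + (\<Sum>(a, b)\<in>R - {(i, j)}. int (h a) - int (h b))"
    using sum.remove[OF ij(3) assms(3), of "\<lambda>(a, b). int (h a) - int (h b)"] h by simp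
  moreover have "(\<Sum>(a, b)\<in>R'. int (h a) - int (h b)) = - 1 + (\<Sum>(a, b)\<in>R - {(i, j)}. int (h a) - int (h b))"
    unfolding R'_def using ij h by (subst sum.insert) auto
  ultimately show "potential R' h > potential R h" by (simp add: potential_def)
qed

lemma load_less:
  assumes "orients E R" "i \<in> U"
  shows "load R i < N"
proof -
  have "{j. (i, j) \<in> R} \<subseteq> U - {i}" using orients_sub[OF assms(1)] orients_antisym[OF assms(1)] by auto
  then have "load R i \<le> card (U - {i})" unfolding load_def using fin by (intro card_mono) auto
  also have "\<dots> < card U" using fin assms(2) by (metis card_Diff1_less)
  finally show ?thesis using card_U by linarith
qed

text \<open>Raising \<open>i\<close> respects the heights because no edge of \<open>i\<close> leads down.
  Each of the edges that \<open>i\<close> owns adds \<open>1\<close> to the sum over the edges, and there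
  are fewer than \<open>N\<close> of them.\<close>

lemma relabel:
  assumes "valid R h" "excess R i" "i \<in> U" "\<And>j. (i, j) \<in> R \<Longrightarrow> h i \<le> h j" "h i < N"
  defines "h' \<equiv> h(i := Suc (h i))"
  shows "valid R h'" "potential R h' > potential R h"
proof -
  have o: "orients E R" using assms by (simp add: valid_def)
  have "h' a \<le> Suc (h' b)" if "(a, b) \<in> R" for a b
  proof -
    have "h a \<le> Suc (h b)" using assms(1) that by (auto simp: valid_def)
    then show ?thesis using assms(4) that by (auto simp: h'_def)
  qed
  moreover have "cap k \<le> load R k" if "k \<in> U" "cap k \<le> load E k \<or> h' k > 0" for k
    using assms(1,2) that by (cases "k = i") (auto simp: valid_def excess_def h'_def)
  moreover have "h' k \<le> N" for k using assms(1,5) by (simp add: valid_def h'_def)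
  ultimately show "valid R h'" using o unfolding valid_def by blast
  have R: "finite R" by (rule orients_finite[OF o])
  have "(\<Sum>(a, b)\<in>R. int (h' a) - int (h' b)) \<le>
     (\<Sum>(a, b)\<in>R. (int (h a) - int (h b)) + (if a = i then 1 else 0))"
    by (rule sum_mono) (auto simp: h'_def)
  also have "\<dots> = (\<Sum>(a, b)\<in>R. int (h a) - int (h b)) + (\<Sum>(a, b)\<in>R. if a = i then 1 else 0)"
    by (simp add: sum.distrib case_prod_unfold)
  also have "(\<Sum>(a, b)\<in>R. if a = i then 1 else 0) = int (card (R \<inter> {x. fst x = i}))"
    using R by (simp add: case_prod_unfold sum.If_cases)
  also have "R \<inter> {x. fst x = i} = Pair i ` {j. (i, j) \<in> R}" by auto
  also have "card \<dots> = load R i" by (simp add: load_def card_image inj_on_def)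
  finally have 1: "(\<Sum>(a, b)\<in>R. int (h' a) - int (h' b)) \<le> (\<Sum>(a, b)\<in>R. int (h a) - int (h b)) + int (load R i)" .
  have "(\<Sum>k\<in>U. int (h' k)) = (\<Sum>k\<in>U. int (h k) + (if k = i then 1 else 0))"
    by (rule sum.cong) (auto simp: h'_def)
  also have "\<dots> = (\<Sum>k\<in>U. int (h k)) + 1" using fin assms(3) by (simp add: sum.distrib)
  finally have 2: "int N * (\<Sum>k\<in>U. int (h' k)) = int N * (\<Sum>k\<in>U. int (h k)) + int N"
    by (simp add: algebra_simps)
  show "potential R h' > potential R h"
    using 1 2 load_less[OF o assms(3)] unfolding potential_def by linarith
qed

lemma potential_le:
  assumes "valid R h"
  shows "potential R h \<le> int (2 * N ^ 3)"
proof -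
  have o: "orients E R" using assms by (simp add: valid_def)
  have h: "int (h i) \<le> int N" for i using assms by (simp add: valid_def)
  have "(\<Sum>i\<in>U. int (h i)) \<le> int (card U) * int N"
    using sum_bounded_above[of U "\<lambda>i. int (h i)" "int N"] h by simp
  also have "\<dots> \<le> int N * int N" using card_U by (simp add: mult_right_mono)
  finally have 1: "int N * (\<Sum>i\<in>U. int (h i)) \<le> int N * (int N * int N)" by (simp add: mult_left_mono)
  have "(\<Sum>(i, j)\<in>R. int (h j) - int (h i)) \<le> int (card R) * int N"
  proof (rule sum_bounded_above)
    fix x assume "x \<in> R"
    show "(case x of (i, j) \<Rightarrow> int (h j) - int (h i)) \<le> int N"
      using h[of "snd x"] by (simp add: case_prod_unfold)
  qed
  also have "int (card R) * int N \<le> (int N * int N) * int N"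
  proof -
    have "card R \<le> card U * card U"
      using card_mono[OF _ orients_sub[OF o]] fin by (simp add: card_cartesian_product)
    also have "\<dots> \<le> N * N" using card_U by (intro mult_le_mono)
    finally have "int (card R) \<le> int N * int N" by (metis of_nat_le_iff of_nat_mult)
    then show ?thesis by (rule mult_right_mono) simp
  qed
  finally have 2: "(\<Sum>(i, j)\<in>R. int (h j) - int (h i)) \<le> (int N * int N) * int N" .
  have "(\<Sum>(i, j)\<in>R. int (h j) - int (h i)) = - (\<Sum>(i, j)\<in>R. int (h i) - int (h j))"
    by (simp add: case_prod_unfold flip: sum_negf)
  then show ?thesis using 1 2 by (simp add: potential_def power3_eq_cube)
qed

text \<open>Reversing the edges of \<open>E\<close> that the orientation reverses is a bijection.\<close>

lemma card_orientation:
  assumes "orients E R"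
  shows "card (E \<inter> W \<times> W) = card (R \<inter> W \<times> W)"
proof -
  let ?A = "E \<inter> R \<inter> W \<times> W" and ?B = "(E - R) \<inter> W \<times> W"
  have f: "finite E" "finite R" using orients_finite[OF assms] E_sub fin
    by (auto intro: finite_subset)
  have "card (E \<inter> W \<times> W) = card (?A \<union> ?B)" by (rule arg_cong[where f = card]) auto
  also have "\<dots> = card ?A + card ?B" using f by (intro card_Un_disjoint) auto
  also have "card ?B = card (prod.swap ` ?B)" by (simp add: card_image)
  also have "card ?A + \<dots> = card (?A \<union> prod.swap ` ?B)"
    using f antisym_E by (intro card_Un_disjoint[symmetric]) auto
  also have "?A \<union> prod.swap ` ?B = R \<inter> W \<times> W"
  proof
    show "?A \<union> prod.swap ` ?B \<subseteq> R \<inter> W \<times> W" using assms by (auto simp: orients_def)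
    show "R \<inter> W \<times> W \<subseteq> ?A \<union> prod.swap ` ?B"
    proof
      fix x assume x: "x \<in> R \<inter> W \<times> W"
      obtain a b where ab: "x = (a, b)" by (cases x)
      show "x \<in> ?A \<union> prod.swap ` ?B"
      proof (cases "x \<in> E")
        case False
        then have "(b, a) \<in> E" using assms x ab by (auto simp: orients_def)
        moreover have "(b, a) \<notin> R" using orients_antisym[OF assms] x ab by auto
        ultimately show ?thesis using x ab by (intro UnI2 image_eqI[of _ _ "(b, a)"]) auto
      qed (use x in auto)
    qed
  qed
  finally show ?thesis .
qed

lemma sum_load:
  assumes "finite R" "finite W"
  shows "card {e \<in> R. fst e \<in> W} = (\<Sum>i\<in>W. load R i)"
proof -
  have "finite {j. (i, j) \<in> R}" for i
    using finite_imageI[OF assms(1), of snd] by (rule finite_subset[rotated]) force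
  moreover have "{e \<in> R. fst e \<in> W} = Sigma W (\<lambda>i. {j. (i, j) \<in> R})" by auto
  ultimately show ?thesis using assms(2) by (simp add: load_def)
qed

text \<open>The other nodes have fewer than \<open>N\<close> heights, so one of the heights below
  \<open>N\<close> does not occur. Edges lead down by at most one level, hence none leads from above this
  level to below it. All nodes above it have positive heights and so own at least as many edges as their
  capacity, and \<open>i\<close> owns more.\<close>

lemma stuck:
  assumes "valid R h" "excess R i" "i \<in> U" "h i = N"
  shows "\<exists>W. obstruction W"
proof -
  have o: "orients E R" using assms by (simp add: valid_def)
  have "card (h ` U - {N}) < card (h ` U)" using fin assms(3,4) by (intro card_Diff1_less) auto
  also have "card (h ` U) \<le> N" using card_image_le[OF fin, of h] card_U by linarith
  finally have "\<not> {..<N} \<subseteq> h ` U - {N}"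
    using card_mono[of "h ` U - {N}" "{..<N}"] fin by auto
  then obtain k where k: "k < N" "k \<notin> h ` U" by auto
  \<comment> \<open>Above the empty level \<open>k\<close>.\<close>
  let ?W = "{u \<in> U. k < h u}"
  have "h v > k" if "(u, v) \<in> R" "u \<in> ?W" for u v
  proof -
    have "v \<in> U" "h u \<le> Suc (h v)" using that assms(1) orients_sub[OF o] by (auto simp: valid_def)
    moreover from this have "h v \<noteq> k" using k(2) by blast
    ultimately show ?thesis using that(2) by simp
  qed
  then have "R \<inter> ?W \<times> ?W = {e \<in> R. fst e \<in> ?W}" using orients_sub[OF o] by auto
  then have "card (E \<inter> ?W \<times> ?W) = (\<Sum>u\<in>?W. load R u)"
    using card_orientation[OF o, of ?W] sum_load[OF orients_finite[OF o], of ?W] fin by simp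
  moreover have "(\<Sum>u\<in>?W. cap u) < (\<Sum>u\<in>?W. int (load R u))"
  proof (rule sum_strict_mono_ex1)
    show "\<forall>u\<in>?W. cap u \<le> int (load R u)" using assms(1) by (auto simp: valid_def)
    show "\<exists>u\<in>?W. cap u < int (load R u)"
      using assms(2-4) k by (intro bexI[of _ i]) (auto simp: excess_def)
  qed (use fin in auto)
  ultimately have "obstruction ?W" by (auto simp: obstruction_def)
  then show ?thesis by blast
qed

text \<open>In a valid state of maximal potential, an overloaded node could make neither move, so it would
  have height \<open>N\<close>.\<close>

theorem orientation_exists:
  assumes "\<And>W. \<not> obstruction W"
  shows "\<exists>R h. valid R h \<and> (\<forall>i\<in>U. \<not> excess R i)"
proof -
  let ?P = "\<lambda>(R, h). valid R h \<and> potential R h \<ge> 0"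
  have "?P (E, \<lambda>_. 0)" using valid_start by (simp add: potential_def)
  moreover have "\<forall>x. ?P x \<longrightarrow> (\<lambda>(R, h). nat (potential R h)) x < Suc (2 * N ^ 3)"
  proof (intro allI impI)
    fix x assume "?P x"
    then show "(\<lambda>(R, h). nat (potential R h)) x < Suc (2 * N ^ 3)"
      using potential_le[of "fst x" "snd x"]
      by (simp add: case_prod_unfold less_Suc_eq_le del: of_nat_mult of_nat_power)
  qed
  ultimately obtain x where x: "?P x" "\<forall>y. ?P y \<longrightarrow> (\<lambda>(R, h). nat (potential R h)) y \<le> (\<lambda>(R, h). nat (potential R h)) x"
    using ex_has_greatest_nat[of ?P "(E, \<lambda>_. 0)" "\<lambda>(R, h). nat (potential R h)" "Suc (2 * N ^ 3)"] by blast
  obtain R h where xe: "x = (R, h)" by (cases x)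
  have v: "valid R h" "potential R h \<ge> 0" using x(1) xe by auto
  have max: "\<not> (valid R' h' \<and> potential R' h' > potential R h)" for R' h'
    using x(2)[rule_format, of "(R', h')"] v xe by auto
  have "\<not> excess R i" if i: "i \<in> U" for i
  proof
    assume ov: "excess R i"
    consider j where "(i, j) \<in> R" "h j < h i" | "\<And>j. (i, j) \<in> R \<Longrightarrow> h i \<le> h j" "h i < N" | "h i = N"
    proof -
      have "h i \<le> N" using v(1) by (simp add: valid_def)
      then have "h i < N \<or> h i = N" by linarith
      then show ?thesis using that by (meson not_le)
    qed
    then show False
    proof cases
      case 1
      then show ?thesis using push[OF v(1) ov 1] max by blast
    next
      case 2
      then show ?thesis using relabel[OF v(1) ov i 2] max by blast
    next
      case 3
      then show ?thesis using stuck[OF v(1) ov i] assms by blast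
    qed
  qed
  then show ?thesis using v by blast
qed

end

section \<open>Star sizes as capacities\<close>

text \<open>Stars are indexed by \<open>I\<close>, with centres \<open>c\<close> and sizes \<open>m\<close>,
  and pairs by \<open>J\<close>, by means of the bijection \<open>pe\<close>. The indices have a common type
  because both are nodes of the graph to be oriented. This also allows the algorithm to use numbers for
  both.\<close>

locale star_instance =
  fixes V :: "'a set" and mu :: "'a set \<Rightarrow> nat"
    and I J :: "'u set" and c :: "'u \<Rightarrow> 'a" and m :: "'u \<Rightarrow> nat" and pe :: "'u \<Rightarrow> 'a set"
  assumes finV: "finite V" and finI: "finite I" and IJ: "I \<inter> J = {}"
    and pe: "bij_betw pe J (pairs V)" and c: "c ` I \<subseteq> V"
begin

definition edges_of :: "'u \<Rightarrow> 'a set \<Rightarrow> 'a set set" where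
  "edges_of s L = (\<lambda>l. {c s, l}) ` L"

definition feasible :: "('u \<Rightarrow> 'a set) \<Rightarrow> bool" where
  "feasible L \<longleftrightarrow> (\<forall>s\<in>I. L s \<subseteq> V - {c s} \<and> card (L s) = m s) \<and>
     (\<forall>e\<in>pairs V. card {s\<in>I. e \<in> edges_of s (L s)} \<le> mu e)"

definition hall :: bool where
  "hall \<longleftrightarrow> (\<forall>S\<subseteq>I. (\<Sum>s\<in>S. m s) \<le> (\<Sum>e\<in>pairs V. min (mu e) (card {s\<in>S. c s \<in> e})))"

text \<open>Every edge is directed away from its star, which owns it at first.\<close>

definition inc :: "('u \<times> 'u) set" where
  "inc = {(s, p). s \<in> I \<and> p \<in> J \<and> c s \<in> pe p}"

text \<open>A centre \<open>v\<close> lies in \<open>card V - 1\<close> pairs. A star of size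
  \<open>m\<close> uses \<open>m\<close> of these edges and keeps the others.\<close>

definition slack :: "'u \<Rightarrow> int" where
  "slack i = (if i \<in> I then int (card V) - 1 - int (m i) else int (mu (pe i)))"

lemma finite_pairs: "finite (pairs V)"
proof -
  have "pairs V \<subseteq> (\<lambda>(u, v). {u, v}) ` (V \<times> V)" by (auto simp: pairs_def)
  then show ?thesis using finV by (meson finite_SigmaI finite_imageI finite_subset)
qed

lemma pe_image: "pe ` J = pairs V"
  using pe by (rule bij_betw_imp_surj_on)

lemma finJ: "finite J"
  using pe finite_pairs bij_betw_finite by blast

lemma pairs_at:
  assumes "v \<in> V"
  shows "{e \<in> pairs V. v \<in> e} = (\<lambda>l. {v, l}) ` (V - {v})"
  using assms by (auto simp: pairs_def image_iff insert_commute)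

lemma inj_pair: "inj_on (\<lambda>l. {v, l}) (X - {v})"
  by (auto simp: inj_on_def doubleton_eq_iff)

lemma card_pairs_at:
  assumes "v \<in> V"
  shows "card {e \<in> pairs V. v \<in> e} = card V - 1"
  using assms finV by (simp add: pairs_at card_image inj_pair)

lemma card_J:
  shows "card {p \<in> J. P (pe p)} = card {e \<in> pairs V. P e}"
proof -
  have "inj_on pe {p \<in> J. P (pe p)}"
    using pe by (auto simp: bij_betw_def inj_on_def)
  moreover have "pe ` {p \<in> J. P (pe p)} = {e \<in> pairs V. P e}"
    unfolding pe_image[symmetric] by auto
  ultimately show ?thesis by (metis card_image)
qed

lemma inc_degree:
  assumes "s \<in> I"
  shows "card {p \<in> J. c s \<in> pe p} = card V - 1"
  using card_J[of "\<lambda>e. c s \<in> e"] card_pairs_at[of "c s"] assms c by auto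

lemma load_inc:
  assumes "s \<in> I"
  shows "load inc s = card V - 1"
proof -
  have "{j. (s, j) \<in> inc} = {p \<in> J. c s \<in> pe p}" using assms by (auto simp: inc_def)
  then show ?thesis using inc_degree[OF assms] by (simp add: load_def)
qed

lemma card_V_pos: "s \<in> I \<Longrightarrow> card V > 0"
  using c finV by (auto simp: card_gt_0_iff)

lemma feasible_hall:
  assumes "feasible L"
  shows hall
  unfolding hall_def
proof (intro allI impI)
  fix S assume S: "S \<subseteq> I"
  have fS: "finite S" using S finI finite_subset by blast
  have "(\<Sum>s\<in>S. m s) = (\<Sum>s\<in>S. card {e \<in> pairs V. e \<in> edges_of s (L s)})"
  proof (rule sum.cong)
    fix s assume "s \<in> S"
    then have s: "L s \<subseteq> V - {c s}" "card (L s) = m s" "c s \<in> V" using assms S c by (auto simp: feasible_def)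
    have "(\<lambda>l. {c s, l}) ` L s \<subseteq> pairs V"
      using s(1) pairs_at[OF s(3)] by blast
    then have "{e \<in> pairs V. e \<in> edges_of s (L s)} = (\<lambda>l. {c s, l}) ` L s"
      by (auto simp: edges_of_def)
    moreover have "inj_on (\<lambda>l. {c s, l}) (L s)" by (rule inj_on_subset[OF inj_pair s(1)])
    ultimately show "m s = card {e \<in> pairs V. e \<in> edges_of s (L s)}" using s(2) by (simp add: card_image)
  qed simp
  also have "\<dots> = (\<Sum>e\<in>pairs V. card {s \<in> S. e \<in> edges_of s (L s)})"
    using fS finite_pairs by (intro sum_multicount_gen) auto
  also have "\<dots> \<le> (\<Sum>e\<in>pairs V. min (mu e) (card {s\<in>S. c s \<in> e}))"
  proof (rule sum_mono)
    fix e assume e: "e \<in> pairs V"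
    have "card {s \<in> S. e \<in> edges_of s (L s)} \<le> card {s\<in>I. e \<in> edges_of s (L s)}"
      using S finI by (intro card_mono) auto
    also have "\<dots> \<le> mu e" using assms e by (simp add: feasible_def)
    finally have "card {s \<in> S. e \<in> edges_of s (L s)} \<le> mu e" .
    moreover have "card {s \<in> S. e \<in> edges_of s (L s)} \<le> card {s\<in>S. c s \<in> e}"
      using fS by (intro card_mono) (auto simp: edges_of_def)
    ultimately show "card {s \<in> S. e \<in> edges_of s (L s)} \<le> min (mu e) (card {s\<in>S. c s \<in> e})" by simp
  qed
  finally show "(\<Sum>s\<in>S. m s) \<le> (\<Sum>e\<in>pairs V. min (mu e) (card {s\<in>S. c s \<in> e}))" .
qed

lemma sum_J: "(\<Sum>p\<in>J. g (pe p)) = (\<Sum>e\<in>pairs V. g e)"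
  using pe by (rule sum.reindex_bij_betw)

text \<open>Let \<open>S\<close> and \<open>P\<close> be the stars and pairs in \<open>W\<close>, and
  \<open>d(e)\<close> the number of stars of \<open>S\<close> centred in \<open>e\<close>. The stars in
  \<open>S\<close> have \<open>\<Sum> d(e)\<close> incident edges in total, the sum taken over all pairs,
  and those in \<open>W\<close> contribute the sum over \<open>P\<close>. So being an obstruction means that
  the sizes of the stars in \<open>S\<close> add up to more than the sum of \<open>\<mu>(e)\<close> over
  \<open>P\<close> and of \<open>d(e)\<close> over the other pairs, which is at least \<open>\<Sum> min
  (\<mu>(e)) (d(e))\<close>. Nodes other than stars and pairs do no harm, having no edges and no negative
  capacity.\<close>

lemma obstruction_not_hall:
  assumes W: "finite W" "(\<Sum>i\<in>W. cap i) < int (card (inc \<inter> W \<times> W))"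
    and cap: "\<And>i. i \<in> I \<union> J \<Longrightarrow> cap i = slack i" "\<And>i. i \<notin> I \<union> J \<Longrightarrow> cap i \<ge> 0"
  shows "\<not> hall"
proof
  assume hall
  let ?S = "W \<inter> I" and ?P = "W \<inter> J"
  have f: "finite ?S" "finite ?P" using W by auto
  let ?d = "\<lambda>e. card {s\<in>?S. c s \<in> e}"
  have "inc \<inter> W \<times> W = (\<Union>p\<in>?P. {s\<in>?S. c s \<in> pe p} \<times> {p})" by (auto simp: inc_def)
  also have "card \<dots> = (\<Sum>p\<in>?P. card ({s\<in>?S. c s \<in> pe p} \<times> {p}))"
    using f by (intro card_UN_disjoint) (auto intro: finite_subset[OF _ f(1)])
  also have "\<dots> = (\<Sum>p\<in>?P. ?d (pe p))" by (simp add: card_cartesian_product)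
  finally have 1: "card (inc \<inter> W \<times> W) = (\<Sum>p\<in>?P. ?d (pe p))" .
  have "(\<Sum>i\<in>?S \<union> ?P. slack i) \<le> (\<Sum>i\<in>W. cap i)"
  proof -
    have "(\<Sum>i\<in>?S \<union> ?P. slack i) = (\<Sum>i\<in>?S \<union> ?P. cap i)" by (rule sum.cong) (auto simp: cap)
    also have "\<dots> \<le> (\<Sum>i\<in>W. cap i)" using W(1) cap(2) by (intro sum_mono2) auto
    finally show ?thesis .
  qed
  also have "(\<Sum>i\<in>?S \<union> ?P. slack i) = (\<Sum>s\<in>?S. slack s) + (\<Sum>p\<in>?P. slack p)"
    using f IJ by (intro sum.union_disjoint) auto
  also have "(\<Sum>s\<in>?S. slack s) = (\<Sum>s\<in>?S. int (card V - 1)) - (\<Sum>s\<in>?S. int (m s))"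
  proof -
    have "(\<Sum>s\<in>?S. slack s) = (\<Sum>s\<in>?S. int (card V - 1) - int (m s))"
      using card_V_pos by (intro sum.cong) (auto simp: slack_def of_nat_diff Suc_le_eq)
    then show ?thesis by (simp add: sum_subtractf)
  qed
  also have "(\<Sum>s\<in>?S. int (card V - 1)) = int (\<Sum>s\<in>?S. card {p \<in> J. c s \<in> pe p})"
    by (simp add: inc_degree)
  also have "(\<Sum>s\<in>?S. card {p \<in> J. c s \<in> pe p}) = (\<Sum>p\<in>J. ?d (pe p))"
    using f finJ by (intro sum_multicount_gen) auto
  also have "(\<Sum>p\<in>?P. slack p) = int (\<Sum>p\<in>?P. mu (pe p))"
    using IJ by (auto simp: slack_def intro!: sum.cong)
  finally have 2: "int (\<Sum>p\<in>J. ?d (pe p)) + int (\<Sum>p\<in>?P. mu (pe p)) < int (\<Sum>s\<in>?S. m s) + int (\<Sum>p\<in>?P. ?d (pe p))"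
    using W(2) 1 by simp
  have "(\<Sum>s\<in>?S. m s) \<le> (\<Sum>p\<in>J. min (mu (pe p)) (?d (pe p)))"
    using \<open>hall\<close> sum_J[of "\<lambda>e. min (mu e) (?d e)"] unfolding hall_def by auto
  also have "\<dots> = (\<Sum>p\<in>?P. min (mu (pe p)) (?d (pe p))) + (\<Sum>p\<in>J - ?P. min (mu (pe p)) (?d (pe p)))"
    using sum.subset_diff[of ?P J "\<lambda>p. min (mu (pe p)) (?d (pe p))"] finJ by simp
  also have "\<dots> \<le> (\<Sum>p\<in>?P. mu (pe p)) + (\<Sum>p\<in>J - ?P. ?d (pe p))"
    by (intro add_mono sum_mono) auto
  finally have 3: "(\<Sum>s\<in>?S. m s) \<le> (\<Sum>p\<in>?P. mu (pe p)) + (\<Sum>p\<in>J - ?P. ?d (pe p))" .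
  have "(\<Sum>p\<in>J. ?d (pe p)) = (\<Sum>p\<in>?P. ?d (pe p)) + (\<Sum>p\<in>J - ?P. ?d (pe p))"
    using sum.subset_diff[of ?P J "\<lambda>p. ?d (pe p)"] finJ by simp
  then show False using 2 3 by linarith
qed

definition leaves :: "('u \<times> 'u) set \<Rightarrow> 'u \<Rightarrow> 'a set" where
  "leaves R s = {l \<in> V - {c s}. \<exists>p\<in>J. pe p = {c s, l} \<and> (p, s) \<in> R}"

text \<open>A star with \<open>card V - 1\<close> edges that owns all but \<open>m\<close> of them leaves
  \<open>m\<close> to their pairs.\<close>

lemma orientation_feasible:
  assumes R: "orients inc R" and le: "\<And>p. p \<in> J \<Longrightarrow> load R p \<le> mu (pe p)"
    and eq: "\<And>s. s \<in> I \<Longrightarrow> int (load R s) = slack s"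
  shows "feasible (leaves R)"
  unfolding feasible_def
proof (intro conjI ballI)
  fix s assume s: "s \<in> I"
  have sV: "c s \<in> V" using s c by auto
  show "leaves R s \<subseteq> V - {c s}" by (auto simp: leaves_def)
  let ?D = "{p \<in> J. c s \<in> pe p}"
  let ?X = "{p \<in> J. c s \<in> pe p \<and> (p, s) \<in> R}"
  have sJ: "s \<notin> J" using s IJ by auto
  have own: "{p. (s, p) \<in> R} = {p \<in> ?D. (p, s) \<notin> R}"
  proof -
    have "(s, p) \<in> R \<longleftrightarrow> p \<in> J \<and> c s \<in> pe p \<and> (p, s) \<notin> R" for p
      using R s sJ IJ unfolding orients_def inc_def by auto
    then show ?thesis by auto
  qed
  have "card ?D = card ?X + card {p. (s, p) \<in> R}"
    unfolding own using finJ by (subst card_Un_disjoint[symmetric]) (auto intro: arg_cong[where f = card])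
  then have "int (card ?X) = int (card V - 1) - slack s"
    using inc_degree[OF s] eq[OF s] by (simp add: load_def)
  then have X: "card ?X = m s" using s card_V_pos[OF s] by (simp add: slack_def of_nat_diff Suc_le_eq)
  have "pe ` ?X = (\<lambda>l. {c s, l}) ` leaves R s"
  proof
    show "pe ` ?X \<subseteq> (\<lambda>l. {c s, l}) ` leaves R s"
    proof
      fix e assume "e \<in> pe ` ?X"
      then obtain p where p: "p \<in> ?X" "e = pe p" by auto
      then have "e \<in> {e \<in> pairs V. c s \<in> e}" using pe by (auto simp: bij_betw_def)
      then obtain l where "l \<in> V - {c s}" "e = {c s, l}" using pairs_at[OF sV] by auto
      then show "e \<in> (\<lambda>l. {c s, l}) ` leaves R s" using p by (auto simp: leaves_def)
    qed
    show "(\<lambda>l. {c s, l}) ` leaves R s \<subseteq> pe ` ?X" by (auto simp: leaves_def image_iff)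
  qed
  moreover have "card (pe ` ?X) = card ?X"
    using pe by (intro card_image) (auto simp: bij_betw_def inj_on_def)
  moreover have "card ((\<lambda>l. {c s, l}) ` leaves R s) = card (leaves R s)"
    by (intro card_image) (auto simp: inj_on_def leaves_def doubleton_eq_iff)
  ultimately show "card (leaves R s) = m s" using X by simp
next
  fix e assume "e \<in> pairs V"
  then obtain p where p: "p \<in> J" "pe p = e" unfolding pe_image[symmetric] by auto
  have "finite {j. (p, j) \<in> R}"
  proof (rule finite_subset)
    show "{j. (p, j) \<in> R} \<subseteq> I \<union> J" using R by (auto simp: orients_def inc_def)
  qed (use finI finJ in auto)
  moreover have "{s\<in>I. e \<in> edges_of s (leaves R s)} \<subseteq> {s. (p, s) \<in> R}"
  proof
    fix s assume "s \<in> {s\<in>I. e \<in> edges_of s (leaves R s)}"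
    then obtain q where "q \<in> J" "pe q = e" "(q, s) \<in> R" by (auto simp: edges_of_def leaves_def)
    then show "s \<in> {s. (p, s) \<in> R}" using p pe by (auto simp: bij_betw_def inj_on_def)
  qed
  ultimately have "card {s\<in>I. e \<in> edges_of s (leaves R s)} \<le> load R p"
    unfolding load_def by (rule card_mono)
  then show "card {s\<in>I. e \<in> edges_of s (leaves R s)} \<le> mu e" using le[OF p(1)] p(2) by simp
qed

lemma inc_antisym: "(i, j) \<in> inc \<Longrightarrow> (j, i) \<notin> inc"
  using IJ by (auto simp: inc_def)

text \<open>At the beginning every star owns all its edges, which is at least its capacity. Valid states
  keep it so, hence the stars have their exact sizes once no node is overloaded.\<close>

theorem feasible_iff_hall: "(\<exists>L. feasible L) \<longleftrightarrow> hall"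
proof
  assume hall: hall
  interpret capacitated_graph "I \<union> J" inc slack "card (I \<union> J)"
    by unfold_locales (use finI finJ inc_antisym in \<open>auto simp: inc_def\<close>)
  have "\<not> obstruction W" for W
  proof
    assume W: "obstruction W"
    then have "finite W" using finI finJ by (auto simp: obstruction_def intro: finite_subset)
    then have "\<not> hall"
      using W by (intro obstruction_not_hall[of W slack]) (auto simp: obstruction_def slack_def)
    then show False using hall by blast
  qed
  then obtain R h where R: "valid R h" "\<forall>i\<in>I \<union> J. \<not> excess R i"
    using orientation_exists by blast
  have "feasible (leaves R)"
  proof (rule orientation_feasible)
    show "orients inc R" using R by (simp add: valid_def)
    show "load R p \<le> mu (pe p)" if "p \<in> J" for p
    proof -
      have "p \<notin> I" using that IJ by auto
      then show ?thesis using R(2)[rule_format, of p] that by (simp add: excess_def slack_def)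
    qed
    show "int (load R s) = slack s" if s: "s \<in> I" for s
    proof -
      have "slack s \<le> load inc s" using load_inc[OF s] s by (simp add: slack_def)
      then have "slack s \<le> load R s" using R(1) s by (auto simp: valid_def)
      then show ?thesis using R(2)[rule_format, of s] s by (simp add: excess_def)
    qed
  qed
  then show "\<exists>L. feasible L" by blast
qed (use feasible_hall in blast)

end

section \<open>Packings as choices of leaves\<close>

text \<open>The members of a multiset can be put in correspondence with an index set if their
  characteristics occur equally often. This assigns the stars of a packing to the prescribed centres and
  sizes.\<close>

lemma matching_of_image_mset:
  assumes "finite I" "image_mset f P = image_mset g (mset_set I)"
  shows "\<exists>\<phi>. image_mset \<phi> (mset_set I) = P \<and> (\<forall>s\<in>I. f (\<phi> s) = g s)"
  using assms
proof (induction I arbitrary: P rule: finite_induct)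
  case empty
  then show ?case by auto
next
  case (insert s I)
  then have "image_mset f P = add_mset (g s) (image_mset g (mset_set I))" by simp
  then obtain x P' where P: "P = add_mset x P'" "f x = g s" "image_mset f P' = image_mset g (mset_set I)"
    using msed_map_invR by metis
  obtain \<phi> where \<phi>: "image_mset \<phi> (mset_set I) = P'" "\<forall>s\<in>I. f (\<phi> s) = g s" using insert.IH[OF P(3)] by auto
  define \<psi> where "\<psi> = \<phi>(s := x)"
  have "image_mset \<psi> (mset_set I) = P'"
    unfolding \<phi>(1)[symmetric] using insert.hyps by (intro image_mset_cong) (auto simp: \<psi>_def)
  moreover have "\<psi> s = x" "\<forall>t\<in>I. f (\<psi> t) = g t" using insert.hyps \<phi>(2) by (auto simp: \<psi>_def)
  ultimately show ?case using insert.hyps P by (intro exI[of _ \<psi>]) auto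
qed

lemma count_image_pair:
  "count (image_mset (\<lambda>x. (f x, g x)) P) (v, k) = count (image_mset g (filter_mset (\<lambda>x. f x = v) P)) k"
  by (induction P) auto

lemma doubleton_in_pairs: "{u, v} \<in> pairs V \<longleftrightarrow> u \<in> V \<and> v \<in> V \<and> u \<noteq> v"
  by (auto simp: pairs_def doubleton_eq_iff)

lemma star_star_of:
  assumes "distinct ls" "c \<notin> set ls" "ls \<noteq> []"
  shows "star (length ls) c (snd (star_of (c, ls)))"
proof -
  let ?H = "snd (star_of (c, ls))"
  have inj: "inj_on (\<lambda>l. {c, l}) (set ls)" using assms(2) by (auto simp: inj_on_def doubleton_eq_iff)
  then have "distinct (map (\<lambda>l. {c, l}) ls)" using assms(1) by (simp add: distinct_map)
  then have "count (edges ?H) e \<le> 1" for e by (simp add: distinct_count_atmost_1)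
  moreover have "multigraph ?H" using assms(2) by (auto simp: multigraph_def pairs_def)
  ultimately have "simple ?H" by (simp add: simple_def)
  moreover have "connected_graph ?H"
  proof -
    let ?R = "{(x, y). {x, y} \<in># edges ?H}"
    have to_centre: "(c, u) \<in> ?R\<^sup>* \<and> (u, c) \<in> ?R\<^sup>*" if "u \<in> verts ?H" for u
      using that by (auto simp: insert_commute intro!: r_into_rtrancl)
    have "(u, v) \<in> ?R\<^sup>*" if "u \<in> verts ?H" "v \<in> verts ?H" for u v
    proof (rule rtrancl_trans)
      show "(u, c) \<in> ?R\<^sup>*" "(c, v) \<in> ?R\<^sup>*" using to_centre that by blast+
    qed
    then show ?thesis by (auto simp: connected_graph_def)
  qed
  ultimately show ?thesis using assms(3) by (auto simp: star_def)
qed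

locale star_prescription = star_instance "verts G" "count (edges G)" I J c m pe
  for G :: "'a multigraph" and I J :: "'u set" and c :: "'u \<Rightarrow> 'a" and m :: "'u \<Rightarrow> nat"
    and pe :: "'u \<Rightarrow> 'a set" +
  fixes M :: "'a \<Rightarrow> nat multiset"
  assumes mg: "multigraph G" and m_pos: "s \<in> I \<Longrightarrow> m s > 0"
    and sizes: "v \<in> verts G \<Longrightarrow> image_mset m (mset_set {s \<in> I. c s = v}) = M v"
begin

lemma feasible_packing:
  assumes L: "feasible L" and ls: "\<And>s. s \<in> I \<Longrightarrow> distinct (ls s) \<and> set (ls s) = L s"
  shows "star_packing G M (image_mset (\<lambda>s. star_of (c s, ls s)) (mset_set I))"
proof -
  let ?H = "\<lambda>s. snd (star_of (c s, ls s))"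
  let ?E = "\<Sum>s\<in>I. edges (?H s)"
  have Ls: "L s \<subseteq> verts G - {c s}" "card (L s) = m s" if "s \<in> I" for s
    using L that by (auto simp: feasible_def)
  have len: "length (ls s) = m s" if "s \<in> I" for s
    using ls[OF that] Ls(2)[OF that] distinct_card by metis
  have cnt: "count (edges (?H s)) e = (if e \<in> edges_of s (L s) then 1 else 0)" if s: "s \<in> I" for s e
  proof -
    have "inj_on (\<lambda>l. {c s, l}) (L s)" by (rule inj_on_subset[OF inj_pair Ls(1)[OF s]])
    then have "distinct (map (\<lambda>l. {c s, l}) (ls s))" using ls[OF s] by (simp add: distinct_map)
    moreover have "set (map (\<lambda>l. {c s, l}) (ls s)) = edges_of s (L s)"
      using ls[OF s] by (simp add: edges_of_def)
    ultimately show ?thesis by (metis distinct_count_atmost_1 multigraph.select_convs(2) snd_conv star_of.simps)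
  qed
  have sub: "edges_of s (L s) \<subseteq> pairs (verts G)" if "s \<in> I" for s
    using Ls(1)[OF that] pairs_at[of "c s"] that c unfolding edges_of_def by blast
  have "count ?E e \<le> count (edges G) e" for e
  proof -
    have "count ?E e = (\<Sum>s\<in>I. if e \<in> edges_of s (L s) then 1 else 0)"
      by (simp add: count_sum cnt cong: sum.cong del: star_of.simps)
    also have "\<dots> = card {s\<in>I. e \<in> edges_of s (L s)}"
      using finI by (simp add: sum.If_cases Int_def)
    also have "\<dots> \<le> count (edges G) e"
    proof (cases "e \<in> pairs (verts G)")
      case True
      then show ?thesis using L by (simp add: feasible_def)
    next
      case False
      then have "{s\<in>I. e \<in> edges_of s (L s)} = {}" using sub by blast
      then show ?thesis by (metis card.empty le0)
    qed
    finally show ?thesis .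
  qed
  then have EG: "?E \<subseteq># edges G" by (rule mset_subset_eqI)
  let ?G' = "\<lparr>verts = verts G, edges = ?E\<rparr>"
  let ?P = "image_mset (\<lambda>s. star_of (c s, ls s)) (mset_set I)"
  have star: "star (m s) (c s) (?H s)" if "s \<in> I" for s
  proof -
    have "c s \<notin> set (ls s)" "ls s \<noteq> []"
      using ls[OF that] Ls(1)[OF that] len[OF that] m_pos[OF that] by auto
    then show ?thesis using star_star_of[of "ls s" "c s"] ls[OF that] len[OF that] by metis
  qed
  have "submultigraph ?G' G"
    using EG mg by (auto simp: submultigraph_def multigraph_def dest: mset_subset_eqD)
  moreover have "decomposition ?G' (image_mset snd ?P)"
    unfolding decomposition_def
  proof (intro conjI ballI impI)
    fix H assume "H \<in># image_mset snd ?P"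
    then obtain s where s: "s \<in> I" "H = ?H s" using finI by auto
    have "edges (?H s) \<subseteq># ?E"
      using s(1) finI by (auto intro!: mset_subset_eqI member_le_sum simp: count_sum simp del: star_of.simps)
    moreover have "verts (?H s) \<subseteq> verts G" using ls[OF s(1)] Ls(1)[OF s(1)] c s(1) by auto
    moreover have "multigraph (?H s)" using star[OF s(1)] by (simp add: star_def simple_def del: star_of.simps)
    ultimately show "submultigraph H ?G'" by (simp add: submultigraph_def s(2) del: star_of.simps)
  next
    fix u v
    have "(\<Sum>H\<in>#image_mset snd ?P. mult H u v) = (\<Sum>s\<in>I. mult (?H s) u v)"
      by (simp add: sum_unfold_sum_mset image_mset.compositionality comp_def del: star_of.simps)
    then show "(\<Sum>H\<in>#image_mset snd ?P. mult H u v) = mult ?G' u v"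
      by (simp add: mult_def count_sum del: star_of.simps)
  qed
  ultimately have "packing G (image_mset snd ?P)" unfolding packing_def by blast
  moreover have "\<forall>(c, H) \<in># ?P. star (size (edges H)) c H"
  proof
    fix x assume "x \<in># ?P"
    then obtain s where s: "s \<in> I" "x = (c s, ?H s)" using finI by auto
    show "case x of (c, H) \<Rightarrow> star (size (edges H)) c H"
      using star[OF s(1)] by (simp add: s(2) star_def del: star_of.simps)
  qed
  moreover have "\<forall>v \<in> verts G. {#size (edges H). (c, H) \<in># filter_mset (\<lambda>(c, H). c = v) ?P#} = M v"
  proof
    fix v assume v: "v \<in> verts G"
    have "{#size (edges H). (c, H) \<in># filter_mset (\<lambda>(c, H). c = v) ?P#}
      = image_mset (\<lambda>s. length (ls s)) (filter_mset (\<lambda>s. c s = v) (mset_set I))"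
      by (simp add: filter_mset_image_mset image_mset.compositionality comp_def)
    also have "\<dots> = image_mset m (filter_mset (\<lambda>s. c s = v) (mset_set I))"
      using len finI by (intro image_mset_cong) auto
    also have "\<dots> = M v" using sizes[OF v] finI by (simp add: filter_mset_mset_set)
    finally show "{#size (edges H). (c, H) \<in># filter_mset (\<lambda>(c, H). c = v) ?P#} = M v" .
  qed
  ultimately show ?thesis unfolding star_packing_def by blast
qed

lemma star_centre_in:
  assumes "star (size (edges H)) v H" "submultigraph H G'" "verts G' \<subseteq> verts G"
  shows "v \<in> verts G"
proof -
  from assms(1) have "edges H \<noteq> {#}" by (auto simp: star_def)
  then obtain e where e: "e \<in># edges H" by (meson multiset_nonemptyE)
  then have "v \<in> e" using assms(1) by (auto simp: star_def)
  moreover have "e \<in> pairs (verts H)" using e assms(2) by (auto simp: submultigraph_def multigraph_def)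
  ultimately show ?thesis using assms(2,3) by (auto simp: submultigraph_def pairs_def)
qed

lemma packing_feasible:
  assumes P: "star_packing G M P"
  shows "\<exists>L. feasible L"
proof -
  obtain G' where G': "submultigraph G' G" "decomposition G' (image_mset snd P)"
    using P by (auto simp: star_packing_def packing_def)
  have star: "star (size (edges H)) v H" if "(v, H) \<in># P" for v H
    using P that by (auto simp: star_packing_def)
  have sub: "submultigraph H G'" if "(v, H) \<in># P" for v H
    using G'(2) that by (force simp: decomposition_def)
  have vG: "verts G' \<subseteq> verts G" using G'(1) by (simp add: submultigraph_def)
  have cV: "v \<in> verts G" if "(v, H) \<in># P" for v H
    using star_centre_in[OF star[OF that] sub[OF that] vG] .
  have "image_mset (\<lambda>x. (fst x, size (edges (snd x)))) P = image_mset (\<lambda>s. (c s, m s)) (mset_set I)"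
  proof (rule multiset_eqI)
    fix x :: "'a \<times> nat"
    obtain v k where x: "x = (v, k)" by (cases x)
    show "count (image_mset (\<lambda>x. (fst x, size (edges (snd x)))) P) x = count (image_mset (\<lambda>s. (c s, m s)) (mset_set I)) x"
    proof (cases "v \<in> verts G")
      case True
      have "{#size (edges H). (c, H) \<in># filter_mset (\<lambda>(c, H). c = v) P#} = image_mset m (mset_set {s \<in> I. c s = v})"
        using P True sizes[OF True] by (simp add: star_packing_def)
      then show ?thesis unfolding x count_image_pair
        by (simp add: case_prod_unfold filter_mset_mset_set finI)
    next
      case False
      have "x \<notin># image_mset (\<lambda>x. (fst x, size (edges (snd x)))) P" using cV False x by auto
      moreover have "x \<notin># image_mset (\<lambda>s. (c s, m s)) (mset_set I)" using c False x finI by auto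
      ultimately show ?thesis by (metis not_in_iff)
    qed
  qed
  from matching_of_image_mset[OF finI this] obtain \<phi> where \<phi>: "image_mset \<phi> (mset_set I) = P"
    "\<forall>s\<in>I. fst (\<phi> s) = c s \<and> size (edges (snd (\<phi> s))) = m s" by auto
  let ?H = "\<lambda>s. snd (\<phi> s)"
  have in_P: "(c s, ?H s) \<in># P" if "s \<in> I" for s
  proof -
    have "\<phi> s \<in># P" unfolding \<phi>(1)[symmetric] using that finI by simp
    moreover have "\<phi> s = (c s, ?H s)" using \<phi>(2) that by (metis prod.collapse)
    ultimately show ?thesis by metis
  qed
  let ?L = "\<lambda>s. {l. {c s, l} \<in># edges (?H s)}"
  have edge: "\<exists>l \<in> verts G - {c s}. e = {c s, l}" if "s \<in> I" "e \<in># edges (?H s)" for s e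
  proof -
    have "e \<in> pairs (verts (?H s))" "verts (?H s) \<subseteq> verts G"
      using sub[OF in_P[OF that(1)]] vG that(2) by (auto simp: submultigraph_def multigraph_def)
    moreover have "c s \<in> e" using star[OF in_P[OF that(1)]] that(2) by (auto simp: star_def)
    ultimately have "e \<in> {e \<in> pairs (verts G). c s \<in> e}" by (auto simp: pairs_def)
    then show ?thesis using pairs_at[of "c s"] c that(1) by auto
  qed
  have LV: "?L s \<subseteq> verts G - {c s}" if s: "s \<in> I" for s
  proof
    fix l assume "l \<in> ?L s"
    then obtain l' where "l' \<in> verts G - {c s}" "{c s, l} = {c s, l'}" using edge[OF s, of "{c s, l}"] by blast
    then show "l \<in> verts G - {c s}" by (auto simp: doubleton_eq_iff)
  qed
  have E: "set_mset (edges (?H s)) = edges_of s (?L s)" if "s \<in> I" for s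
    using edge[OF that] by (fastforce simp: edges_of_def)
  have "feasible ?L"
    unfolding feasible_def
  proof (intro conjI ballI)
    fix s assume s: "s \<in> I"
    show "?L s \<subseteq> verts G - {c s}" by (rule LV[OF s])
    have "size (edges (?H s)) = card (set_mset (edges (?H s)))"
    proof -
      have "count (edges (?H s)) e = (if e \<in># edges (?H s) then 1 else 0)" for e
      proof -
        have "count (edges (?H s)) e \<le> 1" using star[OF in_P[OF s]] by (simp add: star_def simple_def)
        then show ?thesis by (cases "count (edges (?H s)) e") (auto simp: not_in_iff)
      qed
      then show ?thesis by (simp add: size_multiset_overloaded_eq)
    qed
    also have "\<dots> = card (edges_of s (?L s))" by (rule arg_cong[OF E[OF s]])
    also have "\<dots> = card (?L s)" unfolding edges_of_def
      by (intro card_image inj_on_subset[OF inj_pair LV[OF s]])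
    finally show "card (?L s) = m s" using \<phi>(2) s by simp
  next
    fix e assume e: "e \<in> pairs (verts G)"
    then obtain u v where uv: "e = {u, v}" "u \<noteq> v" by (auto simp: pairs_def)
    have "card {s\<in>I. e \<in> edges_of s (?L s)} = card {s\<in>I. e \<in># edges (?H s)}"
      by (intro arg_cong[where f = card] Collect_cong conj_cong refl) (simp add: E[symmetric])
    also have "\<dots> = (\<Sum>s\<in>I. if e \<in># edges (?H s) then 1 else 0)"
      using finI by (simp add: sum.If_cases Int_def)
    also have "\<dots> \<le> (\<Sum>s\<in>I. count (edges (?H s)) e)"
      by (rule sum_mono) auto
    also have "\<dots> = (\<Sum>H\<in>#image_mset snd P. mult H u v)"
      unfolding \<phi>(1)[symmetric] by (simp add: sum_unfold_sum_mset image_mset.compositionality comp_def mult_def uv)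
    also have "\<dots> \<le> count (edges G) e"
    proof (cases "u \<in> verts G' \<and> v \<in> verts G'")
      case True
      then have "(\<Sum>H\<in>#image_mset snd P. mult H u v) = count (edges G') e"
        using G'(2) uv by (simp add: decomposition_def mult_def)
      then show ?thesis using G'(1) by (simp add: submultigraph_def mset_subset_eq_count)
    next
      case False
      have "mult H u v = 0" if "H \<in># image_mset snd P" for H
      proof (rule ccontr)
        assume "mult H u v \<noteq> 0"
        then have "{u, v} \<in># edges H" by (simp add: mult_def count_eq_zero_iff)
        moreover have "submultigraph H G'" using that sub by auto
        ultimately have "{u, v} \<in> pairs (verts H)" "verts H \<subseteq> verts G'"
          by (auto simp: submultigraph_def multigraph_def)
        then show False using False by (auto simp: doubleton_in_pairs)
      qed
      then have "(\<Sum>H\<in>#image_mset snd P. mult H u v) = (\<Sum>H\<in>#image_mset snd P. 0)"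
        by (intro arg_cong[where f = sum_mset] image_mset_cong)
      also have "\<dots> = 0" by simp
      finally show ?thesis by linarith
    qed
    finally show "card {s\<in>I. e \<in> edges_of s (?L s)} \<le> count (edges G) e" .
  qed
  then show ?thesis by blast
qed

text \<open>Leaves chosen for the stars become a packing (\<open>feasible_packing\<close>), and the stars of
  a packing provide leaves (\<open>packing_feasible\<close>).\<close>

theorem packing_iff_hall: "(\<exists>P. star_packing G M P) \<longleftrightarrow> hall"
proof
  assume hall
  then obtain L where L: "feasible L" using feasible_iff_hall by blast
  have "\<exists>xs. distinct xs \<and> set xs = L s" if "s \<in> I" for s
  proof -
    have "finite (L s)" using L that finV by (auto simp: feasible_def intro: finite_subset)
    then show ?thesis using finite_distinct_list by blast
  qed
  then obtain ls where "\<And>s. s \<in> I \<Longrightarrow> distinct (ls s) \<and> set (ls s) = L s" by metis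
  then show "\<exists>P. star_packing G M P" using feasible_packing[OF L] by blast
qed (use packing_feasible feasible_iff_hall in blast)

end


text \<open>The largest index in \<open>T\<close> is at least \<open>card T - 1\<close>, where the
  descending list has no smaller entry; the other indices are treated by induction.\<close>

lemma sum_nth_le_initial:
  fixes xs :: "nat list"
  assumes "sorted (rev xs)" "T \<subseteq> {..<length xs}"
  shows "(\<Sum>i\<in>T. xs ! i) \<le> (\<Sum>i<card T. xs ! i)"
proof -
  have mono: "xs ! j \<le> xs ! i" if "i \<le> j" "j < length xs" for i j
    using assms(1) that sorted_rev_nth_mono by blast
  have "finite T" using assms(2) finite_subset by blast
  then show ?thesis using assms(2)
  proof (induction T rule: finite_linorder_max_induct)
    case (insert x T)
    then have "T \<subseteq> {..<x}" "x \<notin> T" by auto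
    then have "card T \<le> x" using card_mono[of "{..<x}" T] by simp
    then have "xs ! x \<le> xs ! card T" using mono insert.prems by simp
    then show ?case using insert \<open>x \<notin> T\<close> by simp
  qed simp
qed

lemma sum_largest_nth:
  assumes "i \<le> size A"
  shows "sum_largest i A = (\<Sum>k<i. rev (sorted_list_of_multiset A) ! k)"
proof -
  let ?xs = "rev (sorted_list_of_multiset A)"
  have len: "length ?xs = size A" by (metis length_rev mset_sorted_list_of_multiset size_mset)
  have "sum_largest i A = (\<Sum>k<length (take i ?xs). take i ?xs ! k)"
    unfolding sum_largest_def by (metis sum_list_sum_nth atLeast0LessThan)
  also have "length (take i ?xs) = i" using assms len by simp
  also have "(\<Sum>k<i. take i ?xs ! k) = (\<Sum>k<i. ?xs ! k)" by simp
  finally show ?thesis .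
qed

text \<open>A set of stars enters the condition \<open>hall\<close> through its sizes and through the number
  \<open>f v\<close> of its stars centred at each \<open>v\<close>. For given numbers, the sizes add up to
  the most for the largest stars.\<close>

theorem star_packing_iff:
  fixes G :: "'a multigraph"
  assumes mg: "multigraph G" and pos: "\<forall>v \<in> verts G. \<forall>m \<in># M v. m > 0"
  shows "(\<exists>P. star_packing G M P) \<longleftrightarrow>
       (\<forall>f :: 'a \<Rightarrow> nat. (\<forall>v \<in> verts G. f v \<in> {0..size (M v)}) \<longrightarrow>
          (\<Sum>v \<in> verts G. sum_largest (f v) (M v))
            \<le> (\<Sum>e \<in> pairs (verts G). min (\<Sum>v \<in> e. f v) (count (edges G) e)))"
proof -
  let ?V = "verts G"
  define srt where "srt v = rev (sorted_list_of_multiset (M v))" for v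
  define I :: "('a \<times> nat + 'a set) set" where "I = Inl ` (SIGMA v:?V. {..<size (M v)})"
  define c :: "'a \<times> nat + 'a set \<Rightarrow> 'a" where "c = (\<lambda>s. fst (projl s))"
  define m :: "'a \<times> nat + 'a set \<Rightarrow> nat" where "m = (\<lambda>s. srt (fst (projl s)) ! snd (projl s))"
  have fV: "finite ?V" using mg by (simp add: multigraph_def)
  have len: "length (srt v) = size (M v)" for v
    unfolding srt_def by (metis length_rev mset_sorted_list_of_multiset size_mset)
  have mset: "mset (srt v) = M v" for v by (simp add: srt_def)
  have fib: "{s \<in> I. c s = v} = (\<lambda>i. Inl (v, i)) ` {..<size (M v)}" if "v \<in> ?V" for v
    using that by (auto simp: I_def c_def image_iff)
  interpret star_prescription G I "Inr ` pairs ?V" c m projr M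
  proof
    show "bij_betw projr (Inr ` pairs ?V) (pairs ?V)"
      by (auto simp: bij_betw_def inj_on_def image_image)
    show "m s > 0" if "s \<in> I" for s
      using that pos mset len by (auto simp: I_def m_def) (metis nth_mem set_mset_mset)
    show "image_mset m (mset_set {s \<in> I. c s = v}) = M v" if "v \<in> ?V" for v
    proof -
      have "image_mset m (mset_set {s \<in> I. c s = v}) = image_mset (\<lambda>i. srt v ! i) (mset_set {..<size (M v)})"
        unfolding fib[OF that] by (subst image_mset_mset_set[symmetric])
          (auto simp: inj_on_def image_mset.compositionality comp_def m_def)
      also have "\<dots> = mset (map ((!) (srt v)) [0..<length (srt v)])"
        by (simp add: len lessThan_atLeast0)
      finally show ?thesis by (simp add: map_nth mset del: upt_Suc)
    qed
  qed (use fV mg in \<open>auto simp: I_def c_def\<close>)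
  have card_fib: "card {s \<in> S. c s \<in> e} = (\<Sum>v\<in>e. card {s \<in> S. c s = v})" if "e \<in> pairs ?V" "S \<subseteq> I" for S e
  proof -
    have f: "finite e" "finite S" using that finI by (auto simp: pairs_def intro: finite_subset)
    have "{s \<in> S. c s \<in> e} = (\<Union>v\<in>e. {s \<in> S. c s = v})" by auto
    also have "card \<dots> = (\<Sum>v\<in>e. card {s \<in> S. c s = v})" using f by (intro card_UN_disjoint) auto
    finally show ?thesis .
  qed
  have "hall \<longleftrightarrow> (\<forall>f :: 'a \<Rightarrow> nat. (\<forall>v \<in> ?V. f v \<in> {0..size (M v)}) \<longrightarrow>
          (\<Sum>v \<in> ?V. sum_largest (f v) (M v))
            \<le> (\<Sum>e \<in> pairs ?V. min (\<Sum>v \<in> e. f v) (count (edges G) e)))" (is "_ \<longleftrightarrow> ?R")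
  proof
    assume hall
    show ?R
    proof (intro allI impI)
      fix f :: "'a \<Rightarrow> nat" assume f: "\<forall>v \<in> ?V. f v \<in> {0..size (M v)}"
      \<comment> \<open>Indices refer to the sizes in descending order, so these are the \<open>f v\<close> largest stars at each \<open>v\<close>.\<close>
      let ?S = "Inl ` (SIGMA v:?V. {..<f v}) :: ('a \<times> nat + 'a set) set"
      have S: "?S \<subseteq> I" using f by (force simp: I_def)
      have "(\<Sum>v \<in> ?V. sum_largest (f v) (M v)) = (\<Sum>v\<in>?V. \<Sum>i<f v. srt v ! i)"
        using f by (intro sum.cong) (auto simp: sum_largest_nth srt_def)
      also have "\<dots> = (\<Sum>s\<in>?S. m s)"
        using fV by (subst sum.Sigma) (auto simp: sum.reindex m_def case_prod_unfold)
      also have "\<dots> \<le> (\<Sum>e\<in>pairs ?V. min (count (edges G) e) (card {s\<in>?S. c s \<in> e}))"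
        using \<open>hall\<close> S unfolding hall_def by blast
      also have "\<dots> = (\<Sum>e \<in> pairs ?V. min (\<Sum>v \<in> e. f v) (count (edges G) e))"
      proof (rule sum.cong)
        fix e assume e: "e \<in> pairs ?V"
        have "card {s \<in> ?S. c s = v} = f v" if "v \<in> e" for v
        proof -
          have "v \<in> ?V" using e that by (auto simp: pairs_def)
          then have "{s \<in> ?S. c s = v} = (\<lambda>i. Inl (v, i)) ` {..<f v}" by (auto simp: c_def image_iff)
          then show ?thesis by (simp add: card_image inj_on_def)
        qed
        then have "card {s\<in>?S. c s \<in> e} = (\<Sum>v\<in>e. f v)" using card_fib[OF e S] by simp
        then show "min (count (edges G) e) (card {s\<in>?S. c s \<in> e}) = min (\<Sum>v \<in> e. f v) (count (edges G) e)"
          by (simp add: min.commute)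
      qed simp
      finally show "(\<Sum>v \<in> ?V. sum_largest (f v) (M v))
            \<le> (\<Sum>e \<in> pairs ?V. min (\<Sum>v \<in> e. f v) (count (edges G) e))" .
    qed
  next
    assume R: ?R
    show hall
      unfolding hall_def
    proof (intro allI impI)
      fix S assume S: "S \<subseteq> I"
      have fS: "finite S" using S finI finite_subset by blast
      let ?f = "\<lambda>v. card {s \<in> S. c s = v}"
      let ?T = "\<lambda>v. {i. Inl (v, i) \<in> S}"
      have T: "{s \<in> S. c s = v} = (\<lambda>i. Inl (v, i)) ` ?T v" "?T v \<subseteq> {..<size (M v)}" for v
        using S by (auto simp: I_def c_def image_iff)
      have f: "?f v = card (?T v)" for v unfolding T(1) by (simp add: card_image inj_on_def)
      have fle: "?f v \<le> size (M v)" for v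
        using card_mono[OF _ T(2), of v] by (simp add: f)
      have "(\<Sum>s\<in>S. m s) = (\<Sum>v\<in>?V. \<Sum>s\<in>{s \<in> S. c s = v}. m s)"
        using fS fV S c by (intro sum.group[symmetric]) auto
      also have "\<dots> \<le> (\<Sum>v\<in>?V. sum_largest (?f v) (M v))"
      proof (rule sum_mono)
        fix v
        have "(\<Sum>s\<in>{s \<in> S. c s = v}. m s) = (\<Sum>i\<in>?T v. srt v ! i)"
          unfolding T(1) by (simp add: sum.reindex inj_on_def m_def)
        also have "\<dots> \<le> (\<Sum>i<card (?T v). srt v ! i)"
          using T(2) by (intro sum_nth_le_initial) (auto simp: len, simp add: srt_def)
        also have "\<dots> = sum_largest (?f v) (M v)"
          using fle by (simp add: f sum_largest_nth srt_def)
        finally show "(\<Sum>s\<in>{s \<in> S. c s = v}. m s) \<le> sum_largest (?f v) (M v)" .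
      qed
      also have "\<dots> \<le> (\<Sum>e \<in> pairs ?V. min (\<Sum>v \<in> e. ?f v) (count (edges G) e))"
        using R[rule_format, of ?f] fle by simp
      also have "\<dots> = (\<Sum>e\<in>pairs ?V. min (count (edges G) e) (card {s\<in>S. c s \<in> e}))"
        using card_fib[OF _ S] by (intro sum.cong) (auto simp: min.commute)
      finally show "(\<Sum>s\<in>S. m s) \<le> (\<Sum>e\<in>pairs ?V. min (count (edges G) e) (card {s\<in>S. c s \<in> e}))" .
    qed
  qed
  then show ?thesis using packing_iff_hall by simp
qed

section \<open>Reasoning about loop programs\<close>

text \<open>A program leaves alone what it does not mention. As this can be read off its text, invariants
  need not list what stays the same.\<close>

fun written :: "com \<Rightarrow> nat set" where
  "written (Write a xs s) = {a}"
| "written (Seq c d) = written c \<union> written d"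
| "written (IfA a xs s c d) = written c \<union> written d"
| "written (IfEq x y c d) = written c \<union> written d"
| "written (For x c) = written c"
| "written _ = {}"

fun emits :: "com \<Rightarrow> bool" where
  "emits (Emit s) = True"
| "emits (Seq c d) \<longleftrightarrow> emits c \<or> emits d"
| "emits (IfA a xs s c d) \<longleftrightarrow> emits c \<or> emits d"
| "emits (IfEq x y c d) \<longleftrightarrow> emits c \<or> emits d"
| "emits (For x c) \<longleftrightarrow> emits c"
| "emits _ = False"

definition agrees :: "com \<Rightarrow> st \<Rightarrow> st \<Rightarrow> bool" where
  "agrees c \<sigma> \<tau> \<longleftrightarrow> (\<forall>x. x \<notin> assigned c \<longrightarrow> vr \<tau> x = vr \<sigma> x) \<and> (\<forall>a. a \<notin> written c \<longrightarrow> ar \<tau> a = ar \<sigma> a) \<and>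
     (\<not> emits c \<longrightarrow> ot \<tau> = ot \<sigma>)"

lemma agreesD:
  assumes "agrees c \<sigma> \<tau>"
  shows "x \<notin> assigned c \<Longrightarrow> vr \<tau> x = vr \<sigma> x" "a \<notin> written c \<Longrightarrow> ar \<tau> a = ar \<sigma> a" "\<not> emits c \<Longrightarrow> ot \<tau> = ot \<sigma>"
  using assms by (auto simp: agrees_def)

lemma iter_inv:
  assumes "I 0 \<sigma>" "\<And>i \<tau>. i < n \<Longrightarrow> I i \<tau> \<Longrightarrow> I (Suc i) (f i \<tau>)"
  shows "I n (iter n f \<sigma>)"
  using assms by (induction n) auto

lemma run_agrees: "agrees c \<sigma> (run N c \<sigma>)"
proof (induction c arbitrary: \<sigma>)
  case (Seq c d)
  then show ?case unfolding agrees_def by simp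
next
  case (For x c)
  have "agrees (For x c) \<sigma> (iter N (\<lambda>i \<tau>. run N c (setv x i \<tau>)) \<sigma>)"
  proof (rule iter_inv[where I = "\<lambda>_ \<tau>. agrees (For x c) \<sigma> \<tau>"])
    fix i \<tau> assume "agrees (For x c) \<sigma> \<tau>"
    then show "agrees (For x c) \<sigma> (run N c (setv x i \<tau>))"
      using For.IH[of "setv x i \<tau>"] by (auto simp: agrees_def)
  qed (simp add: agrees_def)
  then show ?case by (simp add: agrees_def)
qed (auto simp: agrees_def)

lemma run_frame [simp]:
  "x \<notin> assigned c \<Longrightarrow> vr (run N c \<sigma>) x = vr \<sigma> x"
  "a \<notin> written c \<Longrightarrow> ar (run N c \<sigma>) a = ar \<sigma> a"
  "\<not> emits c \<Longrightarrow> ot (run N c \<sigma>) = ot \<sigma>"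
  using run_agrees[of c \<sigma> N] by (auto simp: agrees_def)

text \<open>An invariant has to speak only about what the loop changes; the rest is known to agree with the
  state before the loop.\<close>

lemma For_rule:
  assumes "I 0 \<sigma>"
    and "\<And>i \<tau>. i < N \<Longrightarrow> I i \<tau> \<Longrightarrow> agrees (For x c) \<sigma> \<tau> \<Longrightarrow> I (Suc i) (run N c (setv x i \<tau>))"
    and "\<And>\<tau>. I N \<tau> \<Longrightarrow> agrees (For x c) \<sigma> \<tau> \<Longrightarrow> Q (setv x 0 \<tau>)"
  shows "Q (run N (For x c) \<sigma>)"
proof -
  have "I N (iter N (\<lambda>i \<tau>. run N c (setv x i \<tau>)) \<sigma>) \<and> agrees (For x c) \<sigma> (iter N (\<lambda>i \<tau>. run N c (setv x i \<tau>)) \<sigma>)"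
  proof (rule iter_inv[where I = "\<lambda>i \<tau>. I i \<tau> \<and> agrees (For x c) \<sigma> \<tau>"])
    fix i \<tau> assume i: "i < N" "I i \<tau> \<and> agrees (For x c) \<sigma> \<tau>"
    then have "agrees (For x c) \<sigma> (run N c (setv x i \<tau>))"
      using run_agrees[of c "setv x i \<tau>" N] by (auto simp: agrees_def)
    then show "I (Suc i) (run N c (setv x i \<tau>)) \<and> agrees (For x c) \<sigma> (run N c (setv x i \<tau>))"
      using assms(2) i by blast
  qed (use assms(1) in \<open>simp add: agrees_def\<close>)
  then show ?thesis using assms(3) by simp
qed

text \<open>The arrays and variables of the program. The numbers in the input are counted consecutively,
  first the multiplicities and then the sizes, and a node is given by its position in this list.
  \<open>aCTR[i, v]\<close>: the star \<open>i\<close> has centre \<open>v\<close>; \<open>aEND[i,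
  v]\<close>: the pair \<open>i\<close> contains \<open>v\<close>; \<open>aVERT[v]\<close>: \<open>v\<close>
  is a vertex; \<open>aBAD[i, k]\<close>: a load of \<open>k\<close> exceeds the capacity of
  \<open>i\<close>; \<open>aOWN[i, j]\<close>: \<open>i\<close> owns the edge between \<open>i\<close> and
  \<open>j\<close>; \<open>aHT[i, t]\<close>: \<open>t\<close> is below the height of \<open>i\<close>;
  \<open>aBIN\<close>: a number in binary notation. The remaining arrays are flags. The variable
  \<open>vQ\<close> runs through the input, \<open>vE\<close> counts entries, \<open>vI\<close> and
  \<open>vJ\<close> are nodes, \<open>vU\<close> and \<open>vV\<close> are vertices, and \<open>vT\<close>
  and \<open>vK\<close> serve local purposes.\<close>

abbreviation (input) "aIN \<equiv> 0 :: nat"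
abbreviation (input) "aSND \<equiv> 2 :: nat"
abbreviation (input) "aPASS \<equiv> 3 :: nat"
abbreviation (input) "aVERT \<equiv> 4 :: nat"
abbreviation (input) "aCTR \<equiv> 5 :: nat"
abbreviation (input) "aBAD \<equiv> 6 :: nat"
abbreviation (input) "aEND \<equiv> 7 :: nat"
abbreviation (input) "aOWN \<equiv> 8 :: nat"
abbreviation (input) "aHT \<equiv> 9 :: nat"
abbreviation (input) "aDONE \<equiv> 10 :: nat"
abbreviation (input) "aFAIL \<equiv> 11 :: nat"
abbreviation (input) "aBIN \<equiv> 12 :: nat"
abbreviation (input) "aCARRY \<equiv> 13 :: nat"

definition arity :: "nat \<Rightarrow> nat" where
  "arity a = (if a \<in> {aIN, aVERT, aBIN} then 1 else if a \<in> {aCTR, aBAD, aEND, aOWN, aHT} then 2 else 0)"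

abbreviation (input) "vQ \<equiv> 3 :: nat"
abbreviation (input) "vE \<equiv> 4 :: nat"
abbreviation (input) "vV \<equiv> 5 :: nat"
abbreviation (input) "vACC \<equiv> 6 :: nat"
abbreviation (input) "vW \<equiv> 7 :: nat"
abbreviation (input) "vT \<equiv> 8 :: nat"
abbreviation (input) "vK \<equiv> 9 :: nat"
abbreviation (input) "vU \<equiv> 10 :: nat"
abbreviation (input) "vI \<equiv> 11 :: nat"
abbreviation (input) "vJ \<equiv> 12 :: nat"

definition clear :: "nat \<Rightarrow> com" where "clear x = For x Skip"

lemma clear_simps [simp]: "assigned (clear x) = {x}" "written (clear x) = {}" "\<not> emits (clear x)"
  by (simp_all add: clear_def)

lemma setv_setv [simp]: "setv x n (setv x m \<sigma>) = setv x n \<sigma>"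
  by (simp add: setv_def)

lemma run_clear [simp]: "run N (clear x) \<sigma> = setv x 0 \<sigma>"
proof -
  have "run N (clear x) \<sigma> = setv x 0 \<sigma>" unfolding clear_def
  proof (rule For_rule[where I = "\<lambda>_ \<tau>. setv x 0 \<tau> = setv x 0 \<sigma>"])
    fix i \<tau> assume "setv x 0 \<tau> = setv x 0 \<sigma>"
    then show "setv x 0 (run N Skip (setv x i \<tau>)) = setv x 0 \<sigma>" by simp
  qed simp_all
  then show ?thesis .
qed

text \<open>Executes \<open>c\<close> for \<open>k = 0, \<dots>, y - 1\<close>. The flag is set when
  \<open>k\<close> reaches \<open>y\<close>.\<close>

definition for_below :: "nat \<Rightarrow> nat \<Rightarrow> com \<Rightarrow> com" where
  "for_below k y c = Seq (Write aPASS [] 0) (For k (Seq (IfEq k y (Write aPASS [] 1) Skip)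
     (IfA aPASS [] 0 c Skip)))"

lemma for_below_simps [simp]: "assigned (for_below k y c) = insert k (assigned c)" "written (for_below k y c) = insert aPASS (written c)"
  "emits (for_below k y c) = emits c"
  by (simp_all add: for_below_def)

lemma run_for_below:
  assumes y: "vr \<sigma> y < N" "y \<noteq> k" "y \<notin> assigned c" and c: "aPASS \<notin> written c"
  shows "run N (for_below k y c) \<sigma> =
     setv k 0 (seta aPASS [] 1 (iter (vr \<sigma> y) (\<lambda>i \<tau>. run N c (setv k i \<tau>)) (seta aPASS [] 0 \<sigma>)))"
proof -
  let ?\<sigma> = "seta aPASS [] 0 \<sigma>"
  let ?f = "\<lambda>i. iter i (\<lambda>i \<tau>. run N c (setv k i \<tau>)) ?\<sigma>"
  have "agrees (For k c) ?\<sigma> (?f i)" for i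
  proof (rule iter_inv[where I = "\<lambda>_ \<tau>. agrees (For k c) ?\<sigma> \<tau>"])
    fix i \<tau> assume "agrees (For k c) ?\<sigma> \<tau>"
    then show "agrees (For k c) ?\<sigma> (run N c (setv k i \<tau>))"
      using run_agrees[of c "setv k i \<tau>" N] by (auto simp: agrees_def)
  qed (simp add: agrees_def)
  then have f: "vr (?f i) y = vr \<sigma> y" "ar (?f i) aPASS [] = 0" for i
    using y c by (auto simp: agrees_def)
  define d where "d = (Seq (IfEq k y (Write aPASS [] 1) Skip) (IfA aPASS [] 0 c Skip))"
  have "run N (For k d) ?\<sigma> = setv k 0 (seta aPASS [] 1 (?f (vr \<sigma> y)))"
  proof (rule For_rule[where I = "\<lambda>i \<tau>. if i \<le> vr \<sigma> y then \<tau> = ?f i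
      else setv k 0 \<tau> = setv k 0 (seta aPASS [] 1 (?f (vr \<sigma> y)))"])
    fix i \<tau> assume i: "i < N" "if i \<le> vr \<sigma> y then \<tau> = ?f i
      else setv k 0 \<tau> = setv k 0 (seta aPASS [] 1 (?f (vr \<sigma> y)))"
    consider "i < vr \<sigma> y" | "i = vr \<sigma> y" | "i > vr \<sigma> y" by linarith
    then show "if Suc i \<le> vr \<sigma> y then run N d (setv k i \<tau>) = ?f (Suc i)
      else setv k 0 (run N d (setv k i \<tau>)) = setv k 0 (seta aPASS [] 1 (?f (vr \<sigma> y)))"
    proof cases
      case 1
      then show ?thesis using i f[of i] y by (simp add: d_def)
    next
      case 2
      then show ?thesis using i f[of i] y by (simp add: d_def setv_def seta_def)
    next
      case 3
      then have e: "setv k 0 \<tau> = setv k 0 (seta aPASS [] 1 (?f (vr \<sigma> y)))" using i by simp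
      have "vr \<tau> y = vr \<sigma> y"
        using arg_cong[OF e, of "\<lambda>s. vr s y"] f[of "vr \<sigma> y"] y(2) by simp
      moreover have "ar \<tau> aPASS [] = 1" using arg_cong[OF e, of "\<lambda>s. ar s aPASS []"] by simp
      ultimately show ?thesis using 3 y e by (simp add: d_def)
    qed
  next
    fix \<tau> assume "if N \<le> vr \<sigma> y then \<tau> = ?f N
      else setv k 0 \<tau> = setv k 0 (seta aPASS [] 1 (?f (vr \<sigma> y)))"
    then show "setv k 0 \<tau> = setv k 0 (seta aPASS [] 1 (?f (vr \<sigma> y)))" using y(1) by simp
  qed simp
  then show ?thesis by (simp add: for_below_def d_def)
qed

definition add :: "nat \<Rightarrow> nat \<Rightarrow> com" where "add x y = for_below vK y (Inc x)"

lemma add_simps [simp]: "assigned (add x y) = {vK, x}" "written (add x y) = {aPASS}" "\<not> emits (add x y)"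
  by (simp_all add: add_def)

lemma run_add:
  assumes "vr \<sigma> x < N" "vr \<sigma> y < N" "x \<noteq> y" "x \<noteq> vK" "y \<noteq> vK"
  shows "vr (run N (add x y) \<sigma>) x = min (N - 1) (vr \<sigma> x + vr \<sigma> y)"
proof -
  have "vr (iter n (\<lambda>i \<tau>. run N (Inc x) (setv vK i \<tau>)) (seta aPASS [] 0 \<sigma>)) x = min (N - 1) (vr \<sigma> x + n)" for n
    using assms by (induction n) (auto simp: min_def)
  then show ?thesis using assms by (simp add: add_def run_for_below)
qed

section \<open>Reading the instance\<close>

text \<open>The list separator \<open>4\<close> occurs once more than there are vertices; the first one ends
  the multiplicities.\<close>

definition prescan :: com where
  "prescan = Seq (For vQ (IfA aIN [vQ] 4 (IfA aSND [] 0 (Write aSND [] 1)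
       (Seq (Write aVERT [vV] 1) (Inc vV))) Skip)) (Seq (clear vV) (Write aSND [] 0))"

lemma prescan_simps [simp]: "assigned prescan = {vQ, vV}" "written prescan = {aSND, aVERT}" "\<not> emits prescan"
  by (auto simp: prescan_def)

lemma count_list_take_Suc: "i < length w \<Longrightarrow>
   count_list (take (Suc i) w) s = count_list (take i w) s + (if w ! i = s then 1 else 0)"
  by (simp add: take_Suc_conv_app_nth)

lemma count_list_take_le: "count_list (take i w) s \<le> count_list w s"
  by (metis append_take_drop_id count_list_append le_add1)

lemma run_prescan:
  assumes IN: "\<And>p. p < N \<Longrightarrow> ar \<sigma> aIN [p] = w ! p" and N: "N = length w"
    and 0: "vr \<sigma> vV = 0" "ar \<sigma> aSND [] = 0" "\<And>z. ar \<sigma> aVERT [z] = 0"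
    and c: "count_list w 4 \<le> N"
  shows "vr (run N prescan \<sigma>) vV = 0" "ar (run N prescan \<sigma>) aSND [] = 0"
    "ar (run N prescan \<sigma>) aVERT [z] = (if Suc z < count_list w 4 then 1 else 0)"
proof -
  let ?I = "\<lambda>i \<tau>. vr \<tau> vV = count_list (take i w) 4 - 1 \<and> ar \<tau> aSND [] = min 1 (count_list (take i w) 4) \<and>
     (\<forall>z. ar \<tau> aVERT [z] = (if Suc z < count_list (take i w) 4 then 1 else 0))"
  let ?c = "IfA aIN [vQ] 4 (IfA aSND [] 0 (Write aSND [] 1) (Seq (Write aVERT [vV] 1) (Inc vV))) Skip"
  have "?I N (run N (For vQ ?c) \<sigma>)"
  proof (rule For_rule[where I = ?I])
    fix i \<tau> assume i: "i < N" "?I i \<tau>" "agrees (For vQ ?c) \<sigma> \<tau>"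
    have "ar \<tau> aIN = ar \<sigma> aIN" using agreesD(2)[OF i(3)] by simp
    then have s: "ar \<tau> aIN [i] = w ! i" using IN i(1) by simp
    note ct = count_list_take_Suc[OF i(1)[unfolded N], of 4]
    have le: "count_list (take (Suc i) w) 4 \<le> N" using count_list_take_le[of "Suc i" w 4] c by linarith
    show "?I (Suc i) (run N ?c (setv vQ i \<tau>))"
    proof (cases "w ! i = 4")
      case False
      then show ?thesis using i s ct by simp
    next
      case True
      then show ?thesis
        using i(2) s ct le by (cases "count_list (take i w) 4") auto
    qed
  qed (use 0 N in auto)
  then show "vr (run N prescan \<sigma>) vV = 0" "ar (run N prescan \<sigma>) aSND [] = 0"
    "ar (run N prescan \<sigma>) aVERT [z] = (if Suc z < count_list w 4 then 1 else 0)"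
    using N by (simp_all add: prescan_def del: run.simps(8))
qed

text \<open>The symbols \<open>1\<close> and \<open>2\<close> are the bits \<open>0\<close> and
  \<open>1\<close>.\<close>

fun bits_value :: "nat list \<Rightarrow> nat" where
  "bits_value [] = 0"
| "bits_value (b # bs) = (b - 1) + 2 * bits_value bs"

text \<open>What has been read: the number of completed lists, the symbols of the current number, and for
  each completed number the list that it belongs to, with its value. The loop over the input is specified by
  this fold, whose value on encoded lists is found by induction on the lists.\<close>

fun scan_step :: "nat \<times> nat list \<times> (nat \<times> nat) list \<Rightarrow> nat \<Rightarrow> nat \<times> nat list \<times> (nat \<times> nat) list" where
  "scan_step (l, bs, es) s =
     (if s = 3 then (l, [], es @ [(l, bits_value bs)]) else if s = 4 then (Suc l, bs, es) else (l, bs @ [s], es))"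

definition scanned :: "nat list \<Rightarrow> nat \<times> nat list \<times> (nat \<times> nat) list" where
  "scanned = foldl scan_step (0, [], [])"

lemma set_binary: "set (binary n) \<subseteq> {1, 2}"
  by (induction n rule: binary.induct) (subst binary.simps, auto)

lemma bits_value_binary: "bits_value (binary n) = n"
  by (induction n rule: binary.induct) (subst binary.simps, auto)

lemma foldl_bits: "set bs \<subseteq> {1, 2} \<Longrightarrow> foldl scan_step (l, cs, es) bs = (l, cs @ bs, es)"
  by (induction bs arbitrary: cs) auto

lemma foldl_numbers:
  "foldl scan_step (l, [], es) (concat (map (\<lambda>x. binary x @ [3]) xs)) = (l, [], es @ map (Pair l) xs)"
  by (induction xs arbitrary: es) (auto simp: foldl_bits[OF set_binary] bits_value_binary)

fun entries :: "nat \<Rightarrow> nat list list \<Rightarrow> (nat \<times> nat) list" where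
  "entries l [] = []"
| "entries l (xs # xss) = map (Pair l) xs @ entries (Suc l) xss"

lemma foldl_lists:
  "foldl scan_step (l, [], es) (encode_lists xss) = (l + length xss, [], es @ entries l xss)"
  by (induction xss arbitrary: l es) (auto simp: encode_lists_def foldl_numbers)

lemma scanned_encode: "scanned (encode_lists xss) = (length xss, [], entries 0 xss)"
  by (simp add: scanned_def foldl_lists)

lemma scanned_counts: "scanned ys = (l, bs, es) \<Longrightarrow> length es = count_list ys 3 \<and> l = count_list ys 4"
proof (induction ys arbitrary: l bs es rule: rev_induct)
  case (snoc s ys)
  obtain l' bs' es' where *: "scanned ys = (l', bs', es')" by (cases "scanned ys") auto
  from snoc.IH[OF *] snoc.prems * show ?case by (auto simp: scanned_def split: if_splits)
qed (simp add: scanned_def)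

lemma bits_value_snoc: "bits_value (bs @ [b]) = bits_value bs + (b - 1) * 2 ^ length bs"
  by (induction bs) (auto simp: algebra_simps)

text \<open>The value of a variable after \<open>x\<close> increments from \<open>0\<close>.\<close>

definition capped :: "nat \<Rightarrow> nat \<Rightarrow> nat" where
  "capped N x = min (N - 1) x"

lemma capped_add: "capped N (capped N x + capped N y) = capped N (x + y)" "capped N (capped N x + y) = capped N (x + y)"
  "capped N (x + capped N y) = capped N (x + y)"
  "capped N (2 * capped N x) = capped N (2 * x)"
  by (auto simp: capped_def min_def)

lemma capped_less: "N > 0 \<Longrightarrow> capped N x < N"
  by (auto simp: capped_def)

lemma capped_0 [simp]: "capped N 0 = 0"
  by (simp add: capped_def)

definition double :: com where
  "double = Seq (add vT vW) (Seq (add vW vT) (clear vT))"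

lemma double_simps [simp]: "assigned double = {vK, vW, vT}" "written double = {aPASS}" "\<not> emits double"
  by (auto simp: double_def)

lemma run_double:
  assumes "vr \<sigma> vW < N" "vr \<sigma> vT = 0"
  shows "vr (run N double \<sigma>) vW = capped N (2 * vr \<sigma> vW)" "vr (run N double \<sigma>) vT = 0"
proof -
  have 1: "vr (run N (add vT vW) \<sigma>) vT = vr \<sigma> vW" using assms run_add[of \<sigma> vT N vW] by auto
  then show "vr (run N double \<sigma>) vW = capped N (2 * vr \<sigma> vW)" "vr (run N double \<sigma>) vT = 0"
    using assms run_add[of "run N (add vT vW) \<sigma>" vW N vT] by (simp_all add: double_def capped_def mult_2)
qed

text \<open>With \<open>\<mu>\<close> in \<open>vACC\<close>, marks the loads above \<open>\<mu>\<close>.\<close>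

definition pair_entry :: com where
  "pair_entry = Seq (Write aPASS [] 0) (For vK (Seq (IfA aPASS [] 1 (Write aBAD [vE, vK] 1) Skip)
     (IfEq vK vACC (Write aPASS [] 1) Skip)))"

text \<open>With \<open>m\<close> in \<open>vACC\<close>, marks the loads \<open>k\<close> with \<open>m + k
  \<ge> n\<close>, those above \<open>n - 1 - m\<close>. The sum is formed in \<open>vACC\<close>, and
  comparing it with \<open>n\<close> means looking it up among the vertices.\<close>

definition star_entry :: com where
  "star_entry = Seq (Write aCTR [vE, vV] 1) (For vK (Seq (IfA aVERT [vACC] 0 (Write aBAD [vE, vK] 1) Skip) (Inc vACC)))"

lemma entry_simps [simp]: "assigned pair_entry = {vK}" "written pair_entry = {aPASS, aBAD}" "\<not> emits pair_entry"
  "assigned star_entry = {vK, vACC}" "written star_entry = {aCTR, aBAD}" "\<not> emits star_entry"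
  by (auto simp: pair_entry_def star_entry_def)

lemma run_pair_entry:
  "ar (run N pair_entry \<sigma>) aBAD ys =
     (if \<exists>k<N. ys = [vr \<sigma> vE, k] \<and> k > vr \<sigma> vACC then 1 else ar \<sigma> aBAD ys)"
proof -
  let ?c = "Seq (IfA aPASS [] 1 (Write aBAD [vE, vK] 1) Skip) (IfEq vK vACC (Write aPASS [] 1) Skip)"
  let ?I = "\<lambda>i \<tau>. (\<forall>ys. ar \<tau> aBAD ys = (if \<exists>k<i. ys = [vr \<sigma> vE, k] \<and> k > vr \<sigma> vACC then 1 else ar \<sigma> aBAD ys)) \<and>
     ar \<tau> aPASS [] = (if vr \<sigma> vACC < i then 1 else 0)"
  have "?I N (run N (For vK ?c) (seta aPASS [] 0 \<sigma>))"
  proof (rule For_rule[where I = ?I])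
    fix i \<tau> assume i: "i < N" "?I i \<tau>" "agrees (For vK ?c) (seta aPASS [] 0 \<sigma>) \<tau>"
    have "vr \<tau> vE = vr \<sigma> vE" "vr \<tau> vACC = vr \<sigma> vACC" using agreesD(1)[OF i(3)] by auto
    then show "?I (Suc i) (run N ?c (setv vK i \<tau>))" using i(2) by (auto simp: less_Suc_eq)
  qed simp_all
  then show ?thesis by (simp add: pair_entry_def del: run.simps(8))
qed

lemma run_star_entry:
  assumes "vr \<sigma> vACC < N"
  shows "ar (run N star_entry \<sigma>) aBAD ys =
     (if \<exists>k<N. ys = [vr \<sigma> vE, k] \<and> ar \<sigma> aVERT [capped N (vr \<sigma> vACC + k)] = 0 then 1 else ar \<sigma> aBAD ys)"
    "ar (run N star_entry \<sigma>) aCTR = (ar \<sigma> aCTR)([vr \<sigma> vE, vr \<sigma> vV] := 1)"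
proof -
  let ?c = "Seq (IfA aVERT [vACC] 0 (Write aBAD [vE, vK] 1) Skip) (Inc vACC)"
  let ?\<sigma> = "seta aCTR [vr \<sigma> vE, vr \<sigma> vV] 1 \<sigma>"
  let ?I = "\<lambda>i \<tau>. (\<forall>ys. ar \<tau> aBAD ys = (if \<exists>k<i. ys = [vr \<sigma> vE, k] \<and>
        ar \<sigma> aVERT [capped N (vr \<sigma> vACC + k)] = 0 then 1 else ar \<sigma> aBAD ys)) \<and>
     vr \<tau> vACC = capped N (vr \<sigma> vACC + i)"
  have "?I N (run N (For vK ?c) ?\<sigma>)"
  proof (rule For_rule[where I = ?I])
    fix i \<tau> assume i: "i < N" "?I i \<tau>" "agrees (For vK ?c) ?\<sigma> \<tau>"
    have "vr \<tau> vE = vr \<sigma> vE" "ar \<tau> aVERT = ar \<sigma> aVERT" using agreesD(1,2)[OF i(3)] by auto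
    then show "?I (Suc i) (run N ?c (setv vK i \<tau>))" using i(1,2) by (auto simp: less_Suc_eq capped_def min_def)
  qed (use assms in \<open>simp_all add: capped_def\<close>)
  then show "ar (run N star_entry \<sigma>) aBAD ys =
     (if \<exists>k<N. ys = [vr \<sigma> vE, k] \<and> ar \<sigma> aVERT [capped N (vr \<sigma> vACC + k)] = 0 then 1 else ar \<sigma> aBAD ys)"
    by (simp add: star_entry_def del: run.simps(8))
  show "ar (run N star_entry \<sigma>) aCTR = (ar \<sigma> aCTR)([vr \<sigma> vE, vr \<sigma> vV] := 1)"
    using agreesD(2)[OF run_agrees, of aCTR "For vK ?c" N ?\<sigma>] by (simp add: star_entry_def del: run.simps(8))
qed

text \<open>\<open>vW\<close> is the weight of the next bit, and \<open>vACC\<close> the value of the bits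
  so far.\<close>

definition scan_body :: com where
  "scan_body = IfA aIN [vQ] 1 double (IfA aIN [vQ] 2 (Seq (add vACC vW) double)
     (IfA aIN [vQ] 3 (Seq (IfA aSND [] 0 pair_entry star_entry)
         (Seq (Inc vE) (Seq (clear vACC) (Seq (clear vW) (Inc vW)))))
     (IfA aSND [] 0 (Write aSND [] 1) (Inc vV))))"

definition scan :: com where
  "scan = Seq (Inc vW) (For vQ scan_body)"

lemma scan_simps [simp]: "assigned scan_body = {vE, vV, vACC, vW, vT, vK}" "written scan_body = {aSND, aPASS, aCTR, aBAD}"
  "\<not> emits scan_body" "assigned scan = {vQ, vE, vV, vACC, vW, vT, vK}" "written scan = {aSND, aPASS, aCTR, aBAD}"
  "\<not> emits scan"
  by (auto simp: scan_body_def scan_def)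

text \<open>If \<open>k\<close> and \<open>n\<close> are less than \<open>N\<close>, this says that
  \<open>k\<close> exceeds the capacity of the entry, and cutting off makes no difference.\<close>

definition bad_entry :: "nat \<Rightarrow> nat \<Rightarrow> nat \<times> nat \<Rightarrow> nat \<Rightarrow> bool" where
  "bad_entry N n x k \<longleftrightarrow> (if fst x = 0 then k > capped N (snd x)
     else capped N (capped N (snd x) + k) \<ge> n)"

definition scan_inv :: "nat \<Rightarrow> nat \<Rightarrow> nat list \<Rightarrow> st \<Rightarrow> bool" where
  "scan_inv N n ys \<tau> \<longleftrightarrow> (case scanned ys of (l, bs, es) \<Rightarrow>
     ar \<tau> aSND [] = min 1 l \<and> vr \<tau> vV = l - 1 \<and> vr \<tau> vACC = capped N (bits_value bs) \<and>
     vr \<tau> vW = capped N (2 ^ length bs) \<and> vr \<tau> vT = 0 \<and> vr \<tau> vE = length es \<and>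
     (\<forall>a b. ar \<tau> aCTR [a, b] = (if a < length es \<and> fst (es ! a) = Suc b then 1 else 0)) \<and>
     (\<forall>a. \<forall>k<N. ar \<tau> aBAD [a, k] = (if a < length es \<and> bad_entry N n (es ! a) k then 1 else 0)))"

lemma scan_inv_step:
  assumes inv: "scan_inv N n ys \<tau>" and IN: "ar \<tau> aIN [vr \<tau> vQ] = s" and s: "s \<in> {1, 2, 3, 4}"
    and N: "N > 0" and V: "\<And>z. z < N \<Longrightarrow> ar \<tau> aVERT [z] = (if z < n then 1 else 0)"
    and c3: "count_list (ys @ [s]) 3 < N" and c4: "count_list (ys @ [s]) 4 \<le> N"
  shows "scan_inv N n (ys @ [s]) (run N scan_body \<tau>)"
proof -
  obtain l bs es where sc: "scanned ys = (l, bs, es)" by (cases "scanned ys") auto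
  have sc': "scanned (ys @ [s]) = scan_step (l, bs, es) s" using sc by (simp add: scanned_def)
  have cnt: "length es = count_list ys 3" "l = count_list ys 4" using scanned_counts[OF sc] by auto
  have I: "ar \<tau> aSND [] = min 1 l" "vr \<tau> vV = l - 1" "vr \<tau> vACC = capped N (bits_value bs)"
     "vr \<tau> vW = capped N (2 ^ length bs)" "vr \<tau> vT = 0" "vr \<tau> vE = length es"
     "\<And>a b. ar \<tau> aCTR [a, b] = (if a < length es \<and> fst (es ! a) = Suc b then 1 else 0)"
     "\<And>a k. k < N \<Longrightarrow> ar \<tau> aBAD [a, k] = (if a < length es \<and> bad_entry N n (es ! a) k then 1 else 0)"
    using inv sc by (auto simp: scan_inv_def)
  have W: "vr \<tau> vW < N" "vr \<tau> vACC < N" using I capped_less[OF N] by simp_all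
  from s consider "s = 1" | "s = 2" | "s = 3" | "s = 4" by auto
  then show ?thesis
  proof cases
    case 1
    have r: "run N scan_body \<tau> = run N double \<tau>" using IN 1 by (simp add: scan_body_def)
    show ?thesis unfolding scan_inv_def r sc' using 1 I run_double[OF W(1) I(5)]
      by (simp add: bits_value_snoc capped_add)
  next
    case 2
    let ?\<tau> = "run N (add vACC vW) \<tau>"
    have r: "run N scan_body \<tau> = run N double ?\<tau>" using IN 2 by (simp add: scan_body_def)
    have "vr ?\<tau> vACC = capped N (bits_value bs + 2 ^ length bs)" using run_add[OF W(2,1), folded capped_def] I by (simp add: capped_add)
    moreover have "vr (run N double ?\<tau>) vW = capped N (2 * vr ?\<tau> vW)" "vr (run N double ?\<tau>) vT = 0"
      using run_double[of ?\<tau> N] W I by simp_all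
    ultimately show ?thesis unfolding scan_inv_def r sc' using 2 I by (simp add: bits_value_snoc capped_add)
  next
    case 3
    let ?e = "if l = 0 then pair_entry else star_entry"
    let ?\<tau> = "run N ?e \<tau>"
    have len: "Suc (length es) < Suc N" using c3 cnt 3 by simp
    have "ar \<tau> aSND [] = 0 \<longleftrightarrow> l = 0" using I by auto
    then have r: "run N scan_body \<tau> = run N (Seq (Inc vE) (Seq (clear vACC) (Seq (clear vW) (Inc vW)))) ?\<tau>"
      using IN 3 by (simp add: scan_body_def)
    have e: "vr ?\<tau> vE = length es" "vr ?\<tau> vV = vr \<tau> vV" "vr ?\<tau> vT = 0" "ar ?\<tau> aSND = ar \<tau> aSND" using I by auto
    have B: "ar ?\<tau> aBAD [a, k] = (if a = length es \<and> bad_entry N n (l, bits_value bs) k then 1 else ar \<tau> aBAD [a, k])"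
      if k: "k < N" for a k
    proof (cases "l = 0")
      case True
      then show ?thesis using k run_pair_entry[of N \<tau> "[a, k]"] I by (auto simp: bad_entry_def)
    next
      case False
      have "ar \<tau> aVERT [capped N (vr \<tau> vACC + k)] = 0 \<longleftrightarrow> \<not> capped N (vr \<tau> vACC + k) < n"
        using V[OF capped_less[OF N], of "vr \<tau> vACC + k"] by auto
      then show ?thesis using False k run_star_entry(1)[OF W(2), of "[a, k]"] I
        by (auto simp: bad_entry_def not_less)
    qed
    have C: "ar ?\<tau> aCTR [a, b] = (if a = length es \<and> l = Suc b then 1 else ar \<tau> aCTR [a, b])" for a b
    proof (cases "l = 0")
      case False
      then show ?thesis using run_star_entry(2)[OF W(2)] I by auto
    qed simp
    have lenN: "Suc (length es) < N" using c3 cnt 3 by simp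
    have nth: "(es @ [(l, bits_value bs)]) ! a = (if a < length es then es ! a else (l, bits_value bs))" if "a < Suc (length es)" for a
      using that by (auto simp: nth_append less_Suc_eq)
    show ?thesis unfolding scan_inv_def r sc' using 3 e I(1,2) lenN
      by (auto simp: C B I(7,8) nth capped_def min_def)
  next
    case 4
    have r: "run N scan_body \<tau> = run N (IfA aSND [] 0 (Write aSND [] 1) (Inc vV)) \<tau>"
      using IN 4 by (simp add: scan_body_def)
    have l: "Suc l \<le> N" using c4 cnt 4 by simp
    show ?thesis
    proof (cases l)
      case 0
      then show ?thesis unfolding scan_inv_def r sc' using 4 I by simp
    next
      case (Suc l')
      then show ?thesis unfolding scan_inv_def r sc' using 4 I l by simp
    qed
  qed
qed

lemma run_scan:
  assumes IN: "\<And>p. p < N \<Longrightarrow> ar \<sigma> aIN [p] = w ! p" and N: "N = length w" "N > 0"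
    and s: "set w \<subseteq> {1, 2, 3, 4}"
    and 0: "\<And>x. x \<in> {vE, vV, vACC, vW, vT} \<Longrightarrow> vr \<sigma> x = 0" "ar \<sigma> aSND [] = 0"
      "\<And>ys. ar \<sigma> aCTR ys = 0" "\<And>ys. ar \<sigma> aBAD ys = 0"
    and V: "\<And>z. z < N \<Longrightarrow> ar \<sigma> aVERT [z] = (if z < n then 1 else 0)"
    and c: "count_list w 3 < N" "count_list w 4 \<le> N"
  shows "scan_inv N n w (run N scan \<sigma>)"
proof -
  let ?\<sigma> = "run N (Inc vW) \<sigma>"
  have "scan_inv N n (take N w) (run N (For vQ scan_body) ?\<sigma>)"
  proof (rule For_rule[where I = "\<lambda>i. scan_inv N n (take i w)"])
    show "scan_inv N n (take 0 w) ?\<sigma>" using 0 N by (auto simp: scan_inv_def scanned_def capped_def min_def)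
  next
    fix i \<tau> assume i: "i < N" "scan_inv N n (take i w) \<tau>" "agrees (For vQ scan_body) ?\<sigma> \<tau>"
    have eq: "take (Suc i) w = take i w @ [w ! i]" using i N by (simp add: take_Suc_conv_app_nth)
    have "ar \<tau> aIN = ar \<sigma> aIN" "ar \<tau> aVERT = ar \<sigma> aVERT" using agreesD(2)[OF i(3)] by auto
    moreover have "scan_inv N n (take i w) (setv vQ i \<tau>)" using i(2) by (simp add: scan_inv_def)
    moreover have "w ! i \<in> {1, 2, 3, 4}" using s i N by (auto dest: nth_mem)
    moreover have "count_list (take (Suc i) w) 3 < N" "count_list (take (Suc i) w) 4 \<le> N"
      using c count_list_take_le[of "Suc i" w] by (meson le_less_trans order_trans)+
    ultimately show "scan_inv N n (take (Suc i) w) (run N scan_body (setv vQ i \<tau>))"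
      unfolding eq using i(1) N(2) IN V by (intro scan_inv_step) simp_all
  next
    fix \<tau> assume "scan_inv N n (take N w) \<tau>"
    then show "scan_inv N n (take N w) (setv vQ 0 \<tau>)" by (simp add: scan_inv_def)
  qed
  then show ?thesis using N by (simp add: scan_def del: run.simps(2,8))
qed

section \<open>Setting up the network\<close>

definition row :: "nat \<Rightarrow> nat \<Rightarrow> (nat \<times> nat) list" where
  "row n u = map (Pair u) [Suc u..<n]"

definition note_pair :: com where
  "note_pair = Seq (Write aEND [vE, vU] 1) (Seq (Write aEND [vE, vV] 1) (Inc vE))"

definition ends_row :: com where
  "ends_row = Seq (Write aSND [] 0) (For vV (Seq
     (IfA aSND [] 1 (IfA aVERT [vV] 1 note_pair Skip) Skip)
     (IfEq vU vV (Write aSND [] 1) Skip)))"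

text \<open>Runs through the pairs \<open>u < v\<close> in the order of the input, so that the counter
  \<open>vE\<close> is the number of the pair. The flag \<open>aSND\<close> says that \<open>v\<close> has
  passed \<open>u\<close>.\<close>

definition ends :: com where
  "ends = Seq (clear vE) (For vU ends_row)"

lemma ends_simps [simp]: "assigned ends = {vE, vU, vV}" "written ends = {aSND, aEND}" "\<not> emits ends"
  "assigned ends_row = {vE, vV}" "written ends_row = {aSND, aEND}" "\<not> emits ends_row"
  "assigned note_pair = {vE}" "written note_pair = {aEND}" "\<not> emits note_pair"
  by (auto simp: ends_def ends_row_def note_pair_def)

definition ends_inv :: "(nat \<times> nat) list \<Rightarrow> st \<Rightarrow> bool" where
  "ends_inv es \<tau> \<longleftrightarrow> vr \<tau> vE = length es \<and>
     (\<forall>a b. ar \<tau> aEND [a, b] = (if a < length es \<and> (b = fst (es ! a) \<or> b = snd (es ! a)) then 1 else 0))"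

lemma run_note_pair:
  assumes "ends_inv es \<tau>" "Suc (length es) < N"
  shows "ends_inv (es @ [(vr \<tau> vU, vr \<tau> vV)]) (run N note_pair \<tau>)"
  using assms by (auto simp: ends_inv_def note_pair_def nth_append less_Suc_eq)

lemma run_ends_row:
  assumes inv: "ends_inv es \<sigma>" and u: "vr \<sigma> vU = u" and len: "length es + length (row n u) < N"
    and V: "\<And>z. z < N \<Longrightarrow> ar \<sigma> aVERT [z] = (if z < n then 1 else 0)" and n: "n \<le> N"
  shows "ends_inv (es @ row n u) (run N ends_row \<sigma>)"
proof -
  let ?c = "Seq (IfA aSND [] 1 (IfA aVERT [vV] 1 note_pair Skip) Skip) (IfEq vU vV (Write aSND [] 1) Skip)"
  let ?es = "\<lambda>v. es @ map (Pair u) [Suc u..<min v n]"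
  have "ends_inv (?es N) (run N (For vV ?c) (seta aSND [] 0 \<sigma>))"
  proof (rule For_rule[where I = "\<lambda>v \<tau>. ends_inv (?es v) \<tau> \<and> ar \<tau> aSND [] = (if u < v then 1 else 0)"])
    show "ends_inv (?es 0) (seta aSND [] 0 \<sigma>) \<and> ar (seta aSND [] 0 \<sigma>) aSND [] = (if u < 0 then 1 else 0)"
      using inv by (simp add: ends_inv_def)
  next
    fix v \<tau> assume v: "v < N" "ends_inv (?es v) \<tau> \<and> ar \<tau> aSND [] = (if u < v then 1 else 0)"
      "agrees (For vV ?c) (seta aSND [] 0 \<sigma>) \<tau>"
    let ?\<tau> = "setv vV v \<tau>"
    have f: "vr \<tau> vU = u" "ar \<tau> aVERT = ar \<sigma> aVERT" using agreesD(1,2)[OF v(3)] u by auto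
    have inv': "ends_inv (?es v) ?\<tau>" using v(2) by (simp add: ends_inv_def)
    show "ends_inv (?es (Suc v)) (run N ?c ?\<tau>) \<and> ar (run N ?c ?\<tau>) aSND [] = (if u < Suc v then 1 else 0)"
    proof (cases "u < v \<and> v < n")
      case True
      then have e: "?es (Suc v) = ?es v @ [(u, v)]" by (simp add: min_def)
      have "length (?es v) + 1 \<le> length es + length (row n u)"
        using True by (simp add: row_def min_def) arith
      then have "ends_inv (?es v @ [(u, v)]) (run N note_pair ?\<tau>)"
        using run_note_pair[OF inv', of N] len f by simp
      then show ?thesis using True v V[of v] f unfolding e by (simp add: ends_inv_def)
    next
      case False
      have e: "?es (Suc v) = ?es v"
      proof (cases "n \<le> v")
        case True
        then show ?thesis by (simp add: min_def)
      next
        case F: False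
        then have "v \<le> u" using False by simp
        then show ?thesis by (simp add: min_def)
      qed
      show ?thesis using False v V[of v] f unfolding e by (auto simp: ends_inv_def)
    qed
  next
    fix \<tau> assume "ends_inv (?es N) \<tau> \<and> ar \<tau> aSND [] = (if u < N then 1 else 0)"
    then show "ends_inv (?es N) (setv vV 0 \<tau>)" by (simp add: ends_inv_def)
  qed
  then show ?thesis using n by (simp add: ends_row_def row_def min.absorb2 del: run.simps(8))
qed

lemma length_concat_mono:
  "u \<le> N \<Longrightarrow> length (concat (map f [0..<u])) \<le> length (concat (map f [0..<N]))"
  by (induction N) (auto simp: le_Suc_eq)

lemma concat_rows: "n \<le> N \<Longrightarrow> concat (map (row n) [0..<N]) = concat (map (row n) [0..<n])"
proof (induction N)
  case (Suc N)
  then show ?case by (cases "n = Suc N") (auto simp: row_def)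
qed simp

lemma run_ends:
  assumes 0: "\<And>ys. ar \<sigma> aEND ys = 0" and len: "length (concat (map (row n) [0..<n])) < N"
    and V: "\<And>z. z < N \<Longrightarrow> ar \<sigma> aVERT [z] = (if z < n then 1 else 0)" and n: "n \<le> N"
  shows "ends_inv (concat (map (row n) [0..<n])) (run N ends \<sigma>)"
proof -
  let ?es = "\<lambda>u. concat (map (row n) [0..<u])"
  have "ends_inv (?es N) (run N (For vU ends_row) (setv vE 0 \<sigma>))"
  proof (rule For_rule[where I = "\<lambda>u. ends_inv (?es u)"])
    show "ends_inv (?es 0) (setv vE 0 \<sigma>)" using 0 by (simp add: ends_inv_def)
  next
    fix u \<tau> assume u: "u < N" "ends_inv (?es u) \<tau>" "agrees (For vU ends_row) (setv vE 0 \<sigma>) \<tau>"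
    have "ar \<tau> aVERT = ar \<sigma> aVERT" using agreesD(2)[OF u(3)] by auto
    moreover have "ends_inv (?es u) (setv vU u \<tau>)" using u(2) by (simp add: ends_inv_def)
    moreover have "length (?es u) + length (row n u) < N"
      using length_concat_mono[of "Suc u" N "row n"] u(1) len concat_rows[OF n] by simp
    ultimately have "ends_inv (?es u @ row n u) (run N ends_row (setv vU u \<tau>))"
      using V n by (intro run_ends_row) simp_all
    then show "ends_inv (?es (Suc u)) (run N ends_row (setv vU u \<tau>))" by simp
  next
    fix \<tau> assume "ends_inv (?es N) \<tau>"
    then show "ends_inv (?es N) (setv vU 0 \<tau>)" by (simp add: ends_inv_def)
  qed
  then show ?thesis by (simp add: ends_def concat_rows[OF n] del: run.simps(8))
qed

text \<open>A star owns its edges at first.\<close>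

definition own :: com where
  "own = For vI (For vJ (For vV (IfA aCTR [vI, vV] 1 (IfA aEND [vJ, vV] 1 (Write aOWN [vI, vJ] 1) Skip) Skip)))"

lemma own_simps [simp]: "assigned own = {vI, vJ, vV}" "written own = {aOWN}" "\<not> emits own"
  by (auto simp: own_def)

lemma run_own:
  "ar (run N own \<sigma>) aOWN ys = (if \<exists>i<N. \<exists>j<N. \<exists>y<N. ys = [i, j] \<and> ar \<sigma> aCTR [i, y] = 1 \<and> ar \<sigma> aEND [j, y] = 1
     then 1 else ar \<sigma> aOWN ys)"
proof -
  define c1 where "c1 = IfA aCTR [vI, vV] 1 (IfA aEND [vJ, vV] 1 (Write aOWN [vI, vJ] 1) Skip) Skip"
  have c1 [simp]: "assigned c1 = {}" "written c1 = {aOWN}" by (auto simp: c1_def)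
  let ?Q1 = "\<lambda>\<tau> m \<upsilon>. \<forall>ys. ar \<upsilon> aOWN ys = (if \<exists>y<m. ys = [vr \<tau> vI, vr \<tau> vJ] \<and>
     ar \<tau> aCTR [vr \<tau> vI, y] = 1 \<and> ar \<tau> aEND [vr \<tau> vJ, y] = 1 then 1 else ar \<tau> aOWN ys)"
  have 1: "?Q1 \<tau> N (run N (For vV c1) \<tau>)" for \<tau>
  proof (rule For_rule[where I = "\<lambda>m. ?Q1 \<tau> m"])
    fix i \<upsilon> assume i: "i < N" "?Q1 \<tau> i \<upsilon>" "agrees (For vV c1) \<tau> \<upsilon>"
    have "vr \<upsilon> vI = vr \<tau> vI" "vr \<upsilon> vJ = vr \<tau> vJ" "ar \<upsilon> aCTR = ar \<tau> aCTR" "ar \<upsilon> aEND = ar \<tau> aEND"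
      using agreesD(1,2)[OF i(3)] by auto
    then show "?Q1 \<tau> (Suc i) (run N c1 (setv vV i \<upsilon>))" using i(2) by (auto simp: c1_def less_Suc_eq)
  qed simp_all
  define c2 where "c2 = For vV c1"
  have c2 [simp]: "assigned c2 = {vV}" "written c2 = {aOWN}" by (auto simp: c2_def)
  note 1 = 1[folded c2_def]
  let ?Q2 = "\<lambda>\<tau> m \<upsilon>. \<forall>ys. ar \<upsilon> aOWN ys = (if \<exists>j<m. \<exists>y<N. ys = [vr \<tau> vI, j] \<and>
     ar \<tau> aCTR [vr \<tau> vI, y] = 1 \<and> ar \<tau> aEND [j, y] = 1 then 1 else ar \<tau> aOWN ys)"
  have 2: "?Q2 \<tau> N (run N (For vJ c2) \<tau>)" for \<tau>
  proof (rule For_rule[where I = "\<lambda>m. ?Q2 \<tau> m"])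
    fix i \<upsilon> assume i: "i < N" "?Q2 \<tau> i \<upsilon>" "agrees (For vJ c2) \<tau> \<upsilon>"
    have "vr \<upsilon> vI = vr \<tau> vI" "ar \<upsilon> aCTR = ar \<tau> aCTR" "ar \<upsilon> aEND = ar \<tau> aEND"
      using agreesD(1,2)[OF i(3)] by auto
    then show "?Q2 \<tau> (Suc i) (run N c2 (setv vJ i \<upsilon>))" using i(2) 1[of "setv vJ i \<upsilon>"]
      by (auto simp: less_Suc_eq)
  qed simp_all
  define c3 where "c3 = For vJ c2"
  have c3 [simp]: "assigned c3 = {vJ, vV}" "written c3 = {aOWN}" by (auto simp: c3_def)
  note 2 = 2[folded c3_def]
  let ?Q3 = "\<lambda>m \<upsilon>. \<forall>ys. ar \<upsilon> aOWN ys = (if \<exists>i<m. \<exists>j<N. \<exists>y<N. ys = [i, j] \<and>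
     ar \<sigma> aCTR [i, y] = 1 \<and> ar \<sigma> aEND [j, y] = 1 then 1 else ar \<sigma> aOWN ys)"
  have 3: "?Q3 N (run N (For vI c3) \<sigma>)"
  proof (rule For_rule[where I = "\<lambda>m. ?Q3 m"])
    fix i \<upsilon> assume i: "i < N" "?Q3 i \<upsilon>" "agrees (For vI c3) \<sigma> \<upsilon>"
    have "ar \<upsilon> aCTR = ar \<sigma> aCTR" "ar \<upsilon> aEND = ar \<sigma> aEND"
      using agreesD(2)[OF i(3)] by auto
    then show "?Q3 (Suc i) (run N c3 (setv vI i \<upsilon>))" using i(2) 2[of "setv vI i \<upsilon>"]
      by (auto simp: less_Suc_eq)
  qed simp_all
  then show ?thesis by (simp add: own_def c1_def c2_def c3_def del: run.simps)
qed

section \<open>The push-relabel procedure as a program\<close>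

text \<open>Heights are stored in unary notation, so that raising a node sets one entry, and heights can be
  compared without counting.\<close>

definition tracks :: "nat \<Rightarrow> (nat \<times> nat) set \<Rightarrow> (nat \<Rightarrow> nat) \<Rightarrow> st \<Rightarrow> bool" where
  "tracks N R h \<tau> \<longleftrightarrow> (\<forall>a<N. \<forall>b<N. ar \<tau> aOWN [a, b] = (if (a, b) \<in> R then 1 else 0)) \<and>
     (\<forall>a<N. \<forall>t<N. ar \<tau> aHT [a, t] = (if t < h a then 1 else 0))"

lemma tracks_cong: "ar \<tau> aOWN = ar \<upsilon> aOWN \<Longrightarrow> ar \<tau> aHT = ar \<upsilon> aHT \<Longrightarrow> tracks N R h \<tau> \<longleftrightarrow> tracks N R h \<upsilon>"
  by (simp add: tracks_def)

lemma tracks_setv [simp]: "tracks N R h (setv x n \<tau>) = tracks N R h \<tau>"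
  "a \<noteq> aOWN \<Longrightarrow> a \<noteq> aHT \<Longrightarrow> tracks N R h (seta a ys s \<tau>) = tracks N R h \<tau>"
  by (simp_all add: tracks_def)

definition count_own :: com where
  "count_own = Seq (clear vK) (For vJ (IfA aOWN [vI, vJ] 1 (Inc vK) Skip))"

text \<open>Hands the first edge that leads down to its other end: a height is greater than another if some
  \<open>t\<close> is below the former but not the latter.\<close>

definition push_edge :: com where
  "push_edge = For vJ (For vT (IfA aDONE [] 0 (IfA aOWN [vI, vJ] 1 (IfA aHT [vI, vT] 1 (IfA aHT [vJ, vT] 0
     (Seq (Write aOWN [vI, vJ] 0) (Seq (Write aOWN [vJ, vI] 1) (Write aDONE [] 1))) Skip) Skip) Skip) Skip))"

definition raise_height :: com where
  "raise_height = For vT (IfA aDONE [] 0 (IfA aHT [vI, vT] 0 (Seq (Write aHT [vI, vT] 1) (Write aDONE [] 1)) Skip) Skip)"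

text \<open>Makes one move at the node \<open>vI\<close> if it is overloaded, and reports failure if there
  is none.\<close>

definition relieve :: com where
  "relieve = Seq count_own (IfA aBAD [vI, vK] 1 (Seq (Write aDONE [] 0) (Seq push_edge (Seq raise_height
     (IfA aDONE [] 0 (Write aFAIL [] 1) Skip)))) Skip)"

definition round :: com where "round = For vI relieve"

text \<open>These are \<open>3 N\<^sup>3\<close> rounds, whereas the potential is at most \<open>2
  N\<^sup>3\<close>. The loop variables serve to count only.\<close>

definition rounds :: com where
  "rounds = For vQ (For vE (For vV (Seq round (Seq round round))))"

lemma round_simps [simp]: "assigned count_own = {vJ, vK}" "written count_own = {}" "\<not> emits count_own"
  "assigned push_edge = {vJ, vT}" "written push_edge = {aOWN, aDONE}" "\<not> emits push_edge"
  "assigned raise_height = {vT}" "written raise_height = {aHT, aDONE}" "\<not> emits raise_height"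
  "assigned relieve = {vJ, vT, vK}" "written relieve = {aOWN, aHT, aDONE, aFAIL}" "\<not> emits relieve"
  "assigned round = {vI, vJ, vT, vK}" "written round = {aOWN, aHT, aDONE, aFAIL}" "\<not> emits round"
  "assigned rounds = {vQ, vE, vV, vI, vJ, vT, vK}" "written rounds = {aOWN, aHT, aDONE, aFAIL}" "\<not> emits rounds"
  by (auto simp: count_own_def push_edge_def raise_height_def relieve_def round_def rounds_def)

lemma run_count_own:
  assumes t: "tracks N R h \<sigma>" and a: "vr \<sigma> vI < N" and R: "R \<subseteq> {..<N} \<times> {..<N}" "load R (vr \<sigma> vI) < N"
  shows "vr (run N count_own \<sigma>) vK = load R (vr \<sigma> vI)"
proof -
  let ?c = "IfA aOWN [vI, vJ] 1 (Inc vK) Skip"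
  let ?a = "vr \<sigma> vI"
  let ?S = "\<lambda>j. {b. b < j \<and> (?a, b) \<in> R}"
  have le: "card (?S j) \<le> load R ?a" for j
    unfolding load_def using R(1) by (intro card_mono) (auto intro: finite_subset[of _ "{..<N}"])
  have "vr (run N (For vJ ?c) (setv vK 0 \<sigma>)) vK = card (?S N)"
  proof (rule For_rule[where I = "\<lambda>j \<tau>. vr \<tau> vK = card (?S j)"])
    fix j \<tau> assume j: "j < N" "vr \<tau> vK = card (?S j)" "agrees (For vJ ?c) (setv vK 0 \<sigma>) \<tau>"
    have f: "vr \<tau> vI = ?a" "ar \<tau> aOWN = ar \<sigma> aOWN" using agreesD(1,2)[OF j(3)] by auto
    have o: "ar \<sigma> aOWN [?a, j] = (if (?a, j) \<in> R then 1 else 0)" using t a j(1) by (simp add: tracks_def)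
    have S: "?S (Suc j) = (if (?a, j) \<in> R then insert j (?S j) else ?S j)" by (auto simp: less_Suc_eq)
    show "vr (run N ?c (setv vJ j \<tau>)) vK = card (?S (Suc j))"
    proof (cases "(?a, j) \<in> R")
      case True
      then have "card (?S (Suc j)) = Suc (card (?S j))" unfolding S by simp
      moreover have "Suc (card (?S j)) < N" using le[of "Suc j"] R(2) calculation by linarith
      ultimately show ?thesis using True f o j by simp
    next
      case False
      then show ?thesis unfolding S using f o j by simp
    qed
  qed simp_all
  moreover have "?S N = {b. (?a, b) \<in> R}" using R(1) by auto
  ultimately show ?thesis by (simp add: count_own_def load_def del: run.simps(8))
qed

lemma tracks_exchange:
  assumes "tracks N R h \<tau>" "a < N" "b < N" "a \<noteq> b"
  shows "tracks N (insert (b, a) (R - {(a, b)})) h (seta aOWN [b, a] 1 (seta aOWN [a, b] 0 \<tau>))"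
  using assms by (auto simp: tracks_def)

text \<open>Either the search has found nothing so far, or it has made exactly one push and does nothing
  more.\<close>

lemma run_push_edge:
  assumes t: "tracks N R h \<sigma>" and a: "vr \<sigma> vI = a" "a < N" and D: "ar \<sigma> aDONE [] = 0"
    and R: "R \<subseteq> {..<N} \<times> {..<N}" "\<And>x. (x, x) \<notin> R" and h: "\<And>x. h x \<le> N"
  shows "(ar (run N push_edge \<sigma>) aDONE [] = 0 \<and> tracks N R h (run N push_edge \<sigma>) \<and> (\<forall>b. (a, b) \<in> R \<longrightarrow> h a \<le> h b)) \<or>
     (ar (run N push_edge \<sigma>) aDONE [] = 1 \<and> (\<exists>b. (a, b) \<in> R \<and> h b < h a \<and>
        tracks N (insert (b, a) (R - {(a, b)})) h (run N push_edge \<sigma>)))"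
proof -
  define c where "c = IfA aDONE [] 0 (IfA aOWN [vI, vJ] 1 (IfA aHT [vI, vT] 1 (IfA aHT [vJ, vT] 0
     (Seq (Write aOWN [vI, vJ] 0) (Seq (Write aOWN [vJ, vI] 1) (Write aDONE [] 1))) Skip) Skip) Skip) Skip"
  have c [simp]: "assigned c = {}" "written c = {aOWN, aDONE}" by (auto simp: c_def)
  define P where "P \<tau> \<longleftrightarrow> ar \<tau> aDONE [] = 1 \<and> (\<exists>b. (a, b) \<in> R \<and> h b < h a \<and>
        tracks N (insert (b, a) (R - {(a, b)})) h \<tau>)" for \<tau>
  define I where "I j \<tau> \<longleftrightarrow> (ar \<tau> aDONE [] = 0 \<and> tracks N R h \<tau> \<and> (\<forall>b<j. (a, b) \<in> R \<longrightarrow> h a \<le> h b)) \<or> P \<tau>" for j \<tau>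
  define I' where "I' j t \<tau> \<longleftrightarrow> (ar \<tau> aDONE [] = 0 \<and> tracks N R h \<tau> \<and> (\<forall>b<j. (a, b) \<in> R \<longrightarrow> h a \<le> h b) \<and>
     ((a, j) \<in> R \<longrightarrow> (\<forall>s<t. s < h a \<longrightarrow> s < h j))) \<or> P \<tau>" for j t \<tau>
  have [simp]: "P (setv x n \<tau>) = P \<tau>" "I j (setv x n \<tau>) = I j \<tau>" for x n \<tau> j by (simp_all add: P_def I_def)
  have inner: "I (Suc j) (run N (For vT c) \<tau>)" if j: "j < N" "I j \<tau>" "vr \<tau> vI = a" "vr \<tau> vJ = j" for j \<tau>
  proof (rule For_rule[where I = "I' j"])
    show "I' j 0 \<tau>" using j(2) by (auto simp: I_def I'_def)
  next
    fix t \<upsilon> assume t: "t < N" "I' j t \<upsilon>" "agrees (For vT c) \<tau> \<upsilon>"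
    have v: "vr \<upsilon> vI = a" "vr \<upsilon> vJ = j" using agreesD(1)[OF t(3)] j by auto
    show "I' j (Suc t) (run N c (setv vT t \<upsilon>))"
    proof (cases "P \<upsilon>")
      case True
      then have "ar \<upsilon> aDONE [] = 1" by (simp add: P_def)
      then have "run N c (setv vT t \<upsilon>) = setv vT t \<upsilon>" by (simp add: c_def)
      then show ?thesis using True by (simp add: I'_def)
    next
      case False
      then have I: "ar \<upsilon> aDONE [] = 0" "tracks N R h \<upsilon>" "\<forall>b<j. (a, b) \<in> R \<longrightarrow> h a \<le> h b"
         "(a, j) \<in> R \<longrightarrow> (\<forall>s<t. s < h a \<longrightarrow> s < h j)" using t(2) by (auto simp: I'_def)
      have o: "ar \<upsilon> aOWN [a, j] = (if (a, j) \<in> R then 1 else 0)" "ar \<upsilon> aHT [a, t] = (if t < h a then 1 else 0)"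
        "ar \<upsilon> aHT [j, t] = (if t < h j then 1 else 0)"
        using I(2) a j(1) t(1) by (auto simp: tracks_def)
      show ?thesis
      proof (cases "(a, j) \<in> R \<and> t < h a \<and> \<not> t < h j")
        case True
        then have r: "run N c (setv vT t \<upsilon>) = seta aDONE [] 1 (seta aOWN [j, a] 1 (seta aOWN [a, j] 0 (setv vT t \<upsilon>)))"
          using o v I(1) by (simp add: c_def)
        have "a \<noteq> j" using True R(2) by auto
        then have "P (run N c (setv vT t \<upsilon>))" unfolding P_def r
          using True tracks_exchange[of N R h "setv vT t \<upsilon>" a j] I(2) a(2) j(1) by auto
        then show ?thesis by (simp add: I'_def)
      next
        case False
        then have r: "run N c (setv vT t \<upsilon>) = setv vT t \<upsilon>" using o v I(1) by (auto simp: c_def)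
        show ?thesis unfolding r I'_def using I False by (auto simp: less_Suc_eq)
      qed
    qed
  next
    fix \<upsilon> assume I': "I' j N \<upsilon>"
    have "h a \<le> h j" if "\<forall>s<N. s < h a \<longrightarrow> s < h j"
    proof (rule ccontr)
      assume "\<not> h a \<le> h j"
      then show False using that h[of a] by (metis less_irrefl_nat less_le_trans not_le)
    qed
    then show "I (Suc j) (setv vT 0 \<upsilon>)" using I' by (auto simp: I_def I'_def less_Suc_eq)
  qed
  have "I N (run N (For vJ (For vT c)) \<sigma>)"
  proof (rule For_rule[where I = I])
    show "I 0 \<sigma>" using t D by (simp add: I_def)
  next
    fix j \<tau> assume j: "j < N" "I j \<tau>" "agrees (For vJ (For vT c)) \<sigma> \<tau>"
    have "vr \<tau> vI = a" using agreesD(1)[OF j(3), of vI] a(1) by simp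
    then show "I (Suc j) (run N (For vT c) (setv vJ j \<tau>))" using j(1,2) by (intro inner) simp_all
  qed simp
  moreover have "push_edge = For vJ (For vT c)" by (simp add: push_edge_def c_def)
  moreover have "b < N" if "(a, b) \<in> R" for b using R(1) that by auto
  ultimately show ?thesis unfolding I_def P_def by auto
qed

lemma run_raise_height:
  assumes t: "tracks N R h \<sigma>" and a: "vr \<sigma> vI = a" "a < N" and D: "ar \<sigma> aDONE [] = 0" and h: "h a \<le> N"
  shows "(ar (run N raise_height \<sigma>) aDONE [] = 0 \<and> tracks N R h (run N raise_height \<sigma>) \<and> h a = N) \<or>
     (ar (run N raise_height \<sigma>) aDONE [] = 1 \<and> tracks N R (h(a := Suc (h a))) (run N raise_height \<sigma>) \<and> h a < N)"
proof -
  let ?c = "IfA aDONE [] 0 (IfA aHT [vI, vT] 0 (Seq (Write aHT [vI, vT] 1) (Write aDONE [] 1)) Skip) Skip"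
  define I where "I t \<tau> \<longleftrightarrow> (ar \<tau> aDONE [] = 0 \<and> tracks N R h \<tau> \<and> t \<le> h a) \<or>
     (ar \<tau> aDONE [] = 1 \<and> tracks N R (h(a := Suc (h a))) \<tau> \<and> h a < N)" for t \<tau>
  have [simp]: "I t (setv x n \<tau>) = I t \<tau>" for x n \<tau> t by (simp add: I_def)
  have "I N (run N (For vT ?c) \<sigma>)"
  proof (rule For_rule[where I = I])
    show "I 0 \<sigma>" using t D by (simp add: I_def)
  next
    fix t \<tau> assume t: "t < N" "I t \<tau>" "agrees (For vT ?c) \<sigma> \<tau>"
    have v: "vr \<tau> vI = a" using agreesD(1)[OF t(3), of vI] a(1) by simp
    show "I (Suc t) (run N ?c (setv vT t \<tau>))"
    proof (cases "ar \<tau> aDONE [] = 0")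
      case False
      then show ?thesis using t(2) by (auto simp: I_def)
    next
      case True
      then have I: "tracks N R h \<tau>" "t \<le> h a" using t(2) by (auto simp: I_def)
      then have o: "ar \<tau> aHT [a, t] = (if t < h a then 1 else 0)" using t(1) a(2) by (simp add: tracks_def)
      show ?thesis
      proof (cases "t < h a")
        case True
        then show ?thesis using \<open>ar \<tau> aDONE [] = 0\<close> I o v by (simp add: I_def)
      next
        case False
        then have "tracks N R (h(a := Suc (h a))) (seta aHT [a, t] 1 \<tau>)"
          using I by (auto simp: tracks_def)
        then show ?thesis using \<open>ar \<tau> aDONE [] = 0\<close> I o v False t(1) by (simp add: I_def tracks_def)
      qed
    qed
  qed simp
  then show ?thesis using h by (auto simp: I_def raise_height_def)
qed

lemma run_raise_height_done:
  assumes D: "ar \<sigma> aDONE [] = 1"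
  shows "ar (run N raise_height \<sigma>) = ar \<sigma>"
proof -
  let ?c = "IfA aDONE [] 0 (IfA aHT [vI, vT] 0 (Seq (Write aHT [vI, vT] 1) (Write aDONE [] 1)) Skip) Skip"
  have "ar (run N (For vT ?c) \<sigma>) = ar \<sigma>"
    by (rule For_rule[where I = "\<lambda>_ \<tau>. ar \<tau> = ar \<sigma>"]) (use D in auto)
  then show ?thesis by (simp add: raise_height_def)
qed

locale network = capacitated_graph "{..<N}" E cap N for N :: nat and E cap
begin

text \<open>Failure is a statement about the network and not about the state, so further moves may follow
  it.\<close>

definition simulates :: "st \<Rightarrow> (nat \<times> nat) set \<Rightarrow> (nat \<Rightarrow> nat) \<Rightarrow> bool" where
  "simulates \<tau> R h \<longleftrightarrow> tracks N R h \<tau> \<and> valid R h \<and>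
     (\<forall>a<N. \<forall>k<N. ar \<tau> aBAD [a, k] = (if cap a < int k then 1 else 0)) \<and>
     (ar \<tau> aFAIL [] = 1 \<longrightarrow> (\<exists>W. obstruction W))"

lemma simulates_setv [simp]: "simulates (setv x n \<tau>) = simulates \<tau>"
  by (simp add: simulates_def fun_eq_iff)

lemma run_relieve:
  assumes s: "simulates \<sigma> R h" and a: "vr \<sigma> vI = a" "a < N"
  shows "\<exists>R' h'. simulates (run N relieve \<sigma>) R' h' \<and>
     (ar \<sigma> aFAIL [] = 1 \<longrightarrow> ar (run N relieve \<sigma>) aFAIL [] = 1) \<and>
     (if excess R a then potential R' h' > potential R h \<or> ar (run N relieve \<sigma>) aFAIL [] = 1 else R' = R \<and> h' = h)"
proof -
  have v: "valid R h" and t: "tracks N R h \<sigma>"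
    and B: "\<forall>a<N. \<forall>k<N. ar \<sigma> aBAD [a, k] = (if cap a < int k then 1 else 0)"
    and F: "ar \<sigma> aFAIL [] = 1 \<longrightarrow> (\<exists>W. obstruction W)"
    using s by (auto simp: simulates_def)
  have o: "orients E R" and hN: "\<And>x. h x \<le> N" using v by (auto simp: valid_def)
  have R: "R \<subseteq> {..<N} \<times> {..<N}" "\<And>x. (x, x) \<notin> R" using orients_sub[OF o] orients_antisym[OF o] by auto
  have ld: "load R a < N" using load_less[OF o] a(2) by simp
  let ?\<sigma> = "run N count_own \<sigma>"
  have k: "vr ?\<sigma> vK = load R a" using run_count_own[OF t] a R ld by simp
  have t1: "tracks N R h ?\<sigma>" using t tracks_cong[of ?\<sigma> \<sigma>] by simp
  have b: "ar ?\<sigma> aBAD [a, load R a] = (if excess R a then 1 else 0)"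
    using B a ld by (simp add: excess_def)
  show ?thesis
  proof (cases "excess R a")
    case False
    then have "run N relieve \<sigma> = ?\<sigma>" using k b a by (simp add: relieve_def)
    then show ?thesis using False s t1 by (intro exI[of _ R] exI[of _ h]) (simp add: simulates_def)
  next
    case True
    let ?\<tau> = "run N push_edge (seta aDONE [] 0 ?\<sigma>)"
    let ?\<upsilon> = "run N raise_height ?\<tau>"
    have r: "run N relieve \<sigma> = run N (IfA aDONE [] 0 (Write aFAIL [] 1) Skip) ?\<upsilon>"
      using True k b a by (simp add: relieve_def)
    have fr: "ar ?\<upsilon> aBAD = ar \<sigma> aBAD" "ar ?\<upsilon> aFAIL = ar \<sigma> aFAIL" "vr ?\<tau> vI = a" using a by auto
    have push_res: "(ar ?\<tau> aDONE [] = 0 \<and> tracks N R h ?\<tau> \<and> (\<forall>b. (a, b) \<in> R \<longrightarrow> h a \<le> h b)) \<or>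
       (ar ?\<tau> aDONE [] = 1 \<and> (\<exists>b. (a, b) \<in> R \<and> h b < h a \<and> tracks N (insert (b, a) (R - {(a, b)})) h ?\<tau>))"
      by (rule run_push_edge) (use t1 a R hN in auto)
    then show ?thesis
    proof
      assume p: "ar ?\<tau> aDONE [] = 1 \<and> (\<exists>b. (a, b) \<in> R \<and> h b < h a \<and> tracks N (insert (b, a) (R - {(a, b)})) h ?\<tau>)"
      then obtain b where b: "(a, b) \<in> R" "h b < h a" "tracks N (insert (b, a) (R - {(a, b)})) h ?\<tau>" by auto
      have e: "ar ?\<upsilon> = ar ?\<tau>" using run_raise_height_done p by blast
      then have r': "run N relieve \<sigma> = ?\<upsilon>" using r p by simp
      have "tracks N (insert (b, a) (R - {(a, b)})) h ?\<upsilon>" using b(3) e tracks_cong by metis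
      then show ?thesis using push[OF v True b(1,2)] B F fr True unfolding r'
        by (intro exI[of _ "insert (b, a) (R - {(a, b)})"] exI[of _ h]) (simp add: simulates_def)
    next
      assume p: "ar ?\<tau> aDONE [] = 0 \<and> tracks N R h ?\<tau> \<and> (\<forall>b. (a, b) \<in> R \<longrightarrow> h a \<le> h b)"
      have "(ar ?\<upsilon> aDONE [] = 0 \<and> tracks N R h ?\<upsilon> \<and> h a = N) \<or>
        (ar ?\<upsilon> aDONE [] = 1 \<and> tracks N R (h(a := Suc (h a))) ?\<upsilon> \<and> h a < N)"
        by (rule run_raise_height) (use p fr a hN in auto)
      then show ?thesis
      proof
        assume q: "ar ?\<upsilon> aDONE [] = 0 \<and> tracks N R h ?\<upsilon> \<and> h a = N"
        then have r': "run N relieve \<sigma> = seta aFAIL [] 1 ?\<upsilon>" using r by simp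
        have "\<exists>W. obstruction W" using stuck[OF v True] a q by auto
        then show ?thesis using q v B fr True unfolding r'
          by (intro exI[of _ R] exI[of _ h]) (simp add: simulates_def)
      next
        assume q: "ar ?\<upsilon> aDONE [] = 1 \<and> tracks N R (h(a := Suc (h a))) ?\<upsilon> \<and> h a < N"
        then have r': "run N relieve \<sigma> = ?\<upsilon>" using r by simp
        have "valid R (h(a := Suc (h a)))" "potential R (h(a := Suc (h a))) > potential R h"
          using relabel[OF v True] a q p by auto
        then show ?thesis using q B F fr True unfolding r'
          by (intro exI[of _ R] exI[of _ "h(a := Suc (h a))"]) (simp add: simulates_def)
      qed
    qed
  qed
qed

text \<open>After \<open>r\<close> rounds, the outcome is decided or the potential has reached
  \<open>r\<close>.\<close>

definition progress :: "nat \<Rightarrow> st \<Rightarrow> bool" where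
  "progress r \<tau> \<longleftrightarrow> (\<exists>R h. simulates \<tau> R h \<and>
     (ar \<tau> aFAIL [] = 1 \<or> (\<forall>a<N. \<not> excess R a) \<or> potential R h \<ge> int r))"

lemma progress_setv [simp]: "progress r (setv x n \<tau>) = progress r \<tau>"
  by (simp add: progress_def)

text \<open>A round either makes a move, which increases the potential, or finds no overloaded node while
  the state stays the same for the whole round, so that no node is overloaded.\<close>

lemma run_round:
  assumes "progress r \<sigma>"
  shows "progress (Suc r) (run N round \<sigma>)"
proof -
  define I where "I i \<tau> \<longleftrightarrow> (\<exists>R h. simulates \<tau> R h \<and>
     (ar \<tau> aFAIL [] = 1 \<or> (\<forall>a<N. \<not> excess R a) \<or> potential R h \<ge> int (Suc r) \<or>
       potential R h \<ge> int r \<and> (\<forall>a<i. \<not> excess R a)))" for i \<tau>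
  have "progress (Suc r) (run N (For vI relieve) \<sigma>)"
  proof (rule For_rule[where I = I])
    show "I 0 \<sigma>" using assms by (auto simp: progress_def I_def)
  next
    fix i \<tau> assume i: "i < N" "I i \<tau>"
    then obtain R h where R: "simulates \<tau> R h"
      "ar \<tau> aFAIL [] = 1 \<or> (\<forall>a<N. \<not> excess R a) \<or> potential R h \<ge> int (Suc r) \<or>
       potential R h \<ge> int r \<and> (\<forall>a<i. \<not> excess R a)" unfolding I_def by blast
    let ?\<tau> = "run N relieve (setv vI i \<tau>)"
    obtain R' h' where R': "simulates ?\<tau> R' h'" "ar \<tau> aFAIL [] = 1 \<longrightarrow> ar ?\<tau> aFAIL [] = 1"
      "if excess R i then potential R' h' > potential R h \<or> ar ?\<tau> aFAIL [] = 1 else R' = R \<and> h' = h"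
      using run_relieve[of "setv vI i \<tau>" R h i] R(1) i(1) by auto
    have "ar ?\<tau> aFAIL [] = 1 \<or> (\<forall>a<N. \<not> excess R' a) \<or> potential R' h' \<ge> int (Suc r) \<or>
       potential R' h' \<ge> int r \<and> (\<forall>a<Suc i. \<not> excess R' a)"
    proof (cases "ar ?\<tau> aFAIL [] = 1")
      case False
      then have R'': "ar \<tau> aFAIL [] \<noteq> 1"
        "if excess R i then potential R' h' > potential R h else R' = R \<and> h' = h"
        using R' by auto
      show ?thesis
      proof (cases "excess R i")
        case True
        then have "potential R' h' > potential R h" using R''(2) by simp
        then show ?thesis using True i(1) R(2) R''(1) by auto
      next
        case False
        then show ?thesis using R(2) R'' by (auto simp: less_Suc_eq)
      qed
    qed simp
    then show "I (Suc i) ?\<tau>" using R'(1) unfolding I_def by blast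
  next
    fix \<tau> assume "I N \<tau>"
    then show "progress (Suc r) (setv vI 0 \<tau>)" unfolding I_def progress_def by auto
  qed
  then show ?thesis by (simp add: round_def)
qed

lemma run_rounds:
  assumes "progress 0 \<sigma>"
  shows "progress (N * (N * (N * 3))) (run N rounds \<sigma>)"
proof -
  have nest: "progress (r + N * k) (run N (For x c) \<sigma>)"
    if c: "\<And>r \<sigma>. progress r \<sigma> \<Longrightarrow> progress (r + k) (run N c \<sigma>)" and p: "progress r \<sigma>" for r k x c \<sigma>
  proof (rule For_rule[where I = "\<lambda>i. progress (r + i * k)"])
    fix i \<tau> assume "progress (r + i * k) \<tau>"
    then show "progress (r + Suc i * k) (run N c (setv x i \<tau>))"
      using c[of "r + i * k" "setv x i \<tau>"] by (simp add: algebra_simps)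
  qed (use p in simp_all)
  have "progress (r + 3) (run N (Seq round (Seq round round)) \<sigma>)" if "progress r \<sigma>" for r \<sigma>
    using run_round[OF run_round[OF run_round[OF that]]] by (simp add: numeral_3_eq_3)
  then have "progress (r + N * 3) (run N (For vV (Seq round (Seq round round))) \<sigma>)" if "progress r \<sigma>" for r \<sigma>
    using nest[of 3] that by blast
  then have "progress (r + N * (N * 3)) (run N (For vE (For vV (Seq round (Seq round round)))) \<sigma>)" if "progress r \<sigma>" for r \<sigma>
    using nest[of "N * 3"] that by blast
  then have "progress (0 + N * (N * (N * 3))) (run N rounds \<sigma>)"
    unfolding rounds_def using nest[of "N * (N * 3)"] assms by blast
  then show ?thesis by simp
qed

lemma rounds_result:
  assumes "progress 0 \<sigma>" "N > 0"
  shows "\<exists>R h. simulates (run N rounds \<sigma>) R h \<and>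
     (ar (run N rounds \<sigma>) aFAIL [] = 1 \<or> (\<forall>a<N. \<not> excess R a))"
proof -
  obtain R h where R: "simulates (run N rounds \<sigma>) R h"
     "ar (run N rounds \<sigma>) aFAIL [] = 1 \<or> (\<forall>a<N. \<not> excess R a) \<or> potential R h \<ge> int (N * (N * (N * 3)))"
    using run_rounds[OF assms(1)] unfolding progress_def by blast
  have "potential R h \<le> int (2 * N ^ 3)" using R(1) potential_le by (simp add: simulates_def)
  also have "2 * N ^ 3 < N * (N * (N * 3))" using assms(2) by (simp add: power3_eq_cube)
  finally show ?thesis using R by (metis not_le of_nat_less_iff)
qed

end

section \<open>Writing the answer\<close>

fun inc_bits :: "nat list \<Rightarrow> nat list" where
  "inc_bits [] = [2]"
| "inc_bits (b # bs) = (if b = 1 then 2 # bs else 1 # inc_bits bs)"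

lemma inc_bits_binary: "inc_bits (binary n) = binary (Suc n)"
proof (induction n rule: binary.induct)
  case (1 n)
  show ?case
  proof (cases "n = 0")
    case True
    then show ?thesis by (simp add: binary.simps)
  next
    case False
    then show ?thesis using 1
      by (cases "even n") (simp_all add: binary.simps[of n] binary.simps[of "Suc n"] even_iff_mod_2_eq_zero mod_Suc div_Suc odd_iff_mod_2_eq_one)
  qed
qed

lemma length_binary: "length (binary n) \<le> n"
proof (induction n rule: binary.induct)
  case (1 n)
  show ?case
  proof (cases "n = 0")
    case False
    then show ?thesis using 1 by (subst binary.simps) auto
  qed (simp add: binary.simps)
qed

text \<open>Adds \<open>1\<close> to the number in \<open>aBIN\<close>, with blanks beyond its last bit.\<close>

definition inc_bin :: com where
  "inc_bin = Seq (Write aCARRY [] 1) (For vK (IfA aCARRY [] 1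
     (IfA aBIN [vK] 1 (Seq (Write aBIN [vK] 2) (Write aCARRY [] 0))
       (IfA aBIN [vK] 2 (Write aBIN [vK] 1) (Seq (Write aBIN [vK] 2) (Write aCARRY [] 0)))) Skip))"

text \<open>Binary notation is obtained by counting up from \<open>0\<close>.\<close>

definition emit_num :: "nat \<Rightarrow> com" where
  "emit_num x = Seq (For vK (Write aBIN [vK] 0)) (Seq (for_below vT x inc_bin)
     (Seq (For vK (IfA aBIN [vK] 1 (Emit 1) (IfA aBIN [vK] 2 (Emit 2) Skip))) (Emit 3)))"

lemma emit_simps [simp]: "assigned inc_bin = {vK}" "written inc_bin = {aCARRY, aBIN}" "\<not> emits inc_bin"
  "assigned (emit_num x) = {vK, vT}" "written (emit_num x) = {aPASS, aCARRY, aBIN}" "emits (emit_num x)"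
  by (auto simp: inc_bin_def emit_num_def)

definition bits :: "nat \<Rightarrow> nat list \<Rightarrow> st \<Rightarrow> bool" where
  "bits N bs \<tau> \<longleftrightarrow> (\<forall>p<N. ar \<tau> aBIN [p] = (if p < length bs then bs ! p else 0))"

lemma bits_setv [simp]: "bits N bs (setv x n \<tau>) = bits N bs \<tau>"
  "a \<noteq> aBIN \<Longrightarrow> bits N bs (seta a ys s \<tau>) = bits N bs \<tau>"
  by (simp_all add: bits_def)

text \<open>As long as there is a carry, the cells passed so far have been turned from \<open>2\<close> into
  \<open>1\<close>.\<close>

lemma run_inc_bin:
  assumes b: "bits N bs \<sigma>" and bs: "set bs \<subseteq> {1, 2}" and len: "length (inc_bits bs) \<le> N"
  shows "bits N (inc_bits bs) (run N inc_bin \<sigma>)"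
proof -
  let ?c = "IfA aCARRY [] 1
     (IfA aBIN [vK] 1 (Seq (Write aBIN [vK] 2) (Write aCARRY [] 0))
       (IfA aBIN [vK] 2 (Write aBIN [vK] 1) (Seq (Write aBIN [vK] 2) (Write aCARRY [] 0)))) Skip"
  define I where "I k \<tau> \<longleftrightarrow> (ar \<tau> aCARRY [] = 0 \<and> bits N (inc_bits bs) \<tau>) \<or>
     (ar \<tau> aCARRY [] = 1 \<and> k \<le> length bs \<and> inc_bits bs = replicate k 1 @ inc_bits (drop k bs) \<and>
       bits N (replicate k 1 @ drop k bs) \<tau>)" for k \<tau>
  have "bits N (inc_bits bs) (run N (For vK ?c) (seta aCARRY [] 1 \<sigma>))"
  proof (rule For_rule[where I = I])
    show "I 0 (seta aCARRY [] 1 \<sigma>)" using b by (simp add: I_def)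
  next
    fix k \<tau> assume k: "k < N" "I k \<tau>"
    show "I (Suc k) (run N ?c (setv vK k \<tau>))"
    proof (cases "ar \<tau> aCARRY [] = 1")
      case False
      then show ?thesis using k(2) by (auto simp: I_def)
    next
      case True
      then have I: "k \<le> length bs" "inc_bits bs = replicate k 1 @ inc_bits (drop k bs)"
        "bits N (replicate k 1 @ drop k bs) \<tau>" using k(2) by (auto simp: I_def)
      have cell: "ar \<tau> aBIN [k] = (if k < length bs then bs ! k else 0)"
        using I(1,3) k(1) by (simp add: bits_def nth_append)
      show ?thesis
      proof (cases "k < length bs")
        case F: False
        then have "k = length bs" using I(1) by simp
        then have "bits N (inc_bits bs) (seta aBIN [k] 2 \<tau>)"
          using I by (auto simp: bits_def nth_append)
        then show ?thesis using True cell F by (simp add: I_def bits_def)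
      next
        case T: True
        then have d: "drop k bs = bs ! k # drop (Suc k) bs" by (simp add: Cons_nth_drop_Suc)
        have "bs ! k \<in> {1, 2}" using bs T by (auto dest: nth_mem)
        then consider "bs ! k = 1" | "bs ! k = 2" by auto
        then show ?thesis
        proof cases
          case 1
          then have "inc_bits bs = replicate k 1 @ 2 # drop (Suc k) bs" using I(2) d by simp
          moreover have "bits N (replicate k 1 @ 2 # drop (Suc k) bs) (seta aBIN [k] 2 \<tau>)"
            using I(3) d T by (auto simp: bits_def nth_append nth_Cons split: nat.splits)
          ultimately show ?thesis using True cell T 1 by (simp add: I_def bits_def)
        next
          case 2
          have "inc_bits bs = replicate (Suc k) 1 @ inc_bits (drop (Suc k) bs)"
            using I(2) d 2 by (simp add: replicate_append_same flip: replicate_Suc)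
          moreover have "bits N (replicate (Suc k) 1 @ drop (Suc k) bs) (seta aBIN [k] 1 \<tau>)"
            unfolding bits_def
          proof (intro allI impI)
            fix p assume p: "p < N"
            have nth: "(replicate j 1 @ drop j bs) ! p = (if p < j then 1 else bs ! p)" if "j \<le> length bs" for j
              using that by (simp add: nth_append)
            have "ar \<tau> aBIN [p] = (if p < length bs then if p < k then 1 else bs ! p else 0)"
              using I(3) T p nth[of k] by (simp add: bits_def)
            then show "ar (seta aBIN [k] 1 \<tau>) aBIN [p] =
              (if p < length (replicate (Suc k) 1 @ drop (Suc k) bs) then (replicate (Suc k) 1 @ drop (Suc k) bs) ! p else 0)"
              using T nth[of "Suc k"] by (simp del: replicate.simps) auto
          qed
          ultimately show ?thesis using True cell T 2 by (simp add: I_def bits_def)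
        qed
      qed
    qed
  next
    fix \<tau> assume I: "I N \<tau>"
    have "length (inc_bits cs) > 0" for cs by (cases cs) auto
    then have "inc_bits bs \<noteq> replicate N 1 @ inc_bits (drop N bs)"
      using len by (metis add_leD1 length_append length_replicate less_add_same_cancel1 not_le)
    then show "bits N (inc_bits bs) (setv vK 0 \<tau>)" using I by (auto simp: I_def)
  qed
  then show ?thesis by (simp add: inc_bin_def del: run.simps(8))
qed

lemma For_emit:
  assumes "\<And>i \<tau>. i < N \<Longrightarrow> agrees (For x c) \<sigma> \<tau> \<Longrightarrow> ot (run N c (setv x i \<tau>)) = ot \<tau> @ g i"
  shows "ot (run N (For x c) \<sigma>) = ot \<sigma> @ concat (map g [0..<N])"
  by (rule For_rule[where I = "\<lambda>i \<tau>. ot \<tau> = ot \<sigma> @ concat (map g [0..<i])"]) (use assms in auto)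

lemma run_emit_num:
  assumes x: "vr \<sigma> x < N" "x \<noteq> vK" "x \<noteq> vT"
  shows "ot (run N (emit_num x) \<sigma>) = ot \<sigma> @ binary (vr \<sigma> x) @ [3]"
proof -
  let ?w = "For vK (Write aBIN [vK] 0)"
  let ?c = "IfA aBIN [vK] 1 (Emit 1) (IfA aBIN [vK] 2 (Emit 2) Skip)"
  let ?\<sigma>1 = "run N ?w \<sigma>" and ?b = "binary (vr \<sigma> x)"
  have "\<forall>p<N. ar ?\<sigma>1 aBIN [p] = 0"
    by (rule For_rule[where I = "\<lambda>i \<tau>. \<forall>p<i. ar \<tau> aBIN [p] = 0" and Q = "\<lambda>\<tau>. \<forall>p<N. ar \<tau> aBIN [p] = 0"])
      (auto simp: less_Suc_eq)
  then have b0: "bits N (binary 0) ?\<sigma>1" by (simp add: bits_def binary.simps)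
  have "i \<le> vr \<sigma> x \<longrightarrow> bits N (binary i) (iter i (\<lambda>i \<tau>. run N inc_bin (setv vT i \<tau>)) (seta aPASS [] 0 ?\<sigma>1))" for i
  proof (induction i)
    case (Suc i)
    show ?case
    proof
      assume i: "Suc i \<le> vr \<sigma> x"
      have "length (inc_bits (binary i)) \<le> N"
        using length_binary[of "Suc i"] i x(1) by (simp add: inc_bits_binary)
      then show "bits N (binary (Suc i)) (iter (Suc i) (\<lambda>i \<tau>. run N inc_bin (setv vT i \<tau>)) (seta aPASS [] 0 ?\<sigma>1))"
        using Suc i set_binary by (simp add: run_inc_bin flip: inc_bits_binary)
    qed
  qed (use b0 in simp)
  moreover have v: "vr ?\<sigma>1 x = vr \<sigma> x" using x by (simp del: run.simps)
  ultimately have "bits N ?b (run N (for_below vT x inc_bin) ?\<sigma>1)"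
    using x by (subst run_for_below) (simp_all del: run.simps)
  moreover have len: "length ?b \<le> N" using length_binary[of "vr \<sigma> x"] x(1) by simp
  let ?\<sigma>2 = "run N (for_below vT x inc_bin) ?\<sigma>1"
  have "ot (run N (For vK ?c) ?\<sigma>2) = ot ?\<sigma>2 @ concat (map (\<lambda>p. if p < length ?b then [?b ! p] else []) [0..<N])"
  proof (rule For_emit)
    fix p \<tau> assume p: "p < N" "agrees (For vK ?c) ?\<sigma>2 \<tau>"
    have "ar \<tau> aBIN = ar ?\<sigma>2 aBIN" using agreesD(2)[OF p(2), of aBIN] by simp
    then have "ar \<tau> aBIN [p] = (if p < length ?b then ?b ! p else 0)" using calculation p(1) by (simp add: bits_def)
    moreover have "p < length ?b \<Longrightarrow> ?b ! p \<in> {1, 2}" using set_binary by (meson nth_mem subsetD)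
    ultimately show "ot (run N ?c (setv vK p \<tau>)) = ot \<tau> @ (if p < length ?b then [?b ! p] else [])"
      by auto
  qed
  moreover have "concat (map (\<lambda>p. if p < length ?b then [?b ! p] else []) [0..<N]) = ?b"
  proof -
    have "[0..<N] = [0..<length ?b] @ [length ?b..<N]" using len by (metis upt_add_eq_append le0 le_add_diff_inverse)
    moreover have "concat (map (\<lambda>p. if p < length ?b then [?b ! p] else []) [0..<length ?b]) = map ((!) ?b) [0..<length ?b]"
      by (subst concat_map_singleton[symmetric]) (intro arg_cong[where f = concat] map_cong, auto)
    moreover have "concat (map (\<lambda>p. if p < length ?b then [?b ! p] else []) [length ?b..<N]) = []" by simp
    ultimately show ?thesis by (simp add: map_nth)
  qed
  moreover have "ot ?\<sigma>2 = ot \<sigma>" by (simp del: run.simps)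
  ultimately show ?thesis by (simp add: emit_num_def del: run.simps(8))
qed

definition leaf_list :: "nat \<Rightarrow> st \<Rightarrow> nat \<Rightarrow> nat \<Rightarrow> nat list" where
  "leaf_list N \<sigma> i v = concat (map (\<lambda>j. if ar \<sigma> aOWN [j, i] = 1 then
     filter (\<lambda>u. ar \<sigma> aEND [j, u] = 1 \<and> u \<noteq> v) [0..<N] else []) [0..<N])"

definition emit_leaves :: com where
  "emit_leaves = For vJ (IfA aOWN [vJ, vI] 1 (For vU (IfA aEND [vJ, vU] 1 (IfEq vU vV Skip (emit_num vU)) Skip)) Skip)"

definition emit_stars :: com where
  "emit_stars = For vI (For vV (IfA aCTR [vI, vV] 1 (Seq (emit_num vV) (Seq emit_leaves (Emit 4))) Skip))"

lemma emit_leaves_simps [simp]: "assigned emit_leaves = {vJ, vU, vK, vT}" "written emit_leaves = {aPASS, aCARRY, aBIN}" "emits emit_leaves"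
  "assigned emit_stars = {vI, vV, vJ, vU, vK, vT}" "written emit_stars = {aPASS, aCARRY, aBIN}" "emits emit_stars"
  by (auto simp: emit_leaves_def emit_stars_def)

lemma concat_map_if: "concat (map (\<lambda>u. if P u then [f u] else []) xs) = map f (filter P xs)"
  by (induction xs) auto

lemma run_emit_leaves:
  "ot (run N emit_leaves \<sigma>) = ot \<sigma> @ concat (map (\<lambda>x. binary x @ [3]) (leaf_list N \<sigma> (vr \<sigma> vI) (vr \<sigma> vV)))"
proof -
  let ?g = "\<lambda>x. binary x @ [3]"
  define c1 where "c1 = IfA aEND [vJ, vU] 1 (IfEq vU vV Skip (emit_num vU)) Skip"
  have c1 [simp]: "assigned c1 = {vK, vT}" "written c1 = {aPASS, aCARRY, aBIN}" by (auto simp: c1_def)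
  have 1: "ot (run N (For vU c1) \<tau>) = ot \<tau> @ concat (map (\<lambda>u. if ar \<tau> aEND [vr \<tau> vJ, u] = 1 \<and> u \<noteq> vr \<tau> vV
     then ?g u else []) [0..<N])" for \<tau>
  proof (rule For_emit)
    fix u \<upsilon> assume u: "u < N" "agrees (For vU c1) \<tau> \<upsilon>"
    have "vr \<upsilon> vJ = vr \<tau> vJ" "vr \<upsilon> vV = vr \<tau> vV" "ar \<upsilon> aEND = ar \<tau> aEND" using agreesD(1,2)[OF u(2)] by auto
    then show "ot (run N c1 (setv vU u \<upsilon>)) = ot \<upsilon> @ (if ar \<tau> aEND [vr \<tau> vJ, u] = 1 \<and> u \<noteq> vr \<tau> vV then ?g u else [])"
      using u(1) by (auto simp: c1_def run_emit_num)
  qed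
  define c2 where "c2 = IfA aOWN [vJ, vI] 1 (For vU c1) Skip"
  have c2 [simp]: "assigned c2 = {vU, vK, vT}" "written c2 = {aPASS, aCARRY, aBIN}" by (auto simp: c2_def)
  have 2: "ot (run N (For vJ c2) \<sigma>) = ot \<sigma> @ concat (map (\<lambda>j. if ar \<sigma> aOWN [j, vr \<sigma> vI] = 1 then
     concat (map (\<lambda>u. if ar \<sigma> aEND [j, u] = 1 \<and> u \<noteq> vr \<sigma> vV then ?g u else []) [0..<N]) else []) [0..<N])"
  proof (rule For_emit)
    fix j \<tau> assume j: "j < N" "agrees (For vJ c2) \<sigma> \<tau>"
    have "vr \<tau> vI = vr \<sigma> vI" "vr \<tau> vV = vr \<sigma> vV" "ar \<tau> aEND = ar \<sigma> aEND" "ar \<tau> aOWN = ar \<sigma> aOWN"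
      using agreesD(1,2)[OF j(2)] by auto
    then show "ot (run N c2 (setv vJ j \<tau>)) = ot \<tau> @ (if ar \<sigma> aOWN [j, vr \<sigma> vI] = 1 then
     concat (map (\<lambda>u. if ar \<sigma> aEND [j, u] = 1 \<and> u \<noteq> vr \<sigma> vV then ?g u else []) [0..<N]) else [])"
      using 1[of "setv vJ j \<tau>"] by (simp add: c2_def del: run.simps(8))
  qed
  have 3: "concat (map (\<lambda>u. if P u then ?g u else []) xs) = concat (map ?g (filter P xs))" for P xs
    by (induction xs) auto
  have 4: "concat (map (\<lambda>j. if Q j then concat (map ?g (h j)) else []) xs) =
     concat (map ?g (concat (map (\<lambda>j. if Q j then h j else []) xs)))" for Q h xs
    by (induction xs) auto
  show ?thesis using 2 unfolding 3 4 by (simp add: emit_leaves_def c1_def c2_def leaf_list_def del: run.simps)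
qed

lemma leaf_list_cong: "ar \<tau> aOWN = ar \<sigma> aOWN \<Longrightarrow> ar \<tau> aEND = ar \<sigma> aEND \<Longrightarrow> leaf_list N \<tau> = leaf_list N \<sigma>"
  by (intro ext) (simp add: leaf_list_def cong: if_cong)

lemma encode_lists_append: "encode_lists (xss @ yss) = encode_lists xss @ encode_lists yss"
  by (simp add: encode_lists_def)

lemma encode_lists_Cons: "encode_lists (xs # xss) = concat (map (\<lambda>x. binary x @ [3]) xs) @ 4 # encode_lists xss"
  by (simp add: encode_lists_def)

lemma concat_encode_lists: "concat (map (\<lambda>i. encode_lists (f i)) xs) = encode_lists (concat (map f xs))"
  by (induction xs) (auto simp: encode_lists_append, simp add: encode_lists_def)

lemma run_emit_stars:
  "ot (run N emit_stars \<sigma>) = ot \<sigma> @ encode_lists (concat (map (\<lambda>i. concat (map (\<lambda>v.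
     if ar \<sigma> aCTR [i, v] = 1 then [v # leaf_list N \<sigma> i v] else []) [0..<N])) [0..<N]))"
proof -
  define c1 where "c1 = IfA aCTR [vI, vV] 1 (Seq (emit_num vV) (Seq emit_leaves (Emit 4))) Skip"
  have c1 [simp]: "assigned c1 = {vJ, vU, vK, vT}" "written c1 = {aPASS, aCARRY, aBIN}" by (auto simp: c1_def)
  let ?l = "\<lambda>\<tau> i v. if ar \<tau> aCTR [i, v] = 1 then [v # leaf_list N \<tau> i v] else []"
  have 1: "ot (run N (For vV c1) \<tau>) = ot \<tau> @ concat (map (\<lambda>v. encode_lists (?l \<tau> (vr \<tau> vI) v)) [0..<N])" for \<tau>
  proof (rule For_emit)
    fix v \<upsilon> assume v: "v < N" "agrees (For vV c1) \<tau> \<upsilon>"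
    have e: "vr \<upsilon> vI = vr \<tau> vI" "ar \<upsilon> aCTR = ar \<tau> aCTR" "ar \<upsilon> aOWN = ar \<tau> aOWN" "ar \<upsilon> aEND = ar \<tau> aEND"
      using agreesD(1,2)[OF v(2)] by auto
    let ?\<upsilon> = "setv vV v \<upsilon>"
    let ?\<omega> = "run N (emit_num vV) ?\<upsilon>"
    have "ot ?\<omega> = ot \<upsilon> @ binary v @ [3]" using run_emit_num[of ?\<upsilon> vV N] v(1) by simp
    moreover have "leaf_list N ?\<omega> = leaf_list N \<tau>" using e by (intro leaf_list_cong) simp_all
    ultimately show "ot (run N c1 ?\<upsilon>) = ot \<upsilon> @ encode_lists (?l \<tau> (vr \<tau> vI) v)"
      using e run_emit_leaves[of N ?\<omega>] by (simp add: c1_def encode_lists_def)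
  qed
  have 2: "ot (run N (For vI (For vV c1)) \<sigma>) = ot \<sigma> @ concat (map (\<lambda>i. concat (map (\<lambda>v. encode_lists (?l \<sigma> i v)) [0..<N])) [0..<N])"
  proof (rule For_emit)
    fix i \<tau> assume i: "i < N" "agrees (For vI (For vV c1)) \<sigma> \<tau>"
    have e: "ar \<tau> aCTR = ar \<sigma> aCTR" "ar \<tau> aOWN = ar \<sigma> aOWN" "ar \<tau> aEND = ar \<sigma> aEND"
      using agreesD(2)[OF i(2)] by auto
    then have l: "leaf_list N (setv vI i \<tau>) = leaf_list N \<sigma>" by (intro leaf_list_cong) simp_all
    have v: "vr (setv vI i \<tau>) vI = i" by simp
    show "ot (run N (For vV c1) (setv vI i \<tau>)) = ot \<tau> @ concat (map (\<lambda>v. encode_lists (?l \<sigma> i v)) [0..<N])"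
      using 1[of "setv vI i \<tau>", unfolded v l] e by (simp del: run.simps)
  qed
  then show ?thesis by (simp only: emit_stars_def c1_def concat_encode_lists)
qed

section \<open>Correctness of the algorithm\<close>

lemma entries_bounds:
  "x \<in> set (entries l xss) \<Longrightarrow> l \<le> fst x \<and> fst x < l + length xss \<and> snd x \<in> set (xss ! (fst x - l))"
proof (induction xss arbitrary: l)
  case (Cons xs xss)
  then consider "x \<in> Pair l ` set xs" | "x \<in> set (entries (Suc l) xss)" by auto
  then show ?case
  proof cases
    case 2
    then show ?thesis using Cons.IH[OF 2] by (auto simp: nth_Cons' Suc_le_eq)
  qed auto
qed simp

lemma entries_filter:
  "v < length xss \<Longrightarrow> map snd (filter (\<lambda>x. fst x = l + v) (entries l xss)) = xss ! v"
proof (induction xss arbitrary: l v)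
  case (Cons xs xss)
  have none: "filter (\<lambda>x. fst x = l) (entries (Suc l) xss) = []"
    using entries_bounds by (fastforce simp: filter_empty_conv)
  show ?case
  proof (cases v)
    case 0
    then show ?thesis using none by (simp add: filter_map comp_def)
  next
    case (Suc v')
    then show ?thesis using Cons.IH[of v' "Suc l"] Cons.prems by (simp add: filter_map comp_def)
  qed
qed simp

lemma image_mset_indices:
  "image_mset (\<lambda>a. f (xs ! a)) (mset_set {a. a < length xs \<and> Q (xs ! a)}) = mset (map f (filter Q xs))"
proof -
  have "mset xs = mset (map ((!) xs) [0..<length xs])" by (simp only: map_nth)
  also have "\<dots> = image_mset ((!) xs) (mset_set {..<length xs})" by (simp add: lessThan_atLeast0)
  finally have "filter_mset Q (mset xs) = image_mset ((!) xs) (filter_mset (\<lambda>a. Q (xs ! a)) (mset_set {..<length xs}))"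
    by (simp add: filter_mset_image_mset)
  also have "filter_mset (\<lambda>a. Q (xs ! a)) (mset_set {..<length xs}) = mset_set {a. a < length xs \<and> Q (xs ! a)}"
    by (simp add: filter_mset_mset_set)
  finally show ?thesis by (simp add: image_mset.compositionality comp_def)
qed

definition pair_list :: "nat \<Rightarrow> (nat \<times> nat) list" where
  "pair_list n = concat (map (row n) [0..<n])"

lemma distinct_concat_upt:
  assumes "\<And>j. distinct (f j)" "\<And>j k. j \<noteq> k \<Longrightarrow> set (f j) \<inter> set (f k) = {}"
  shows "distinct (concat (map f [0..<N]))"
proof (induction N)
  case (Suc N)
  have "\<forall>j<N. set (f j) \<inter> set (f N) = {}"
  proof (intro allI impI)
    fix j assume "j < N"
    then show "set (f j) \<inter> set (f N) = {}" by (intro assms(2)) simp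
  qed
  then have "(\<Union>j<N. set (f j)) \<inter> set (f N) = {}" by blast
  then show ?case using Suc assms(1) by (simp add: lessThan_atLeast0)
qed simp

lemma distinct_pair_list: "distinct (pair_list n)"
  unfolding pair_list_def
  by (rule distinct_concat_upt) (auto simp: row_def distinct_map inj_on_def)

lemma set_pair_list: "set (pair_list n) = {(u, v). u < v \<and> v < n}"
  by (auto simp: pair_list_def row_def image_iff)

lemma bij_pair_list:
  "bij_betw (\<lambda>j. {fst (pair_list n ! j), snd (pair_list n ! j)}) {..<length (pair_list n)} (pairs {..<n})"
proof -
  have "bij_betw (\<lambda>x. {fst x, snd x}) {(u, v). u < v \<and> v < n} (pairs {..<n})"
    unfolding bij_betw_def
  proof
    show "inj_on (\<lambda>x. {fst x, snd x}) {(u, v). u < v \<and> v < n}"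
      by (auto simp: inj_on_def doubleton_eq_iff)
    show "(\<lambda>x. {fst x, snd x}) ` {(u, v). u < v \<and> v < n} = pairs {..<n}"
    proof
      show "pairs {..<n} \<subseteq> (\<lambda>x. {fst x, snd x}) ` {(u, v). u < v \<and> v < n}"
      proof
        fix e assume "e \<in> pairs {..<n}"
        then obtain u v where uv: "e = {u, v}" "u < n" "v < n" "u \<noteq> v" by (auto simp: pairs_def)
        show "e \<in> (\<lambda>x. {fst x, snd x}) ` {(u, v). u < v \<and> v < n}"
        proof (cases "u < v")
          case True
          then show ?thesis using uv by (intro image_eqI[of _ _ "(u, v)"]) auto
        next
          case False
          then show ?thesis using uv by (intro image_eqI[of _ _ "(v, u)"]) auto
        qed
      qed
    qed (auto simp: doubleton_in_pairs)
  qed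
  moreover have "bij_betw ((!) (pair_list n)) {..<length (pair_list n)} {(u, v). u < v \<and> v < n}"
    using bij_betw_nth[OF distinct_pair_list refl refl] set_pair_list by simp
  ultimately show ?thesis using bij_betw_trans by (fastforce simp: comp_def)
qed

lemma multiplicities_pair_list:
  "[mult G u v. u \<leftarrow> [0..<n], v \<leftarrow> [Suc u..<n]] = map (\<lambda>x. mult G (fst x) (snd x)) (pair_list n)"
  by (simp add: pair_list_def row_def map_concat comp_def)

lemma set_encode_lists: "set (encode_lists xss) \<subseteq> {1, 2, 3, 4}"
proof -
  have "x = 1 \<or> x = 2" if "x \<in> set (binary k)" for x k using set_binary that by blast
  then show ?thesis by (auto simp: encode_lists_def)
qed

lemma count_list_3_4: "count_list w 3 + count_list w (4::nat) \<le> length w"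
  by (induction w) auto

lemma filter_upt_eq: "x < N \<Longrightarrow> filter (\<lambda>v. v = x) [0..<N] = [x]"
proof (induction N)
  case (Suc N)
  then show ?case by (cases "x = N") (auto simp: filter_empty_conv)
qed simp

definition solve :: com where
  "solve = Seq prescan (Seq scan (Seq ends (Seq own (Seq rounds
     (IfA aFAIL [] 1 (Emit 1) (Seq (Emit 2) emit_stars))))))"

lemma well_formed_solve: "well_formed 14 arity solve"
  by (simp add: solve_def prescan_def scan_def scan_body_def double_def add_def pair_entry_def star_entry_def
    ends_def ends_row_def note_pair_def own_def rounds_def round_def relieve_def count_own_def push_edge_def
    raise_height_def emit_stars_def emit_leaves_def emit_num_def inc_bin_def for_below_def clear_def arity_def)

text \<open>The nodes are the numbers below \<open>N\<close>. Among them are the entries of the input, and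
  the others have no edges and an unreachable capacity. The program has computed their incidences and
  capacities and then simulates the push-relabel procedure. If it reports failure there is an obstruction,
  so \<open>hall\<close> is violated. Otherwise no node is overloaded, and the edges that are not owned by
  their stars give the leaves.\<close>

theorem solve_correct:
  assumes inst: "(G, Ms) \<in> instances"
  defines "w \<equiv> encode_instance (G, Ms)"
  shows "correct_answer (G, Ms) (ot (run (length w) solve (init_st w)))"
proof -
  define n where "n = length Ms"
  define N where "N = length w"
  define mus where "mus = [mult G u v. u \<leftarrow> [0..<n], v \<leftarrow> [Suc u..<n]]"
  \<comment> \<open>List \<open>0\<close> holds the multiplicities, list \<open>v + 1\<close> the sizes at \<open>v\<close>.\<close>
  define es where "es = entries 0 (mus # Ms)"
  define pl where "pl = pair_list n"
  have mg: "multigraph G" and V: "verts G = {..<n}" and pos: "\<forall>ms \<in> set Ms. \<forall>m \<in> set ms. m > 0"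
    using inst by (auto simp: instances_def n_def)
  have w: "w = encode_lists (mus # Ms)" by (simp add: w_def mus_def n_def)
  have cnt: "length es = count_list w 3" "Suc n = count_list w 4"
    using scanned_counts[of w "Suc n" "[]" es] scanned_encode[of "mus # Ms"] by (simp_all add: w es_def n_def)
  have len: "length es + Suc n \<le> N" using count_list_3_4[of w] cnt by (simp add: N_def)
  then have N0: "N > 0" "n \<le> N" "n < N" "length es < N" by auto
  have sw: "set w \<subseteq> {1, 2, 3, 4}" unfolding w by (rule set_encode_lists)

  define s1 where "s1 = run N prescan (init_st w)"
  define s2 where "s2 = run N scan s1"
  define s3 where "s3 = run N ends s2"
  define s4 where "s4 = run N own s3"
  define s5 where "s5 = run N rounds s4"
  have IN: "ar (init_st w) aIN [p] = w ! p" if "p < N" for p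
    using that by (simp add: init_st_def word_cells_def N_def)
  have i0: "vr (init_st w) x = 0" "a \<noteq> aIN \<Longrightarrow> ar (init_st w) a ys = 0" "ot (init_st w) = []" for x a ys
    by (simp_all add: init_st_def)
  have s1: "vr s1 vV = 0" "ar s1 aSND [] = 0" "ar s1 aVERT [z] = (if z < n then 1 else 0)" for z
    using run_prescan[of N "init_st w" w, OF IN N_def] cnt(2) N0 i0 by (auto simp: s1_def)
  have s1': "ar s1 a = ar (init_st w) a" if "a \<notin> {aSND, aVERT}" for a using that by (simp add: s1_def)
  have "scan_inv N n w s2" unfolding s2_def
  proof (rule run_scan[OF _ N_def N0(1) sw])
    show "vr s1 x = 0" if "x \<in> {vE, vV, vACC, vW, vT}" for x
      using that s1(1) i0(1) by (auto simp: s1_def)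
  qed (use s1 s1' IN i0 cnt len in \<open>auto simp: N_def\<close>)
  then have CTR: "ar s2 aCTR [a, b] = (if a < length es \<and> fst (es ! a) = Suc b then 1 else 0)"
    and BAD: "k < N \<Longrightarrow> ar s2 aBAD [a, k] = (if a < length es \<and> bad_entry N n (es ! a) k then 1 else 0)" for a b k
    unfolding scan_inv_def w scanned_encode by (auto simp: es_def)
  have s2': "ar s2 a = ar s1 a" if "a \<notin> {aSND, aPASS, aCTR, aBAD}" for a using that by (simp add: s2_def)
  have mus: "mus = map (\<lambda>x. mult G (fst x) (snd x)) pl" unfolding mus_def pl_def by (rule multiplicities_pair_list)
  have es_app: "es = map (Pair 0) mus @ entries 1 Ms" by (simp add: es_def)
  have lpl: "length pl = length mus" by (simp add: mus)
  then have lpl_le: "length pl \<le> length es" by (simp add: es_app)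
  have "ends_inv pl s3" unfolding s3_def pl_def pair_list_def
  proof (rule run_ends)
    show "length (concat (map (row n) [0..<n])) < N" using lpl_le N0(4) by (simp add: pl_def pair_list_def)
  qed (use s1 s1' s2' i0 N0 in auto)
  then have END: "ar s3 aEND [a, b] = (if a < length pl \<and> (b = fst (pl ! a) \<or> b = snd (pl ! a)) then 1 else 0)" for a b
    by (simp add: ends_inv_def)
  have s3': "ar s3 a = ar s2 a" if "a \<notin> {aSND, aEND}" for a using that by (simp add: s3_def)

  have blank: "ar s3 a ys = 0" if "a \<in> {aOWN, aHT, aFAIL}" for a ys
  proof -
    have "ar s3 a = ar s2 a" by (rule s3') (use that in auto)
    also have "\<dots> = ar s1 a" by (rule s2') (use that in auto)
    also have "\<dots> = ar (init_st w) a" by (rule s1') (use that in auto)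
    finally show ?thesis using i0(2)[of a ys] that by auto
  qed

  define I where "I = {a. a < length es \<and> fst (es ! a) \<noteq> 0}"
  define J where "J = {..<length pl}"
  define c where "c a = fst (es ! a) - 1" for a
  define m where "m a = snd (es ! a)" for a
  define pe where "pe j = {fst (pl ! j), snd (pl ! j)}" for j
  have es_J: "es ! a = (0, mus ! a)" if "a \<in> J" for a
    using that lpl by (simp add: J_def es_app nth_append)
  have es_I: "a < length es \<Longrightarrow> a \<notin> J \<Longrightarrow> 1 \<le> fst (es ! a)" for a
    using lpl entries_bounds[of "es ! a" 1 Ms] by (auto simp: J_def es_app nth_append)
  have I_alt: "a \<in> I \<longleftrightarrow> a < length es \<and> a \<notin> J" for a
    using es_J es_I by (fastforce simp: I_def)
  have J_sub: "J \<subseteq> {..<length es}" using lpl_le by (auto simp: J_def)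
  have in_I: "c a < n \<and> m a \<in> set (Ms ! c a) \<and> fst (es ! a) = Suc (c a)" if "a \<in> I" for a
  proof -
    have "es ! a \<in> set (entries 1 Ms)" using that lpl by (auto simp: I_alt J_def es_app nth_append)
    from entries_bounds[OF this] show ?thesis by (auto simp: c_def m_def n_def)
  qed
  have pe_bij: "bij_betw pe J (pairs (verts G))"
    using bij_pair_list[of n] by (simp add: V J_def pl_def pe_def[abs_def])
  interpret star_prescription G I J c m pe "\<lambda>v. mset (Ms ! v)"
  proof
    show "image_mset m (mset_set {s \<in> I. c s = v}) = mset (Ms ! v)" if "v \<in> verts G" for v
    proof -
      have v: "v < length Ms" using that V n_def by simp
      have "{s \<in> I. c s = v} = {a. a < length es \<and> fst (es ! a) = Suc v}"
        by (auto simp: I_def c_def)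
      then have "image_mset m (mset_set {s \<in> I. c s = v}) = mset (map snd (filter (\<lambda>x. fst x = Suc v) es))"
        using image_mset_indices[of snd es "\<lambda>x. fst x = Suc v"] by (simp add: m_def[abs_def])
      also have "filter (\<lambda>x. fst x = Suc v) es = filter (\<lambda>x. fst x = 1 + v) (entries 1 Ms)"
        by (simp add: es_app filter_map comp_def)
      finally show ?thesis unfolding entries_filter[OF v] .
    qed
    show "0 < m s" if "s \<in> I" for s
      using in_I[OF that] pos n_def by auto
    show "I \<inter> J = {}" using I_alt by auto
    show "c ` I \<subseteq> verts G" using in_I V by auto
    show "finite (verts G)" by (simp add: V)
    show "finite I" by (simp add: I_def)
  qed (fact pe_bij mg)+

  have mu: "count (edges G) (pe a) = mus ! a" if "a \<in> J" for a
    using that by (simp add: mus J_def mult_def pe_def)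
  \<comment> \<open>Loads are less than \<open>N\<close>, so the other nodes are never overloaded.\<close>
  define cap where "cap a = (if a \<in> I \<union> J then slack a else int N)" for a
  have inc_sub: "inc \<subseteq> {..<N} \<times> {..<N}" using I_alt J_sub N0(4) by (fastforce simp: inc_def)
  interpret network N inc cap
    by unfold_locales (use inc_sub inc_antisym in auto)
  have IJ_N: "I \<union> J \<subseteq> {..<N}" using I_alt J_sub N0(4) by fastforce

  have "simulates s4 inc (\<lambda>_. 0)"
    unfolding simulates_def
  proof (intro conjI allI impI)
    show "valid inc (\<lambda>_. 0)" by (rule valid_start)
    show "tracks N inc (\<lambda>_. 0) s4" unfolding tracks_def
    proof (intro conjI allI impI)
      fix a b assume ab: "a < N" "b < N"
      have zero: "ar s3 aOWN [a, b] = 0" by (rule blank) simp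
      have "(\<exists>i<N. \<exists>j<N. \<exists>y<N. [a, b] = [i, j] \<and> ar s3 aCTR [i, y] = 1 \<and> ar s3 aEND [j, y] = 1) \<longleftrightarrow> (a, b) \<in> inc"
      proof
        assume "\<exists>i<N. \<exists>j<N. \<exists>y<N. [a, b] = [i, j] \<and> ar s3 aCTR [i, y] = 1 \<and> ar s3 aEND [j, y] = 1"
        then obtain y where y: "ar s2 aCTR [a, y] = 1" "ar s3 aEND [b, y] = 1" using s3'[of aCTR] by auto
        have "a < length es \<and> fst (es ! a) = Suc y" using CTR[of a y] y(1) by (metis zero_neq_one)
        then have "a \<in> I" "c a = y" by (simp_all add: I_def c_def)
        moreover have "b < length pl \<and> (y = fst (pl ! b) \<or> y = snd (pl ! b))"
          using END[of b y] y(2) by (metis zero_neq_one)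
        then have "b \<in> J" "y \<in> pe b" by (simp_all add: J_def pe_def)
        ultimately show "(a, b) \<in> inc" by (simp add: inc_def)
      next
        assume "(a, b) \<in> inc"
        then have ab': "a \<in> I" "b \<in> J" "c a \<in> pe b" by (auto simp: inc_def)
        have "ar s3 aCTR [a, c a] = 1"
          using in_I[OF ab'(1)] ab'(1) s3'[of aCTR] CTR[of a "c a"] by (simp add: I_def)
        moreover have "ar s3 aEND [b, c a] = 1"
          using ab'(2,3) END[of b "c a"] by (simp add: J_def pe_def)
        moreover have "c a < N" using in_I[OF ab'(1)] N0(2) by simp
        ultimately show "\<exists>i<N. \<exists>j<N. \<exists>y<N. [a, b] = [i, j] \<and> ar s3 aCTR [i, y] = 1 \<and> ar s3 aEND [j, y] = 1"
          using ab by blast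
      qed
      then show "ar s4 aOWN [a, b] = (if (a, b) \<in> inc then 1 else 0)"
        unfolding s4_def run_own using zero by simp
    next
      fix a t show "ar s4 aHT [a, t] = (if t < 0 then 1 else 0)" using blank[of aHT] by (simp add: s4_def)
    qed
  next
    fix a k assume ak: "a < N" "k < N"
    have "ar s4 aBAD [a, k] = (if a < length es \<and> bad_entry N n (es ! a) k then 1 else 0)"
      using BAD[OF ak(2)] s3'[of aBAD] by (simp add: s4_def)
    moreover have "a < length es \<and> bad_entry N n (es ! a) k \<longleftrightarrow> cap a < int k"
    proof -
      consider "a \<in> J" | "a \<in> I" | "a \<ge> length es" "a \<notin> I \<union> J" using I_alt J_sub by fastforce
      then show ?thesis
      proof cases
        case 1
        then have "a \<notin> I" "a < length es" using I_alt J_sub by auto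
        then have "cap a = int (mus ! a)" using 1 mu by (simp add: cap_def slack_def)
        then show ?thesis using 1 es_J[OF 1] ak \<open>a < length es\<close> by (auto simp: bad_entry_def capped_def min_def)
      next
        case 2
        then have "cap a = int n - 1 - int (m a)" unfolding cap_def slack_def using 2 by (simp add: V)
        moreover have "bad_entry N n (es ! a) k \<longleftrightarrow> n \<le> m a + k"
          using in_I[OF 2] N0(3) by (auto simp: bad_entry_def capped_def m_def min_def)
        ultimately show ?thesis using 2 by (auto simp: I_def)
      next
        case 3
        then show ?thesis using ak by (simp add: cap_def)
      qed
    qed
    ultimately show "ar s4 aBAD [a, k] = (if cap a < int k then 1 else 0)" by simp
  next
    assume "ar s4 aFAIL [] = 1"
    then show "\<exists>W. obstruction W" using blank[of aFAIL] by (simp add: s4_def)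
  qed
  then have "progress 0 s4" unfolding progress_def
    by (intro exI[of _ inc] exI[of _ "\<lambda>_. 0"]) (simp add: potential_def)
  from rounds_result[OF this N0(1)] obtain R h where R: "simulates s5 R h"
    and fin: "ar s5 aFAIL [] = 1 \<or> (\<forall>a<N. \<not> excess R a)"
    unfolding s5_def[symmetric] by blast

  have ot5: "ot s5 = []" using i0 by (simp add: s5_def s4_def s3_def s2_def s1_def)
  have result: "run N solve (init_st w) = run N (IfA aFAIL [] 1 (Emit 1) (Seq (Emit 2) emit_stars)) s5"
    by (simp add: solve_def s5_def s4_def s3_def s2_def s1_def)
  show ?thesis
  proof (cases "ar s5 aFAIL [] = 1")
    case True
    then obtain W where W: "obstruction W" using R by (auto simp: simulates_def)
    have "\<not> hall"
    proof (rule obstruction_not_hall[where cap = cap])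
      show "finite W" using W by (auto simp: obstruction_def intro: finite_subset)
    qed (use W in \<open>auto simp: obstruction_def cap_def\<close>)
    then have "\<nexists>P. star_packing G (\<lambda>v. mset (Ms ! v)) P" using packing_iff_hall by blast
    moreover have "ot (run N solve (init_st w)) = [1]" using True ot5 unfolding result by simp
    ultimately show ?thesis by (simp add: N_def)
  next
    case False
    then have ex: "\<not> excess R a" if "a < N" for a using fin that by blast
    have v: "valid R h" and tr: "tracks N R h s5" using R by (auto simp: simulates_def)
    have o: "orients inc R" using v by (simp add: valid_def)
    have "feasible (leaves R)"
    proof (rule orientation_feasible[OF o])
      show "load R p \<le> count (edges G) (pe p)" if "p \<in> J" for p
      proof -
        have "p < N" "p \<notin> I" using that IJ_N I_alt by auto
        then show ?thesis using ex[of p] that by (simp add: excess_def cap_def slack_def)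
      qed
      show "int (load R s) = slack s" if s: "s \<in> I" for s
      proof -
        have sN: "s < N" using s IJ_N by auto
        have cs: "cap s = slack s" using s by (simp add: cap_def)
        have "cap s \<le> load inc s" unfolding cs using load_inc[OF s] s by (simp add: slack_def)
        moreover have "\<forall>i\<in>{..<N}. cap i \<le> load inc i \<or> 0 < h i \<longrightarrow> cap i \<le> load R i"
          using v unfolding valid_def by blast
        ultimately have "cap s \<le> load R s" using sN by blast
        then show ?thesis using ex[OF sN] cs by (simp add: excess_def)
      qed
    qed
    moreover define ls where "ls i = leaf_list N s5 i (c i)" for i
    have OWN5: "ar s5 aOWN [a, b] = 1 \<longleftrightarrow> (a, b) \<in> R" if "a < N" "b < N" for a b
      using tr that by (simp add: tracks_def)
    have END5: "ar s5 aEND [a, b] = 1 \<longleftrightarrow> a \<in> J \<and> b \<in> pe a" for a b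
      using END by (simp add: s5_def s4_def J_def pe_def)
    have CTR5: "ar s5 aCTR [a, b] = 1 \<longleftrightarrow> a \<in> I \<and> b = c a" for a b
      using CTR[of a b] s3'[of aCTR] by (auto simp: s5_def s4_def I_def c_def)
    have pe_V: "pe j \<subseteq> {..<n}" if "j \<in> J" for j
    proof -
      have "pe j \<in> pairs {..<n}" using pe_bij that by (auto simp: bij_betw_def V)
      then show ?thesis by (auto simp: pairs_def)
    qed
    have pe_eq: "pe j = {c i, u}" if "j \<in> J" "u \<in> pe j" "u \<noteq> c i" "c i \<in> pe j" for i j u
      using that by (auto simp: pe_def)
    have own_J: "j \<in> J \<and> c i \<in> pe j" if "(j, i) \<in> R" "i \<in> I" for i j
      using o that I_alt by (auto simp: orients_def inc_def)
    have ls: "distinct (ls i) \<and> set (ls i) = leaves R i" if i: "i \<in> I" for i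
    proof
      have iN: "i < N" using i IJ_N by auto
      let ?f = "\<lambda>j. if ar s5 aOWN [j, i] = 1 then filter (\<lambda>u. ar s5 aEND [j, u] = 1 \<and> u \<noteq> c i) [0..<N] else []"
      have mem: "u \<in> set (?f j) \<longleftrightarrow> ar s5 aOWN [j, i] = 1 \<and> u < N \<and> j \<in> J \<and> u \<in> pe j \<and> u \<noteq> c i" for u j
        using END5[of j u] by auto
      have one: "(j, i) \<in> R \<and> pe j = {c i, u}" if "u \<in> set (?f j)" for u j
      proof -
        have u: "ar s5 aOWN [j, i] = 1" "j \<in> J" "u \<in> pe j" "u \<noteq> c i" using that mem by blast+
        then have "(j, i) \<in> R" using OWN5 iN IJ_N by auto
        then show ?thesis using own_J i pe_eq u by blast
      qed
      have disj: "set (?f j) \<inter> set (?f k) = {}" if jk: "j \<noteq> k" for j k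
      proof (rule ccontr)
        assume "set (?f j) \<inter> set (?f k) \<noteq> {}"
        then obtain u where u: "u \<in> set (?f j)" "u \<in> set (?f k)" by blast
        have "pe j = pe k" using one[OF u(1)] one[OF u(2)] by metis
        moreover have "j \<in> J" "k \<in> J" using u mem by blast+
        ultimately show False using bij_betw_imp_inj_on[OF pe_bij] jk inj_onD by metis
      qed
      show "distinct (ls i)" unfolding ls_def leaf_list_def
        by (rule distinct_concat_upt) (simp, rule disj)
      have ls_mem: "u \<in> set (ls i) \<longleftrightarrow> (\<exists>j<N. u \<in> set (?f j))" for u
        unfolding ls_def leaf_list_def by auto
      show "set (ls i) = leaves R i"
      proof (intro set_eqI iffI)
        fix u assume "u \<in> set (ls i)"
        then obtain j where j: "u \<in> set (?f j)" using ls_mem by blast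
        then have "u \<in> pe j" "u \<noteq> c i" "j \<in> J" using mem by blast+
        then show "u \<in> leaves R i" using one[OF j] pe_V unfolding leaves_def using V by auto
      next
        fix u assume "u \<in> leaves R i"
        then obtain j where j: "j \<in> J" "pe j = {c i, u}" "(j, i) \<in> R" "u \<noteq> c i" "u < n"
          unfolding leaves_def using V by auto
        then have "ar s5 aOWN [j, i] = 1" "j < N" using OWN5 iN IJ_N by auto
        then have "u \<in> set (?f j)" unfolding mem using j N0(2) by simp
        then show "u \<in> set (ls i)" using ls_mem \<open>j < N\<close> by blast
      qed
    qed
    ultimately have pack: "star_packing G (\<lambda>v. mset (Ms ! v)) (image_mset (\<lambda>s. star_of (c s, ls s)) (mset_set I))"
      by (intro feasible_packing) auto
    define S where "S = map (\<lambda>i. (c i, ls i)) (filter (\<lambda>i. i \<in> I) [0..<N])"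
    have "mset (filter (\<lambda>i. i \<in> I) [0..<N]) = mset_set I"
    proof -
      have "set (filter (\<lambda>i. i \<in> I) [0..<N]) = I" using IJ_N by auto
      then show ?thesis by (metis distinct_filter distinct_upt mset_set_set)
    qed
    then have "image_mset (\<lambda>s. star_of (c s, ls s)) (mset_set I) = mset (map star_of S)"
      by (simp add: S_def image_mset.compositionality comp_def flip: mset_filter del: star_of.simps)
    then have pack': "star_packing G (\<lambda>v. mset (Ms ! v)) (mset (map star_of S))" using pack by simp
    let ?g = "\<lambda>i v. v # leaf_list N (emit 2 s5) i v"
    have "leaf_list N (emit 2 s5) = leaf_list N s5" by (rule leaf_list_cong) simp_all
    then have gls: "?g i (c i) = c i # ls i" for i by (simp add: ls_def)
    have row: "concat (map (\<lambda>v. if ar (emit 2 s5) aCTR [i, v] = 1 then [?g i v] else []) [0..<N])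
        = (if i \<in> I then [c i # ls i] else [])" for i
    proof -
      have "c i < N" if "i \<in> I" using in_I[OF that] N0(2) by simp
      then have "filter (\<lambda>v. i \<in> I \<and> v = c i) [0..<N] = (if i \<in> I then [c i] else [])"
        using filter_upt_eq[of "c i" N] by simp
      then show ?thesis unfolding concat_map_if by (simp add: CTR5 gls del: One_nat_def)
    qed
    have "ot (run N solve (init_st w)) = 2 # encode_lists (concat (map (\<lambda>i. concat (map (\<lambda>v.
        if ar (emit 2 s5) aCTR [i, v] = 1 then [?g i v] else []) [0..<N])) [0..<N]))"
      using False ot5 unfolding result by (simp add: run_emit_stars)
    also have "\<dots> = 2 # encode_lists (map (\<lambda>i. c i # ls i) (filter (\<lambda>i. i \<in> I) [0..<N]))"
      unfolding row unfolding concat_map_if ..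
    also have "\<dots> = encode_answer (Some S)" by (simp add: S_def comp_def)
    finally show ?thesis using pack' by (auto simp: N_def simp del: encode_answer.simps)
  qed
qed

theorem theorem2:
  "(\<forall>(G :: 'a multigraph) (M :: 'a \<Rightarrow> nat multiset).
      multigraph G \<and> (\<forall>v \<in> verts G. \<forall>m \<in># M v. m > 0) \<longrightarrow>
      ((\<exists>P. star_packing G M P) \<longleftrightarrow>
       (\<forall>f :: 'a \<Rightarrow> nat. (\<forall>v \<in> verts G. f v \<in> {0..size (M v)}) \<longrightarrow>
          (\<Sum>v \<in> verts G. sum_largest (f v) (M v))
            \<le> (\<Sum>e \<in> pairs (verts G). min (\<Sum>v \<in> e. f v) (count (edges G) e))))) \<and>
   poly_time_solvable instances encode_instance correct_answer"
proof
  have "poly_time_solvable instances encode_instance correct_answer"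
  proof (rule poly_time_solvable_run[OF well_formed_solve])
    fix x assume x: "x \<in> instances"
    obtain G Ms where e: "x = (G, Ms)" by (cases x)
    have "encode_lists (xs # xss) \<noteq> []" for xs xss by (simp add: encode_lists_Cons)
    then have "encode_instance x \<noteq> []" by (simp add: e)
    moreover have "set (encode_lists xss) \<subseteq> {0<..<5}" for xss using set_encode_lists[of xss] by auto
    then have "set (encode_instance x) \<subseteq> {0<..<5}" by (simp only: e encode_instance.simps)
    ultimately show "encode_instance x \<noteq> [] \<and> set (encode_instance x) \<subseteq> {0<..<5} \<and>
        correct_answer x (ot (run (length (encode_instance x)) solve (init_st (encode_instance x))))"
      using solve_correct x unfolding e by blast
  qed (simp_all add: arity_def)
  then show "poly_time_solvable instances encode_instance correct_answer" .
qed (use star_packing_iff in blast)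

end
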